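(* Let $S_{1,1}$ be a one-punctured torus, with standard generators $a,b$ of the free group $\pi_1(S_{1,1})$, and let $g$ be a complete hyperbolic metric of finite area on $S_{1,1}$. If all three numbers $\mathrm{Tr}_g(a)$, $\mathrm{Tr}_g(b)$ and $\mathrm{Tr}_g(ab)$ are geometric Salem numbers, then $g$ is arithmetic.
   Context: For $\gamma\in\pi_1(S_{1,1})$, let $\ell_g(\gamma)$ be the length of the closed geodesic freely homotopic to $\gamma$ (with $\ell_g(\gamma)=0$ if $\gamma$ is parabolic or trivial), and put $\mathrm{Tr}_g(\gamma)=2\cosh(\ell_g(\gamma)/2)$; this is the absolute value of the trace of a matrix in $\operatorname{SL}(2,\mathbb{R})$ representing $\gamma$. Standard generators $a,b$ are free generators of $\pi_1(S_{1,1})$ whose commutator $[a,b]$ represents a loop around the puncture. A real algebraic integer $x$ is a geometric Salem number if $x>2$ and all of its Galois conjugates over $\mathbb{Q}$ other than $x$ itself are real with absolute value less than $2$. Arithmeticity: let $k$ be a totally real number field and $A$ a quaternion algebra over $k$ which is unramified at exactly one real place (the identity embedding) and ramified at all the other real places, so that $A\otimes_{\mathbb{Q}}\mathbb{R}\cong M_2(\mathbb{R})\oplus\mathbf{H}\oplus\cdots\oplus\mathbf{H}$, with $\mathbf{H}$ Hamilton's quaternions. For an order $\mathcal{O}$ in $A$, let $\mathcal{O}^1$ be its group of elements of reduced norm $1$; its image in $\operatorname{PSL}(2,\mathbb{R})$ under projection to the first factor is a lattice. A Fuchsian lattice is arithmetic if it is commensurable (up to conjugation) with such an image. The metric $g$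 is arithmetic if the Fuchsian lattice $\pi_1(S_{1,1})\subset\operatorname{PSL}(2,\mathbb{R})$ that it determines is arithmetic. *)

theory Defs
  imports
    "HOL-Analysis.Analysis"
    "HOL-Algebra.Coset"
    "HOL-Algebra.Generated_Groups"
    "HOL-Computational_Algebra.Polynomial"
begin

section \<open>The hyperbolic plane and \<open>PSL(2,\<real>)\<close>\<close>

definition upper_half :: "complex set" where
  "upper_half = {z. Im z > 0}"

definition hdist :: "complex \<Rightarrow> complex \<Rightarrow> real" where
  "hdist z w = arcosh (1 + (cmod (z - w))\<^sup>2 / (2 * Im z * Im w))"

text \<open>The hyperbolic area form \<open>dx dy / y\<^sup>2\<close>; it is only meant for subsets of
  \<^const>\<open>upper_half\<close>.\<close>
definition harea :: "complex measure" where
  "harea = density lborel (\<lambda>z. ennreal (1 / (Im z)\<^sup>2))"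

definition moebius :: "real^2^2 \<Rightarrow> complex \<Rightarrow> complex" where
  "moebius M z = (of_real (M$1$1) * z + of_real (M$1$2)) / (of_real (M$2$1) * z + of_real (M$2$2))"

definition SL2R :: "(real^2^2) monoid" where
  "SL2R = \<lparr>carrier = {M. det M = 1}, mult = (**), one = mat 1\<rparr>"

text \<open>Elements of \<open>PSL(2,\<real>)\<close> are the cosets \<open>{M, - M}\<close>; both members give the same
  \<^const>\<open>moebius\<close> map.\<close>
definition PSL2R :: "(real^2^2) set monoid" where
  "PSL2R = SL2R Mod {mat 1, - mat 1}"

definition psl_class :: "real^2^2 \<Rightarrow> (real^2^2) set" where
  "psl_class M = {mat 1, - mat 1} #>\<^bsub>SL2R\<^esub> M"


section \<open>Hyperbolic metrics on a surface\<close>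

text \<open>A Riemannian metric is represented by its distance function \<open>d\<close> on the surface
  \<open>S\<close>.\<close>

definition curve_length :: "('a \<Rightarrow> 'a \<Rightarrow> real) \<Rightarrow> (real \<Rightarrow> 'a) \<Rightarrow> ennreal" where
  "curve_length d c =
     (SUP (n, t) \<in> {(n :: nat, t :: nat \<Rightarrow> real). mono t \<and> range t \<subseteq> {0..1}}.
        \<Sum>i<n. ennreal (d (c (t i)) (c (t (Suc i)))))"

definition isometric_embedding ::
    "complex set \<Rightarrow> ('a \<Rightarrow> 'a \<Rightarrow> real) \<Rightarrow> (complex \<Rightarrow> 'a) \<Rightarrow> bool" where
  "isometric_embedding V d f \<longleftrightarrow> (\<forall>z\<in>V. \<forall>w\<in>V. d (f z) (f w) = hdist z w)"

text \<open>Complete, inducing the given topology, a path metric, and locally isometric to the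
  hyperbolic plane.\<close>
definition complete_hyperbolic_metric ::
    "'a::topological_space set \<Rightarrow> ('a \<Rightarrow> 'a \<Rightarrow> real) \<Rightarrow> bool" where
  "complete_hyperbolic_metric S d \<longleftrightarrow>
     Metric_space S d \<and>
     Metric_space.mtopology S d = top_of_set S \<and>
     Metric_space.mcomplete S d \<and>
     (\<forall>x\<in>S. \<forall>y\<in>S. ennreal (d x y) =
        (INF c \<in> {c. path c \<and> path_image c \<subseteq> S \<and> pathstart c = x \<and> pathfinish c = y}.
           curve_length d c)) \<and>
     (\<forall>x\<in>S. \<exists>r>0. \<exists>z\<in>upper_half. \<exists>f.
        isometric_embedding {w \<in> upper_half. hdist z w < r} d f \<and>
        f ` {w \<in> upper_half. hdist z w < r} = Metric_space.mball S d x r)"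

text \<open>The area of \<open>S\<close> as the supremum of the total areas of finitely many pairwise disjoint
  pieces of \<open>S\<close> that are isometric to Borel subsets of the hyperbolic plane.  (A hyperbolic
  surface is a countable disjoint union of such pieces.)\<close>
definition surface_area :: "'a set \<Rightarrow> ('a \<Rightarrow> 'a \<Rightarrow> real) \<Rightarrow> ennreal" where
  "surface_area S d =
     (SUP (n, V, f) \<in> {(n :: nat, V :: nat \<Rightarrow> complex set, f :: nat \<Rightarrow> complex \<Rightarrow> 'a).
          (\<forall>i<n. V i \<in> sets borel \<and> V i \<subseteq> upper_half \<and> f i ` V i \<subseteq> S \<and>
                 isometric_embedding (V i) d (f i)) \<and>
          disjoint_family_on (\<lambda>i. f i ` V i) {..<n}}.
        \<Sum>i<n. emeasure harea (V i))"

text \<open>\<open>p\<close> identifies \<open>S\<close> isometrically with the quotient of the hyperbolic plane by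
  \<open>\<Gamma> \<subseteq> PSL(2,\<real>)\<close>, i.e. \<open>\<Gamma>\<close> is the image of the fundamental group of \<open>S\<close> under the
  holonomy of the metric.\<close>
definition uniformizes ::
    "'a::topological_space set \<Rightarrow> ('a \<Rightarrow> 'a \<Rightarrow> real) \<Rightarrow> (complex \<Rightarrow> 'a) \<Rightarrow> (real^2^2) set set \<Rightarrow> bool"
  where
  "uniformizes S d p \<Gamma> \<longleftrightarrow>
     covering_space upper_half p S \<and>
     (\<forall>z\<in>upper_half. \<exists>r>0. isometric_embedding {w \<in> upper_half. hdist z w < r} d p) \<and>
     subgroup \<Gamma> PSL2R \<and>
     (\<forall>z\<in>upper_half. \<forall>w\<in>upper_half. p z = p w \<longleftrightarrow> (\<exists>P\<in>\<Gamma>. \<exists>M\<in>P. moebius M z = w))"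


section \<open>Fundamental group, geodesic lengths and traces\<close>

definition homotopy_class :: "'a::topological_space set \<Rightarrow> (real \<Rightarrow> 'a) \<Rightarrow> (real \<Rightarrow> 'a) set" where
  "homotopy_class S f = {h. homotopic_paths S f h}"

definition fundamental_group :: "'a::topological_space set \<Rightarrow> 'a \<Rightarrow> (real \<Rightarrow> 'a) set monoid" where
  "fundamental_group S x0 =
     \<lparr>carrier = homotopy_class S `
        {f. path f \<and> path_image f \<subseteq> S \<and> pathstart f = x0 \<and> pathfinish f = x0},
      mult = (\<lambda>A B. {h. \<exists>f\<in>A. \<exists>g\<in>B. homotopic_paths S (f +++ g) h}),
      one = homotopy_class S (\<lambda>_. x0)\<rparr>"

text \<open>A closed geodesic of length \<open>L\<close>, parametrized by arc length.  It need not be simple or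
  primitive.\<close>
definition closed_geodesic :: "'a set \<Rightarrow> ('a \<Rightarrow> 'a \<Rightarrow> real) \<Rightarrow> real \<Rightarrow> (real \<Rightarrow> 'a) \<Rightarrow> bool" where
  "closed_geodesic S d L c \<longleftrightarrow>
     L > 0 \<and> range c \<subseteq> S \<and> (\<forall>t. c (t + L) = c t) \<and>
     (\<forall>t. \<exists>e>0. \<forall>s\<in>{t-e<..<t+e}. \<forall>s'\<in>{t-e<..<t+e}. d (c s) (c s') = \<bar>s - s'\<bar>)"

definition geodesic_length_rel ::
    "'a::topological_space set \<Rightarrow> ('a \<Rightarrow> 'a \<Rightarrow> real) \<Rightarrow> (real \<Rightarrow> 'a) set \<Rightarrow> real \<Rightarrow> bool" where
  "geodesic_length_rel S d \<gamma> L \<longleftrightarrow>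
     (\<exists>c. closed_geodesic S d L c \<and> (\<exists>f\<in>\<gamma>. homotopic_loops S f (\<lambda>t. c (L * t))))"

text \<open>On a complete hyperbolic surface, the classes without closed geodesic are exactly the
  parabolic and the trivial ones.\<close>
definition geodesic_length ::
    "'a::topological_space set \<Rightarrow> ('a \<Rightarrow> 'a \<Rightarrow> real) \<Rightarrow> (real \<Rightarrow> 'a) set \<Rightarrow> real" where
  "geodesic_length S d \<gamma> =
     (if \<exists>L. geodesic_length_rel S d \<gamma> L then (THE L. geodesic_length_rel S d \<gamma> L) else 0)"

definition Tr :: "'a::topological_space set \<Rightarrow> ('a \<Rightarrow> 'a \<Rightarrow> real) \<Rightarrow> (real \<Rightarrow> 'a) set \<Rightarrow> real" where
  "Tr S d \<gamma> = 2 * cosh (geodesic_length S d \<gamma> / 2)"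


section \<open>The one-punctured torus and its standard generators\<close>

definition punctured_torus :: "(complex \<times> complex) set" where
  "punctured_torus = sphere 0 1 \<times> sphere 0 1 - {(1, 1)}"

text \<open>The unit circle around the origin in the chart \<open>(s,t) \<mapsto> (e\<^sup>i\<^sup>s, e\<^sup>i\<^sup>t)\<close>, which is injective
  on the open square of side \<open>2\<pi>\<close> centred at the origin and sends the origin to the
  puncture.\<close>
definition puncture_loop :: "real \<Rightarrow> complex \<times> complex" where
  "puncture_loop t = (cis (cos (2 * pi * t)), cis (sin (2 * pi * t)))"

definition around_puncture :: "(real \<Rightarrow> complex \<times> complex) set \<Rightarrow> bool" where
  "around_puncture \<gamma> \<longleftrightarrow>
     (\<exists>f\<in>\<gamma>. homotopic_loops punctured_torus f puncture_loop \<or>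
            homotopic_loops punctured_torus f (reversepath puncture_loop))"

text \<open>A word is a list of letters \<open>(x, e)\<close>, standing for \<open>x\<close> if \<open>e\<close> holds and for its inverse
  otherwise.\<close>
definition word_eval :: "('g, 'm) monoid_scheme \<Rightarrow> ('g \<times> bool) list \<Rightarrow> 'g" where
  "word_eval G w =
     foldr (\<lambda>(x, e) y. (if e then x else inv\<^bsub>G\<^esub> x) \<otimes>\<^bsub>G\<^esub> y) w \<one>\<^bsub>G\<^esub>"

definition reduced_word :: "('g \<times> bool) list \<Rightarrow> bool" where
  "reduced_word w \<longleftrightarrow> successively (\<lambda>(x, e) (y, e'). x = y \<longrightarrow> e = e') w"

definition free_basis :: "('g, 'm) monoid_scheme \<Rightarrow> 'g set \<Rightarrow> bool" where
  "free_basis G X \<longleftrightarrow>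
     X \<subseteq> carrier G \<and> generate G X = carrier G \<and>
     (\<forall>w. w \<noteq> [] \<and> set w \<subseteq> X \<times> UNIV \<and> reduced_word w \<longrightarrow> word_eval G w \<noteq> \<one>\<^bsub>G\<^esub>)"

definition commutator :: "('g, 'm) monoid_scheme \<Rightarrow> 'g \<Rightarrow> 'g \<Rightarrow> 'g" where
  "commutator G x y = x \<otimes>\<^bsub>G\<^esub> y \<otimes>\<^bsub>G\<^esub> inv\<^bsub>G\<^esub> x \<otimes>\<^bsub>G\<^esub> inv\<^bsub>G\<^esub> y"

definition standard_generators ::
    "complex \<times> complex \<Rightarrow> (real \<Rightarrow> complex \<times> complex) set \<Rightarrow>
     (real \<Rightarrow> complex \<times> complex) set \<Rightarrow> bool" where
  "standard_generators x0 a b \<longleftrightarrow>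
     a \<noteq> b \<and> free_basis (fundamental_group punctured_torus x0) {a, b} \<and>
     around_puncture (commutator (fundamental_group punctured_torus x0) a b)"


section \<open>Geometric Salem numbers\<close>

definition galois_conjugate :: "real \<Rightarrow> complex \<Rightarrow> bool" where
  "galois_conjugate x y \<longleftrightarrow>
     (\<exists>q :: rat poly. irreducible q \<and>
        poly (map_poly of_rat q) (complex_of_real x) = 0 \<and> poly (map_poly of_rat q) y = 0)"

definition geometric_Salem :: "real \<Rightarrow> bool" where
  "geometric_Salem x \<longleftrightarrow>
     algebraic_int x \<and> x > 2 \<and>
     (\<forall>y. galois_conjugate x y \<and> y \<noteq> complex_of_real x \<longrightarrow> y \<in> \<real> \<and> cmod y < 2)"


section \<open>Quaternion algebras and arithmetic groups\<close>

text \<open>The field comes with a distinguished real place, so it is taken to be a subfield of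
  \<open>\<real>\<close>.\<close>
definition real_number_field :: "real set \<Rightarrow> bool" where
  "real_number_field k \<longleftrightarrow>
     1 \<in> k \<and> (\<forall>x\<in>k. \<forall>y\<in>k. x - y \<in> k \<and> x * y \<in> k) \<and> (\<forall>x\<in>k. inverse x \<in> k) \<and>
     (\<exists>B. finite B \<and> k = range (\<lambda>c :: real \<Rightarrow> rat. \<Sum>b\<in>B. of_rat (c b) * b))"

definition field_embedding :: "real set \<Rightarrow> (real \<Rightarrow> 'b::field) \<Rightarrow> bool" where
  "field_embedding k \<sigma> \<longleftrightarrow>
     \<sigma> 1 = 1 \<and> (\<forall>x\<in>k. \<forall>y\<in>k. \<sigma> (x + y) = \<sigma> x + \<sigma> y \<and> \<sigma> (x * y) = \<sigma> x * \<sigma> y)"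

definition totally_real :: "real set \<Rightarrow> bool" where
  "totally_real k \<longleftrightarrow> (\<forall>\<sigma> :: real \<Rightarrow> complex. field_embedding k \<sigma> \<longrightarrow> \<sigma> ` k \<subseteq> \<real>)"

text \<open>The product of the quaternion algebra with basis \<open>1, i, j, ij\<close> and relations
  \<open>i\<^sup>2 = \<alpha>\<close>, \<open>j\<^sup>2 = \<beta>\<close>, \<open>ji = - ij\<close>, over \<open>\<real>\<close>.  The algebra over a subfield
  \<open>k\<close> containing \<open>\<alpha>\<close> and \<open>\<beta>\<close> consists of the vectors with coordinates in \<open>k\<close>.\<close>
definition quat_mult :: "real \<Rightarrow> real \<Rightarrow> real^4 \<Rightarrow> real^4 \<Rightarrow> real^4" where
  "quat_mult \<alpha> \<beta> x y = vector
     [x$1 * y$1 + \<alpha> * (x$2 * y$2) + \<beta> * (x$3 * y$3) - \<alpha> * \<beta> * (x$4 * y$4),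
      x$1 * y$2 + x$2 * y$1 - \<beta> * (x$3 * y$4) + \<beta> * (x$4 * y$3),
      x$1 * y$3 + x$3 * y$1 + \<alpha> * (x$2 * y$4) - \<alpha> * (x$4 * y$2),
      x$1 * y$4 + x$4 * y$1 + x$2 * y$3 - x$3 * y$2]"

definition quat_one :: "real^4" where
  "quat_one = vector [1, 0, 0, 0]"

definition quat_points :: "real set \<Rightarrow> (real^4) set" where
  "quat_points k = {x. \<forall>i. x$i \<in> k}"

definition reduced_norm :: "real \<Rightarrow> real \<Rightarrow> real^4 \<Rightarrow> real" where
  "reduced_norm \<alpha> \<beta> x = (x$1)\<^sup>2 - \<alpha> * (x$2)\<^sup>2 - \<beta> * (x$3)\<^sup>2 + \<alpha> * \<beta> * (x$4)\<^sup>2"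

definition algebra_iso ::
    "('a::real_vector \<Rightarrow> 'a \<Rightarrow> 'a) \<Rightarrow> ('b::real_vector \<Rightarrow> 'b \<Rightarrow> 'b) \<Rightarrow> ('a \<Rightarrow> 'b) \<Rightarrow> bool" where
  "algebra_iso m m' f \<longleftrightarrow> linear f \<and> bij f \<and> (\<forall>x y. f (m x y) = m' (f x) (f y))"

text \<open>At a real place \<open>\<sigma>\<close>, the completion of the algebra with parameters \<open>\<alpha>\<close>, \<open>\<beta>\<close> is the real
  quaternion algebra with parameters \<open>\<sigma> \<alpha>\<close>, \<open>\<sigma> \<beta>\<close>; Hamilton's quaternions have parameters
  \<open>-1\<close>, \<open>-1\<close>.\<close>
definition ramified_at :: "real \<Rightarrow> real \<Rightarrow> (real \<Rightarrow> real) \<Rightarrow> bool" where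
  "ramified_at \<alpha> \<beta> \<sigma> \<longleftrightarrow>
     (\<exists>f. algebra_iso (quat_mult (\<sigma> \<alpha>) (\<sigma> \<beta>)) (quat_mult (-1) (-1)) f)"

text \<open>A subring that is finitely generated as a \<open>\<int>\<close>-module and spans the algebra over
  \<open>\<rat>\<close>.\<close>
definition quat_order :: "real set \<Rightarrow> real \<Rightarrow> real \<Rightarrow> (real^4) set \<Rightarrow> bool" where
  "quat_order k \<alpha> \<beta> R \<longleftrightarrow>
     R \<subseteq> quat_points k \<and> quat_one \<in> R \<and>
     (\<forall>x\<in>R. \<forall>y\<in>R. x - y \<in> R \<and> quat_mult \<alpha> \<beta> x y \<in> R) \<and>
     (\<exists>B. finite B \<and> R = range (\<lambda>c :: real^4 \<Rightarrow> int. \<Sum>b\<in>B. of_int (c b) *\<^sub>R b)) \<and>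
     (\<forall>x\<in>quat_points k. \<exists>n::nat. n > 0 \<and> of_nat n *\<^sub>R x \<in> R)"

definition arithmetic_model :: "(real^2^2) set set \<Rightarrow> bool" where
  "arithmetic_model \<Delta> \<longleftrightarrow>
     (\<exists>k \<alpha> \<beta> R \<theta>.
        real_number_field k \<and> totally_real k \<and>
        \<alpha> \<in> k \<and> \<beta> \<in> k \<and> \<alpha> \<noteq> 0 \<and> \<beta> \<noteq> 0 \<and>
        algebra_iso (quat_mult \<alpha> \<beta>) ((**) :: real^2^2 \<Rightarrow> real^2^2 \<Rightarrow> real^2^2) \<theta> \<and>
        (\<forall>\<sigma>. field_embedding k \<sigma> \<and> (\<exists>x\<in>k. \<sigma> x \<noteq> x) \<longrightarrow> ramified_at \<alpha> \<beta> \<sigma>) \<and>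
        quat_order k \<alpha> \<beta> R \<and>
        \<Delta> = (\<lambda>x. psl_class (\<theta> x)) ` {x\<in>R. reduced_norm \<alpha> \<beta> x = 1})"

definition commensurable :: "('g, 'm) monoid_scheme \<Rightarrow> 'g set \<Rightarrow> 'g set \<Rightarrow> bool" where
  "commensurable G H K \<longleftrightarrow>
     finite (rcosets\<^bsub>G\<lparr>carrier := H\<rparr>\<^esub> (H \<inter> K)) \<and> finite (rcosets\<^bsub>G\<lparr>carrier := K\<rparr>\<^esub> (H \<inter> K))"

definition arithmetic_group :: "(real^2^2) set set \<Rightarrow> bool" where
  "arithmetic_group \<Gamma> \<longleftrightarrow>
     (\<exists>\<Delta>. arithmetic_model \<Delta> \<and>
        (\<exists>g\<in>carrier PSL2R.
           commensurable PSL2R \<Gamma> ((\<lambda>h. g \<otimes>\<^bsub>PSL2R\<^esub> h \<otimes>\<^bsub>PSL2R\<^esub> inv\<^bsub>PSL2R\<^esub> g) ` \<Delta>)))"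

text \<open>The Fuchsian group of a complete hyperbolic metric on an orientable surface exists by the
  Killing--Hopf theorem and is determined up to conjugation in \<open>PGL(2,\<real>)\<close>.\<close>
definition arithmetic_metric ::
    "'a::topological_space set \<Rightarrow> ('a \<Rightarrow> 'a \<Rightarrow> real) \<Rightarrow> bool" where
  "arithmetic_metric S d \<longleftrightarrow> (\<forall>p \<Gamma>. uniformizes S d p \<Gamma> \<longrightarrow> arithmetic_group \<Gamma>)"

end

theory Submission
  imports
    Defs
    "HOL-Computational_Algebra.Fundamental_Theorem_Algebra"
begin

text \<open>Lifting loops to the hyperbolic plane turns \<open>a\<close>, \<open>b\<close> into matrices \<open>A\<close>, \<open>B\<close> that generate the Fuchsian
  group up to sign, and lifting closed geodesics gives \<open>Tr = \<bar>trace\<bar>\<close>.  The commutator \<open>C\<close> of \<open>A\<close> and \<open>B\<close> is the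
  holonomy around the puncture.  It is not elliptic because the group acts freely.  If it were hyperbolic,
  a punctured neighbourhood of the puncture would lift onto a region that contains a sector along the
  axis at infinity, and the area would be infinite.  If its trace were \<open>2\<close>, then \<open>A\<close> and \<open>B\<close> would have
  commuting commutators, against freeness.  So \<open>trace C = -2\<close>, which is the Markov type equation
  \<open>x\<^sup>2 + y\<^sup>2 + z\<^sup>2 = x y z\<close> for the three traces.

  For a real conjugate \<open>\<xi>\<close> of \<open>x\<close> with \<open>\<bar>\<xi>\<bar> < 2\<close> and the corresponding real conjugates of \<open>y\<close>, \<open>z\<close> this
  equation says that a positive definite form vanishes.  Hence \<open>x\<close>, and likewise \<open>y\<close> and \<open>z\<close>, has no
  conjugate besides itself: the traces are integers.  Markov's descent, realized by Nielsen moves,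
  changes the generators into a pair with traces \<open>3, 3, 3\<close>.  Such a pair is unique up to conjugation in
  \<open>GL(2,\<real>)\<close>, and one such pair generates a subgroup of finite index in \<open>SL(2,\<int>)\<close>.\<close>

section \<open>Two-by-two matrices and Moebius transformations\<close>

text \<open>Lengths determine traces only up to sign, and loops determine matrices only up to sign.
  The signs of \<open>A\<close> and \<open>B\<close> can be chosen, that of \<open>A ** B\<close>
  cannot; the Markov type equation forces its trace to be positive. The area is a supremum over
  isometric pieces, and no fundamental domain is at hand. Infinite area therefore needs explicit
  pieces on which the covering is injective: low boxes, narrower than one period of the dilation
  that belongs to the puncture. The main difficulty is that these boxes lie in the lifted
  neighbourhood. An open-closed argument shows it, with compactness modulo the dilation in place of
  knowledge about the rest of the group. On the algebraic side the equation must be conjugated as a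
  whole, so an embedding that moves \<open>x\<close> is extended to \<open>y\<close> and
  \<open>z\<close>. A pair with traces 3, 3, 3 is unique only up to conjugation in GL(2,R), while
  commensurability conjugates in PSL(2,R); the conjugating matrix is therefore made part of the
  arithmetic model.\<close>

definition mk2 :: "real \<Rightarrow> real \<Rightarrow> real \<Rightarrow> real \<Rightarrow> real^2^2" where
  "mk2 a b c d = vector [vector [a, b], vector [c, d]]"

lemma mk2_nth [simp]:
  "mk2 a b c d $ 1 $ 1 = a" "mk2 a b c d $ 1 $ 2 = b"
  "mk2 a b c d $ 2 $ 1 = c" "mk2 a b c d $ 2 $ 2 = d"
  by (simp_all add: mk2_def)

lemma mat2_eq_iff:
  "A = B \<longleftrightarrow> A$1$1 = B$1$1 \<and> A$1$2 = B$1$2 \<and> A$2$1 = B$2$1 \<and> A$2$2 = (B :: real^2^2)$2$2"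
  by (auto simp: vec_eq_iff forall_2)

lemma mat2_mult_nth [simp]:
  fixes A B :: "real^2^2"
  shows "(A ** B)$1$1 = A$1$1 * B$1$1 + A$1$2 * B$2$1" "(A ** B)$1$2 = A$1$1 * B$1$2 + A$1$2 * B$2$2"
        "(A ** B)$2$1 = A$2$1 * B$1$1 + A$2$2 * B$2$1" "(A ** B)$2$2 = A$2$1 * B$1$2 + A$2$2 * B$2$2"
  by (simp_all add: matrix_matrix_mult_def sum_2)

lemma mat2_one_nth [simp]:
  "(mat 1 :: real^2^2)$1$1 = 1" "(mat 1 :: real^2^2)$1$2 = 0"
  "(mat 1 :: real^2^2)$2$1 = 0" "(mat 1 :: real^2^2)$2$2 = 1"
  by (simp_all add: mat_def)

lemma trace_2: "trace (A :: real^2^2) = A$1$1 + A$2$2"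
  by (simp add: trace_def sum_2)

text \<open>On determinant 1 this is the inverse. Its entries are linear in those of the matrix, so
  identities about inverses become polynomial ones.\<close>

definition adj2 :: "real^2^2 \<Rightarrow> real^2^2" where
  "adj2 A = mk2 (A$2$2) (- A$1$2) (- A$2$1) (A$1$1)"

lemma adj2_nth [simp]:
  "adj2 A $ 1 $ 1 = A$2$2" "adj2 A $ 1 $ 2 = - A$1$2"
  "adj2 A $ 2 $ 1 = - A$2$1" "adj2 A $ 2 $ 2 = A$1$1"
  by (simp_all add: adj2_def)

lemma adj2_mult: "adj2 (A ** B) = adj2 B ** adj2 A"
  by (simp add: mat2_eq_iff)

lemma adj2_adj2 [simp]: "adj2 (adj2 A) = A"
  by (simp add: mat2_eq_iff)

lemma det_adj2 [simp]: "det (adj2 A) = det A"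
  by (simp add: det_2)

lemma adj2_inverse:
  assumes "det A = 1"
  shows "A ** adj2 A = mat 1" "adj2 A ** A = mat 1"
  using assms by (simp_all add: mat2_eq_iff det_2 algebra_simps)

lemma adj2_cancel:
  assumes "det A = 1"
  shows "A ** (adj2 A ** B) = B" "adj2 A ** (A ** B) = B"
  using adj2_inverse[OF assms] by (simp_all add: matrix_mul_assoc)

lemma matrix_neg_mult [simp]:
  fixes A B :: "real^2^2"
  shows "(- A) ** B = - (A ** B)" "A ** (- B) = - (A ** B)"
  by (simp_all add: mat2_eq_iff)

lemma det_neg2 [simp]: "det (- A) = det (A :: real^2^2)"
  by (simp add: det_2)

lemma trace_neg2 [simp]: "trace (- A) = - trace (A :: real^2^2)"
  by (simp add: trace_2)

lemma adj2_neg [simp]: "adj2 (- A) = - adj2 A"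
  by (simp add: mat2_eq_iff)

lemma trace_adj2 [simp]: "trace (adj2 A) = trace A"
  by (simp add: trace_2)

lemma trace_conj:
  assumes "det M = 1"
  shows "trace (M ** A ** adj2 M) = trace A"
proof -
  have "trace (M ** A ** adj2 M) = det M * trace A"
    by (simp add: trace_2 det_2 algebra_simps)
  with assms show ?thesis by simp
qed

text \<open>Fricke's identity; the value -2 on the left turns it into the Markov type
  equation.\<close>

lemma trace_commutator:
  assumes "det A = 1" "det B = 1"
  shows "trace (A ** B ** adj2 A ** adj2 B) =
    (trace A)\<^sup>2 + (trace B)\<^sup>2 + (trace (A ** B))\<^sup>2 - trace A * trace B * trace (A ** B) - 2"
proof -
  \<comment> \<open>Inserting determinants makes this a polynomial identity in the eight
    entries.\<close>
  have "trace (A ** B ** adj2 A ** adj2 B) = (trace A)\<^sup>2 * det B + (trace B)\<^sup>2 * det A +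
      (trace (A ** B))\<^sup>2 - trace A * trace B * trace (A ** B) - 2 * det A * det B"
    by (simp add: trace_2 det_2 algebra_simps power2_eq_square)
  with assms show ?thesis by simp
qed

lemma upper_half_iff [simp]: "z \<in> upper_half \<longleftrightarrow> Im z > 0"
  by (simp add: upper_half_def)

lemma moebius_denom_nonzero:
  fixes M :: "real^2^2"
  assumes "det M = 1" "Im z > 0"
  shows "of_real (M$2$1) * z + of_real (M$2$2) \<noteq> 0"
proof
  assume *: "of_real (M$2$1) * z + of_real (M$2$2) = 0"
  have "Im (of_real (M$2$1) * z + of_real (M$2$2)) = M$2$1 * Im z" by simp
  then have "M$2$1 * Im z = 0" unfolding * by simp
  with assms have "M$2$1 = 0" by simp
  with * assms show False by (simp add: det_2)
qed

lemma Im_moebius: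
  assumes "det M = 1"
  shows "Im (moebius M z) = Im z / (cmod (of_real (M$2$1) * z + of_real (M$2$2)))\<^sup>2"
proof -
  let ?d = "of_real (M$2$1) * z + of_real (M$2$2)"
  have "Im (moebius M z) = Im ((of_real (M$1$1) * z + of_real (M$1$2)) * cnj ?d) / (cmod ?d)\<^sup>2"
    unfolding moebius_def by (subst complex_div_cnj) (simp only: Im_divide_of_real flip: of_real_power)
  also have "Im ((of_real (M$1$1) * z + of_real (M$1$2)) * cnj ?d) = det M * Im z"
    by (simp add: det_2 algebra_simps)
  finally show ?thesis using assms by simp
qed

lemma moebius_upper_half:
  assumes "det M = 1" "Im z > 0"
  shows "Im (moebius M z) > 0"
  using assms moebius_denom_nonzero[OF assms] by (simp add: Im_moebius)

lemma moebius_one [simp]: "moebius (mat 1) z = z"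
  by (simp add: moebius_def)

lemma moebius_neg [simp]: "moebius (- M) z = moebius M z"
proof -
  have "of_real ((- M)$1$1) * z + of_real ((- M)$1$2) = - (of_real (M$1$1) * z + of_real (M$1$2))"
    "of_real ((- M)$2$1) * z + of_real ((- M)$2$2) = - (of_real (M$2$1) * z + of_real (M$2$2))" by simp_all
  then show ?thesis unfolding moebius_def by (simp only: minus_divide_left[symmetric] minus_divide_right[symmetric] minus_minus)
qed

lemma moebius_mult:
  assumes "det N = 1" "Im z > 0"
  shows "moebius (M ** N) z = moebius M (moebius N z)"
proof -
  let ?d = "of_real (N$2$1) * z + of_real (N$2$2) :: complex"
  have d: "?d \<noteq> 0" by (rule moebius_denom_nonzero[OF assms])
  have "moebius M (moebius N z) = 
    ((of_real (M$1$1) * moebius N z + of_real (M$1$2)) * ?d) / ((of_real (M$2$1) * moebius N z + of_real (M$2$2)) * ?d)"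
    using d by (simp add: moebius_def)
  moreover have "moebius N z * ?d = of_real (N$1$1) * z + of_real (N$1$2)"
    using d by (simp add: moebius_def)
  then have "(of_real (M$1$1) * moebius N z + of_real (M$1$2)) * ?d = 
       of_real (M$1$1) * (of_real (N$1$1) * z + of_real (N$1$2)) + of_real (M$1$2) * ?d" 
     "(of_real (M$2$1) * moebius N z + of_real (M$2$2)) * ?d = 
       of_real (M$2$1) * (of_real (N$1$1) * z + of_real (N$1$2)) + of_real (M$2$2) * ?d"
    by (simp_all add: distrib_right mult.assoc)
  ultimately show ?thesis by (simp add: moebius_def algebra_simps)
qed

lemma continuous_on_moebius:
  assumes "det M = 1"
  shows "continuous_on upper_half (moebius M)"
  unfolding moebius_def
  by (intro continuous_intros) (use assms moebius_denom_nonzero in auto)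

text \<open>Both sides are \<open>cosh (hdist _ _) - 1\<close>. The difference of the images is
  \<open>z - w\<close> divided by both denominators, and \<open>Im_moebius\<close> divides by the
  squares of their moduli, so these cancel.\<close>

lemma moebius_dist:
  assumes "det M = 1" "Im z > 0" "Im w > 0"
  shows "(cmod (moebius M z - moebius M w))\<^sup>2 / (2 * Im (moebius M z) * Im (moebius M w))
    = (cmod (z - w))\<^sup>2 / (2 * Im z * Im w)"
proof -
  let ?d = "of_real (M$2$1) * z + of_real (M$2$2) :: complex"
  let ?e = "of_real (M$2$1) * w + of_real (M$2$2) :: complex"
  have d: "?d \<noteq> 0" "?e \<noteq> 0" using assms moebius_denom_nonzero by auto
  have "moebius M z - moebius M w = of_real (det M) * (z - w) / (?d * ?e)"
    using d unfolding moebius_def det_2 by (simp add: divide_simps) (simp add: algebra_simps)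
  then have "(cmod (moebius M z - moebius M w))\<^sup>2 = (cmod (z - w))\<^sup>2 / ((cmod ?d)\<^sup>2 * (cmod ?e)\<^sup>2)"
    using assms by (simp add: norm_divide norm_mult power_divide power_mult_distrib)
  then show ?thesis using d assms
    by (simp add: Im_moebius divide_simps)
qed

lemma hdist_moebius:
  assumes "det M = 1" "Im z > 0" "Im w > 0"
  shows "hdist (moebius M z) (moebius M w) = hdist z w"
  unfolding hdist_def using moebius_dist[OF assms] by simp

lemma cosh_hdist:
  assumes "Im z > 0" "Im w > 0"
  shows "cosh (hdist z w) = 1 + (cmod (z - w))\<^sup>2 / (2 * Im z * Im w)"
  unfolding hdist_def using assms by (intro cosh_arcosh_real) simp

lemma hdist_nonneg:
  assumes "Im z > 0" "Im w > 0"
  shows "hdist z w \<ge> 0"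
  unfolding hdist_def using assms by (intro arcosh_nonneg_real) simp

lemma hdist_self [simp]: "hdist z z = 0"
  by (simp add: hdist_def)

lemma hdist_eq_0_iff:
  assumes "Im z > 0" "Im w > 0"
  shows "hdist z w = 0 \<longleftrightarrow> z = w"
proof
  assume "hdist z w = 0"
  with cosh_hdist[OF assms] have "(cmod (z - w))\<^sup>2 / (2 * Im z * Im w) = 0" by simp
  with assms show "z = w" by simp
qed simp

lemma hdist_less_iff:
  assumes "Im z > 0" "Im w > 0" "r > 0"
  shows "hdist z w < r \<longleftrightarrow> 1 + (cmod (z - w))\<^sup>2 / (2 * Im z * Im w) < cosh r"
proof -
  have "hdist z w < r \<longleftrightarrow> cosh (hdist z w) < cosh r"
    using cosh_real_nonneg_less_iff[OF hdist_nonneg[OF assms(1,2)], of r] assms by simp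
  then show ?thesis using assms by (simp add: cosh_hdist)
qed

abbreviation hball :: "complex \<Rightarrow> real \<Rightarrow> complex set" where
  "hball z r \<equiv> {w \<in> upper_half. hdist z w < r}"

lemma open_hdist_ball:
  assumes "Im z > 0" "r > 0"
  shows "open (hball z r)"
proof -
  have "hball z r =
    {w. 0 < Im w} \<inter> {w. (cmod (z - w))\<^sup>2 < (cosh r - 1) * (2 * Im z * Im w)}"
    using assms by (auto simp: hdist_less_iff field_simps)
  moreover have "open {w. 0 < Im w}" by (intro open_Collect_less continuous_intros)
  moreover have "open {w. (cmod (z - w))\<^sup>2 < (cosh r - 1) * (2 * Im z * Im w)}"
    by (intro open_Collect_less continuous_intros)
  ultimately show ?thesis by auto
qed

lemma convex_upper_half: "convex upper_half"
  unfolding upper_half_def by (simp add: convex_halfspace_Im_gt)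

text \<open>The fixed points of \<open>M\<close> are the roots of a real quadratic, which has at most one root in
  the upper half plane.\<close>
lemma moebius_two_fixed_points:
  assumes "det M = 1" "Im z > 0" "Im w > 0" "z \<noteq> w" "moebius M z = z" "moebius M w = w"
  shows "M = mat 1 \<or> M = - mat 1"
proof -
  define a b c d where "a = M$1$1" and "b = M$1$2" and "c = M$2$1" and "d = M$2$2"
  have fix_iff: "of_real c * u * u + of_real (d - a) * u - of_real b = 0"
    if "Im u > 0" "moebius M u = u" for u
  proof -
    have "of_real a * u + of_real b = u * (of_real c * u + of_real d)"
      using that moebius_denom_nonzero[OF assms(1) that(1)] 
      unfolding moebius_def a_def b_def c_def d_def by (simp add: divide_simps)
    then show ?thesis by (simp add: algebra_simps)
  qed
  \<comment> \<open>If \<open>c\<close> is not 0, the imaginary part of the quadratic determines the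
    real part of a root, and the real part determines its modulus; two roots above the real line
    would then coincide.\<close>
  have im: "2 * c * Re u + (d - a) = 0" if "Im u > 0" "moebius M u = u" for u
  proof -
    have "Im (of_real c * u * u + of_real (d - a) * u - of_real b) = Im u * (2 * c * Re u + (d - a))"
      by (simp add: algebra_simps)
    with fix_iff[OF that] that show ?thesis by simp
  qed
  have re: "c * ((Re u)\<^sup>2 + (Im u)\<^sup>2) + b = 0" if "Im u > 0" "moebius M u = u" for u
  proof -
    have "Re (of_real c * u * u + of_real (d - a) * u - of_real b) 
      = Re u * (2 * c * Re u + (d - a)) - (c * ((Re u)\<^sup>2 + (Im u)\<^sup>2) + b)"
      by (simp add: algebra_simps power2_eq_square)
    with fix_iff[OF that] im[OF that] show ?thesis by simp
  qed
  have c: "c = 0"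
  proof (rule ccontr)
    assume "c \<noteq> 0"
    have "c * (Re z - Re w) = 0" using im[OF assms(2,5)] im[OF assms(3,6)] unfolding right_diff_distrib by linarith
    with \<open>c \<noteq> 0\<close> have r: "Re z = Re w" by simp
    moreover have "c * ((Im z)\<^sup>2 - (Im w)\<^sup>2) = 0" 
      using re[OF assms(2,5)] re[OF assms(3,6)] unfolding r right_diff_distrib distrib_left by linarith
    with \<open>c \<noteq> 0\<close> have "(Im z)\<^sup>2 = (Im w)\<^sup>2" by simp
    ultimately show False using assms by (auto simp: power2_eq_iff complex_eq_iff)
  qed
  have "d = a" "b = 0" using im[of z] re[of z] assms c by simp_all
  moreover have "a * d = 1" using assms(1) c by (simp add: det_2 a_def b_def c_def d_def)
  ultimately have "a = 1 \<or> a = -1" by (simp add: square_eq_1_iff)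
  with \<open>d = a\<close> \<open>b = 0\<close> c show ?thesis
    by (auto simp: mat2_eq_iff a_def b_def c_def d_def)
qed

lemma elliptic_fixed_point:
  assumes "det M = 1" "\<bar>trace M\<bar> < 2"
  obtains z where "Im z > 0" "moebius M z = z"
proof -
  define a b c d where "a = M$1$1" and "b = M$1$2" and "c = M$2$1" and "d = M$2$2"
  have det: "a * d - b * c = 1" using assms(1) by (simp add: det_2 a_def b_def c_def d_def)
  have "\<bar>a + d\<bar> < 2" using assms(2) by (simp add: trace_2 a_def d_def)
  then have "(a + d)\<^sup>2 < 4" using abs_square_less_1[of "(a+d)/2"] by (simp add: power_divide)
  then have pos: "4 - (a + d)\<^sup>2 > 0" by simp
  have c: "c \<noteq> 0"
  proof
    assume "c = 0"
    with det have "(a + d)\<^sup>2 = (a - d)\<^sup>2 + 4" by (simp add: power2_eq_square algebra_simps)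
    with pos show False by (smt (verit) zero_le_power2)
  qed
  define s where "s = sqrt (4 - (a + d)\<^sup>2)"
  have s: "s > 0" "s\<^sup>2 = 4 - (a + d)\<^sup>2" using pos by (simp_all add: s_def)
  \<comment> \<open>The root of \<open>c z^2 + (d - a) z - b\<close> in the upper half plane; the
    discriminant \<open>(a + d)^2 - 4\<close> is negative, and the absolute value of
    \<open>c\<close> selects the right one of the two roots.\<close>
  define z where "z = Complex ((a - d) / (2 * c)) (s / (2 * \<bar>c\<bar>))"
  have Imz: "Im z > 0" using s c by (simp add: z_def)
  have n: "c * ((Re z)\<^sup>2 + (Im z)\<^sup>2) = - b"
  proof -
    have "(Re z)\<^sup>2 + (Im z)\<^sup>2 = ((a - d)\<^sup>2 + s\<^sup>2) / (4 * c\<^sup>2)"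
      by (simp add: z_def power_divide power_mult_distrib add_divide_distrib)
    also have "(a - d)\<^sup>2 + s\<^sup>2 = - 4 * b * c"
      using det s(2) by (simp add: power2_eq_square algebra_simps)
    finally show ?thesis using c by (simp add: power2_eq_square)
  qed
  have "of_real a * z + of_real b = z * (of_real c * z + of_real d)"
  proof (rule complex_eqI)
    have r: "2 * c * Re z = a - d" using c by (simp add: z_def)
    have "c * Re z * Re z - c * Im z * Im z = 2 * c * Re z * Re z + b" using n by (simp add: power2_eq_square algebra_simps)
    then show "Re (of_real a * z + of_real b) = Re (z * (of_real c * z + of_real d))"
      unfolding r by (simp add: algebra_simps)
    have "Im (z * (of_real c * z + of_real d)) = (2 * c * Re z + d) * Im z" by (simp add: algebra_simps)
    then show "Im (of_real a * z + of_real b) = Im (z * (of_real c * z + of_real d))"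
      unfolding r by simp
  qed
  then have "moebius M z = z" 
    using moebius_denom_nonzero[OF assms(1) Imz] unfolding moebius_def a_def b_def c_def d_def
    by (simp add: divide_simps)
  with Imz that show thesis by blast
qed

section \<open>Geodesics of the hyperbolic plane\<close>

text \<open>Rigidity: \<open>adj2 N ** M\<close> fixes two points. This glues local descriptions of
  a geodesic and identifies a translation by its action on an axis.\<close>

lemma moebius_cong_sign:
  assumes "det M = 1" "det N = 1" "Im z > 0" "Im w > 0" "z \<noteq> w"
    "moebius M z = moebius N z" "moebius M w = moebius N w"
  shows "M = N \<or> M = - N"
proof -
  have det: "det (adj2 N ** M) = 1" using assms by (simp add: det_mul)
  have fix_iff: "moebius (adj2 N ** M) u = u" if "Im u > 0" "moebius M u = moebius N u" for u
  proof -
    have "moebius (adj2 N ** M) u = moebius (adj2 N) (moebius N u)"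
      using that assms by (simp add: moebius_mult)
    also have "\<dots> = moebius (adj2 N ** N) u" using that assms by (simp add: moebius_mult)
    finally show ?thesis using assms by (simp add: adj2_inverse)
  qed
  have "adj2 N ** M = mat 1 \<or> adj2 N ** M = - mat 1"
    using moebius_two_fixed_points[OF det] assms fix_iff by blast
  moreover have "M = N ** (adj2 N ** M)" using assms by (simp add: adj2_cancel)
  ultimately show ?thesis by (metis matrix_neg_mult(2) matrix_mul_rid)
qed

text \<open>The model geodesic, the imaginary axis at unit speed; \<open>hshift t\<close> is the
  translation by \<open>t\<close> along it.\<close>

definition hline :: "real \<Rightarrow> complex" where
  "hline t = \<i> * of_real (exp t)"

definition hshift :: "real \<Rightarrow> real^2^2" where
  "hshift t = mk2 (exp (t/2)) 0 0 (exp (- t/2))"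

lemma Im_hline [simp]: "Im (hline t) = exp t" and Re_hline [simp]: "Re (hline t) = 0"
  by (simp_all add: hline_def)

lemma hline_inj [simp]: "hline s = hline t \<longleftrightarrow> s = t"
  by (auto simp: complex_eq_iff)

lemma det_hshift [simp]: "det (hshift t) = 1"
  by (simp add: hshift_def det_2 flip: exp_add)

lemma trace_hshift: "trace (hshift t) = 2 * cosh (t / 2)"
  by (simp add: hshift_def trace_2 cosh_def)

lemma moebius_hshift: "moebius (hshift t) z = of_real (exp t) * z"
proof -
  have "moebius (hshift t) z = of_real (exp (t/2) / exp (- t/2)) * z"
    by (simp add: moebius_def hshift_def)
  also have "exp (t/2) / exp (- t/2) = exp t" by (simp flip: exp_diff)
  finally show ?thesis .
qed

lemma moebius_hshift_hline: "moebius (hshift t) (hline s) = hline (s + t)"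
  by (simp add: moebius_hshift hline_def exp_add mult_ac)

lemma cosh_hdist_hline:
  assumes "Im z > 0"
  shows "2 * Im z * exp t * cosh (hdist (hline t) z) = (Re z)\<^sup>2 + (Im z)\<^sup>2 + (exp t)\<^sup>2"
proof -
  have "2 * Im z * exp t * cosh (hdist (hline t) z) = 2 * Im z * exp t + (cmod (hline t - z))\<^sup>2"
    using assms by (simp add: cosh_hdist field_simps)
  also have "(cmod (hline t - z))\<^sup>2 = (Re z)\<^sup>2 + (exp t - Im z)\<^sup>2"
    by (simp add: cmod_power2)
  finally show ?thesis by (simp add: power2_eq_square algebra_simps)
qed

lemma hdist_hline: "hdist (hline s) (hline t) = \<bar>s - t\<bar>"
proof -
  have "2 * exp t * exp s * cosh (hdist (hline s) (hline t)) = (exp t)\<^sup>2 + (exp s)\<^sup>2"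
    using cosh_hdist_hline[of "hline t" s] by simp
  also have "\<dots> = 2 * exp t * exp s * cosh (s - t)"
    by (simp add: cosh_def exp_diff exp_minus field_simps power2_eq_square)
  finally have "cosh (hdist (hline s) (hline t)) = cosh (s - t)" by simp
  then show ?thesis using hdist_nonneg[of "hline s" "hline t"]
    by (metis abs_of_nonneg abs_ge_zero cosh_real_abs cosh_real_nonneg_le_iff order_antisym Im_hline exp_gt_zero order_refl)
qed

text \<open>Multiplied out, a distance condition at \<open>hline t\<close> is an affine relation
  between \<open>(cmod q)^2\<close> and \<open>Im q\<close> with coefficients depending on
  \<open>exp t\<close>. Subtracting two of them leaves \<open>Im q = exp s\<close>, and then
  \<open>Re q = 0\<close>.\<close>

lemma hline_determined:
  assumes "Im q > 0" "a \<noteq> b" "hdist (hline a) q = \<bar>s - a\<bar>" "hdist (hline b) q = \<bar>s - b\<bar>"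
  shows "q = hline s"
proof -
  have eq: "(Re q)\<^sup>2 + (Im q)\<^sup>2 + (exp t)\<^sup>2 = Im q * (exp s + (exp t)\<^sup>2 * exp (- s))"
    if "hdist (hline t) q = \<bar>s - t\<bar>" for t
  proof -
    have "(Re q)\<^sup>2 + (Im q)\<^sup>2 + (exp t)\<^sup>2 = Im q * (exp t * (2 * cosh (s - t)))"
      using cosh_hdist_hline[OF assms(1), of t] that by (simp add: mult_ac)
    also have "exp t * (2 * cosh (s - t)) = exp s + (exp t)\<^sup>2 * exp (- s)"
      by (simp add: cosh_def exp_diff exp_minus field_simps power2_eq_square)
    finally show ?thesis .
  qed
  have ne: "(exp a)\<^sup>2 \<noteq> (exp b)\<^sup>2" using assms(2) by (simp add: power2_eq_iff)
     (metis add.inverse_inverse exp_gt_zero neg_less_0_iff_less not_less_iff_gr_or_eq)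
  have "((exp a)\<^sup>2 - (exp b)\<^sup>2) * (Im q * exp (- s) - 1) = 0"
    using eq[OF assms(3)] eq[OF assms(4)] by (simp add: algebra_simps)
  with ne have "Im q * exp (- s) = 1" by simp
  then have im: "Im q = exp s" by (simp add: exp_minus field_simps)
  then have "(Re q)\<^sup>2 = 0" using eq[OF assms(3)] by (simp add: algebra_simps exp_minus power2_eq_square)
  with im show ?thesis by (simp add: complex_eq_iff)
qed

lemma two_point_transitive:
  assumes "Im z > 0" "Im w > 0" "hdist z w = b - a" "a < b"
  obtains M where "det M = 1" "moebius M z = hline a" "moebius M w = hline b"
proof -
  \<comment> \<open>Sends \<open>z\<close> to \<open>hline 0\<close>, the imaginary unit.\<close>
  define N where "N = mk2 (1 / sqrt (Im z)) (- Re z / sqrt (Im z)) 0 (sqrt (Im z))"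
  have N: "det N = 1" using assms(1) by (simp add: N_def det_2)
  have "moebius N z = (of_real (1 / sqrt (Im z)) * (z - of_real (Re z))) / of_real (sqrt (Im z))"
    by (simp add: N_def moebius_def diff_divide_distrib)
  also have "z - of_real (Re z) = \<i> * of_real (Im z)" by (simp add: complex_eq_iff)
  also have "(of_real (1 / sqrt (Im z)) * (\<i> * of_real (Im z))) / of_real (sqrt (Im z))
     = \<i> * of_real (Im z / (sqrt (Im z) * sqrt (Im z)))" by (simp only: of_real_mult of_real_divide) simp
  also have "\<dots> = hline 0" using assms(1) by (simp add: hline_def)
  finally have Nz: "moebius N z = hline 0" .
  define u where "u = moebius N w"
  have u: "Im u > 0" using N assms by (simp add: u_def moebius_upper_half)
  have du: "hdist (hline 0) u = b - a"
    using hdist_moebius[OF N assms(1,2)] assms(3) by (simp add: Nz u_def)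
  define R where "R = (\<lambda>t. mk2 (cos t) (sin t) (- sin t) (cos t))"
  have R: "det (R t) = 1" for t by (simp add: R_def det_2 flip: power2_eq_square)
  have Ri: "moebius (R t) (hline 0) = hline 0" for t
  proof -
    have "moebius (R t) (hline 0) = (\<i> * (of_real (cos t) - \<i> * of_real (sin t))) / (of_real (cos t) - \<i> * of_real (sin t))"
      by (simp add: moebius_def R_def hline_def algebra_simps)
    moreover have "of_real (cos t) - \<i> * of_real (sin t) \<noteq> 0"
      using moebius_denom_nonzero[OF R[of t], of \<i>] by (simp add: R_def algebra_simps)
    ultimately show ?thesis by (simp add: hline_def)
  qed
  \<comment> \<open>Up to a positive factor this is the real part of the image of \<open>u\<close>
    under the rotation \<open>R t\<close> about the imaginary unit. Its values at 0 and
    \<open>pi / 2\<close> are \<open>Re u\<close> and \<open>- Re u\<close>, so some rotation moves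
    \<open>u\<close> onto the axis.\<close>
  have "\<exists>t\<ge>0. t \<le> pi / 2 \<and> Re u * cos (2 * t) + (1 - (cmod u)\<^sup>2) / 2 * sin (2 * t) = 0"
  proof (cases "Re u \<le> 0")
    case True
    show ?thesis
      by (rule IVT') (use True in \<open>auto intro!: continuous_intros\<close>)
  next
    case False
    show ?thesis
      by (rule IVT2') (use False in \<open>auto intro!: continuous_intros\<close>)
  qed
  then obtain t where t: "Re u * cos (2 * t) + (1 - (cmod u)\<^sup>2) / 2 * sin (2 * t) = 0" by blast
  define v where "v = moebius (R t) u"
  have v: "Im v > 0" using R u by (simp add: v_def moebius_upper_half)
  have "Re v = 0"
  proof -
    let ?d = "of_real (- sin t) * u + of_real (cos t) :: complex"
    have "v = (of_real (cos t) * u + of_real (sin t)) * cnj ?d / of_real ((cmod ?d)\<^sup>2)"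
      unfolding v_def moebius_def R_def mk2_nth by (subst complex_div_cnj) simp
    then have "Re v = Re ((of_real (cos t) * u + of_real (sin t)) * cnj ?d) / (cmod ?d)\<^sup>2"
      by (simp only: Re_divide_of_real)
    also have "Re ((of_real (cos t) * u + of_real (sin t)) * cnj ?d) = 
      Re u * cos (2 * t) + (1 - (cmod u)\<^sup>2) / 2 * sin (2 * t)"
      unfolding cos_double sin_double cmod_power2 by (simp add: field_simps power2_eq_square)
    finally show ?thesis using t by simp
  qed
  then have vl: "v = hline (ln (Im v))" using v by (simp add: complex_eq_iff)
  have "hdist (hline 0) v = b - a"
    using hdist_moebius[OF R, of "hline 0" u t] u du by (simp add: Ri v_def)
  then have ln: "\<bar>ln (Im v)\<bar> = b - a" by (subst (asm) vl) (simp add: hdist_hline)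
  \<comment> \<open>If the rotation moved \<open>u\<close> to the wrong side of the imaginary unit,
    a half turn about it reverses the axis.\<close>
  define S where "S = (if ln (Im v) \<ge> 0 then mat 1 else mk2 0 (-1) 1 0)"
  have S: "det S = 1" by (simp add: S_def det_2)
  have S0: "moebius S (hline 0) = hline 0" 
    by (simp add: S_def hline_def) (simp add: moebius_def complex_eq_iff)
  have S1: "moebius S v = hline (b - a)"
  proof (cases "ln (Im v) \<ge> 0")
    case True
    then show ?thesis using ln by (subst vl) (simp add: S_def)
  next
    case False
    then have "ln (Im v) = a - b" using ln by simp
    then have "moebius S v = -1 / hline (a - b)" using False vl by (simp add: S_def moebius_def)
    also have "\<dots> = hline (b - a)" by (simp add: hline_def field_simps flip: of_real_mult exp_add)
    finally show ?thesis .
  qed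
  define M where "M = hshift a ** (S ** (R t ** N))"
  have "det M = 1" by (simp add: M_def det_mul S R N)
  moreover have "moebius M z = hline a"
    using assms N R S u v by (simp add: M_def moebius_mult det_mul moebius_upper_half Nz Ri S0 moebius_hshift_hline)
  moreover have "moebius M w = hline b"
    using assms N R S u v by (simp add: M_def moebius_mult det_mul moebius_upper_half S1 moebius_hshift_hline flip: u_def v_def)
  ultimately show thesis by (rule that)
qed

text \<open>Once \<open>c t\<close> and \<open>c (t + e/2)\<close> are moved onto the axis, every
  other point is determined by its distances to these two.\<close>

lemma geodesic_segment:
  assumes "e > 0" "\<And>s. s \<in> {t-e<..<t+e} \<Longrightarrow> Im (c s) > 0"
    and "\<And>s s'. s \<in> {t-e<..<t+e} \<Longrightarrow> s' \<in> {t-e<..<t+e} \<Longrightarrow> hdist (c s) (c s') = \<bar>s - s'\<bar>"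
  obtains M where "det M = 1" "\<And>s. s \<in> {t-e<..<t+e} \<Longrightarrow> c s = moebius M (hline s)"
proof -
  have in1: "t \<in> {t-e<..<t+e}" and in2: "t + e/2 \<in> {t-e<..<t+e}" using assms(1) by auto
  obtain M where M: "det M = 1" "moebius M (c t) = hline t" "moebius M (c (t + e/2)) = hline (t + e/2)"
  proof (rule two_point_transitive[of "c t" "c (t + e/2)" "t + e/2" t])
    show "hdist (c t) (c (t + e / 2)) = t + e / 2 - t" using assms(1) by (subst assms(3)[OF in1 in2]) simp
  qed (use assms(1) assms(2)[OF in1] assms(2)[OF in2] in auto)
  have "moebius M (c s) = hline s" if s: "s \<in> {t-e<..<t+e}" for s
  proof (rule hline_determined[of _ t "t + e/2"])
    show "Im (moebius M (c s)) > 0" using M assms(2)[OF s] by (simp add: moebius_upper_half)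
    show "hdist (hline t) (moebius M (c s)) = \<bar>s - t\<bar>"
      using hdist_moebius[OF M(1) assms(2)[OF in1] assms(2)[OF s]] assms(3)[OF in1 s] by (simp add: M)
    show "hdist (hline (t + e/2)) (moebius M (c s)) = \<bar>s - (t + e/2)\<bar>"
      using hdist_moebius[OF M(1) assms(2)[OF in2] assms(2)[OF s]] assms(3)[OF in2 s] by (simp add: M)
  qed (use assms(1) in simp)
  then have "c s = moebius (adj2 M) (hline s)" if s: "s \<in> {t-e<..<t+e}" for s
    using moebius_mult[OF M(1), of "c s" "adj2 M"] assms(2)[OF s] M(1) s by (simp add: adj2_inverse)
  with M(1) show thesis by (intro that[of "adj2 M"]) auto
qed

lemma geodesic_line:
  assumes "\<And>s. Im (c s) > 0"
    and "\<And>t. \<exists>e>0. \<forall>s\<in>{t-e<..<t+e}. \<forall>s'\<in>{t-e<..<t+e}. hdist (c s) (c s') = \<bar>s - s'\<bar>"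
  obtains M where "det M = 1" "\<And>s. c s = moebius M (hline s)"
proof -
  have loc: "\<exists>e>0. \<exists>M. det M = 1 \<and> (\<forall>s\<in>{t-e<..<t+e}. c s = moebius M (hline s))" for t
  proof -
    obtain e where e: "e > 0" "\<forall>s\<in>{t-e<..<t+e}. \<forall>s'\<in>{t-e<..<t+e}. hdist (c s) (c s') = \<bar>s - s'\<bar>"
      using assms(2) by blast
    obtain M where "det M = 1" "\<And>s. s \<in> {t-e<..<t+e} \<Longrightarrow> c s = moebius M (hline s)"
      by (rule geodesic_segment[of e t c]) (use e assms(1) in blast)+
    with e show ?thesis by blast
  qed
  from loc[of 0] obtain e0 M where e0: "e0 > 0" and M: "det M = 1"
    and M0: "\<And>s. s \<in> {-e0<..<e0} \<Longrightarrow> c s = moebius M (hline s)" by auto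
  \<comment> \<open>Continuation along the line: \<open>T\<close> is closed because a matrix that
    describes \<open>c\<close> near a limit point agrees with \<open>M\<close> at two distinct
    points of the axis, hence equals \<open>M\<close> up to sign.\<close>
  define T where "T = {t. \<exists>e>0. \<forall>s\<in>{t-e<..<t+e}. c s = moebius M (hline s)}"
  have "0 \<in> T" using e0 M0 unfolding T_def by force
  moreover have "open T"
    unfolding open_dist
  proof
    fix t assume "t \<in> T"
    then obtain e where e: "e > 0" "\<forall>s\<in>{t-e<..<t+e}. c s = moebius M (hline s)" by (auto simp: T_def)
    have "t' \<in> T" if "dist t' t < e" for t'
      unfolding T_def
    proof (intro CollectI exI conjI)
      show "e - \<bar>t' - t\<bar> > 0" using that by (simp add: dist_real_def)
      show "\<forall>s\<in>{t' - (e - \<bar>t' - t\<bar>)<..<t' + (e - \<bar>t' - t\<bar>)}. c s = moebius M (hline s)"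
        using e(2) by (auto simp: abs_if split: if_splits)
    qed
    then show "\<exists>e>0. \<forall>y. dist y t < e \<longrightarrow> y \<in> T" using e(1) by blast
  qed
  moreover have "closed T"
    unfolding closure_subset_eq[symmetric]
  proof
    fix t assume "t \<in> closure T"
    then have t: "\<forall>e>0. \<exists>y\<in>T. dist y t < e" by (simp add: closure_approachable)
    obtain e N where e: "e > 0" and N: "det N = 1" and eN: "\<And>s. s\<in>{t-e<..<t+e} \<Longrightarrow> c s = moebius N (hline s)"
      using loc[of t] by blast
    obtain y where "y \<in> T" and y: "dist y t < e" using t e by blast
    then obtain e' where e': "e' > 0" "\<forall>s\<in>{y-e'<..<y+e'}. c s = moebius M (hline s)" by (auto simp: T_def)
    obtain s where s: "s \<in> {y-e'<..<y+e'}" "s\<in>{t-e<..<t+e}" "s \<noteq> y"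
    proof -
      have "y < min (y + e') (t + e)" using y e' by (simp add: dist_real_def abs_less_iff)
      then obtain s where "y < s" "s < min (y + e') (t + e)" using dense by blast
      with y e' that[of s] show thesis by (simp add: dist_real_def abs_less_iff)
    qed
    have yin: "y \<in> {y-e'<..<y+e'}" "y \<in> {t-e<..<t+e}" using y e' by (auto simp: dist_real_def abs_less_iff)
    have "M = N \<or> M = - N"
    proof (rule moebius_cong_sign[OF M N, of "hline y" "hline s"])
      show "moebius M (hline y) = moebius N (hline y)" using e'(2) eN yin by metis
      show "moebius M (hline s) = moebius N (hline s)" using e'(2) eN s by metis
    qed (use s in auto)
    then have "moebius M (hline s) = moebius N (hline s)" for s by auto
    then show "t \<in> T" unfolding T_def using e eN by auto
  qed
  ultimately have "T = UNIV" using connected_UNIV[where ?'a=real] unfolding connected_clopen by auto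
  then have "c s = moebius M (hline s)" for s
  proof -
    have "s \<in> T" using \<open>T = UNIV\<close> by simp
    then obtain e where "e > 0" "\<forall>s'\<in>{s-e<..<s+e}. c s' = moebius M (hline s')" unfolding T_def by blast
    then show ?thesis by simp
  qed
  with M show thesis by (rule that)
qed

text \<open>\<open>A\<close> shifts the geodesic by \<open>L\<close> along itself. Compared at two
  points of the axis, \<open>A\<close> is up to sign the conjugate of \<open>hshift L\<close> by
  \<open>M\<close>.\<close>

lemma trace_translation:
  assumes "\<And>s. Im (c s) > 0"
    and "\<And>t. \<exists>e>0. \<forall>s\<in>{t-e<..<t+e}. \<forall>s'\<in>{t-e<..<t+e}. hdist (c s) (c s') = \<bar>s - s'\<bar>"
    and "det A = 1" "\<And>t. c (t + L) = moebius A (c t)"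
  shows "\<bar>trace A\<bar> = 2 * cosh (L / 2)"
proof -
  obtain M where M: "det M = 1" "\<And>s. c s = moebius M (hline s)"
    using geodesic_line[OF assms(1,2)] by blast
  have eq: "moebius (A ** M) (hline s) = moebius (M ** hshift L) (hline s)" for s
    using assms(3) assms(4)[of s] M by (simp add: moebius_mult moebius_hshift_hline)
  have "A ** M = M ** hshift L \<or> A ** M = - (M ** hshift L)"
    by (rule moebius_cong_sign[of _ _ "hline 0" "hline 1"]) (use eq assms(3) M in \<open>auto simp: det_mul\<close>)
  moreover have "A = (A ** M) ** adj2 M" using M(1) by (simp add: adj2_inverse flip: matrix_mul_assoc)
  ultimately have "A = M ** hshift L ** adj2 M \<or> A = - (M ** hshift L ** adj2 M)" by (metis matrix_neg_mult(1))
  then have "\<bar>trace A\<bar> = \<bar>trace (M ** hshift L ** adj2 M)\<bar>" by (metis abs_minus_cancel trace_neg2)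
  then show ?thesis by (simp add: trace_conj[OF M(1)] trace_hshift abs_of_pos)
qed

section \<open>Fuchsian groups and holonomy\<close>

lemma SL2R_simps [simp]:
  "carrier SL2R = {M. det M = 1}" "mult SL2R = (**)" "one SL2R = mat 1"
  by (simp_all add: SL2R_def)

lemma group_SL2R: "group SL2R"
proof (rule groupI)
  fix M assume "M \<in> carrier SL2R"
  then show "\<exists>N\<in>carrier SL2R. N \<otimes>\<^bsub>SL2R\<^esub> M = \<one>\<^bsub>SL2R\<^esub>"
    by (intro bexI[of _ "adj2 M"]) (auto simp: adj2_inverse)
qed (auto simp: det_mul matrix_mul_assoc)

lemma psl_class_eq: "psl_class M = {M, - M}"
  by (auto simp: psl_class_def r_coset_def)

lemma normal_pm_one: "{mat 1, - mat 1} \<lhd> SL2R"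
proof -
  interpret group SL2R by (rule group_SL2R)
  have "subgroup {mat 1, - mat 1} SL2R"
  proof (rule subgroupI)
    fix M :: "real^2^2" assume M: "M \<in> {mat 1, - mat 1}"
    then have "inv\<^bsub>SL2R\<^esub> M = M" by (intro inv_equality) auto
    with M show "inv\<^bsub>SL2R\<^esub> M \<in> {mat 1, - mat 1}" by simp
  qed auto
  then show ?thesis by (rule normalI) (auto simp: r_coset_def l_coset_def)
qed

lemma group_PSL2R: "group PSL2R"
  unfolding PSL2R_def by (rule normal.factorgroup_is_group[OF normal_pm_one])

lemma carrier_PSL2R: "carrier PSL2R = psl_class ` {M. det M = 1}"
  by (auto simp: PSL2R_def FactGroup_def RCOSETS_def psl_class_def)

lemma psl_class_mult: "psl_class M \<otimes>\<^bsub>PSL2R\<^esub> psl_class N = psl_class (M ** N)"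
  by (auto simp: PSL2R_def FactGroup_def set_mult_def psl_class_eq)

lemma psl_class_one: "\<one>\<^bsub>PSL2R\<^esub> = psl_class (mat 1)"
  by (auto simp: PSL2R_def FactGroup_def psl_class_eq)

lemma psl_class_inv:
  assumes "det M = 1"
  shows "inv\<^bsub>PSL2R\<^esub> psl_class M = psl_class (adj2 M)"
  using assms by (intro group.inv_equality[OF group_PSL2R])
    (auto simp: psl_class_mult psl_class_one adj2_inverse carrier_PSL2R)

text \<open>The full preimage in SL(2,R), closed under sign. It allows computing with matrices
  instead of cosets, at the price of statements that hold up to sign.\<close>

definition psl_preimage :: "(real^2^2) set set \<Rightarrow> (real^2^2) set" where
  "psl_preimage \<Gamma> = {M. det M = 1 \<and> psl_class M \<in> \<Gamma>}"

lemma psl_preimage: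
  assumes "subgroup \<Gamma> PSL2R"
  shows "\<And>M. M \<in> psl_preimage \<Gamma> \<Longrightarrow> det M = 1" "mat 1 \<in> psl_preimage \<Gamma>"
    "\<And>M N. M \<in> psl_preimage \<Gamma> \<Longrightarrow> N \<in> psl_preimage \<Gamma> \<Longrightarrow> M ** N \<in> psl_preimage \<Gamma>"
    "\<And>M. M \<in> psl_preimage \<Gamma> \<Longrightarrow> adj2 M \<in> psl_preimage \<Gamma>"
    "\<And>M. M \<in> psl_preimage \<Gamma> \<Longrightarrow> - M \<in> psl_preimage \<Gamma>"
    "psl_class ` psl_preimage \<Gamma> = \<Gamma>"
proof -
  show "mat 1 \<in> psl_preimage \<Gamma>" 
    using subgroup.one_closed[OF assms] by (simp add: psl_preimage_def psl_class_one)
  show "M ** N \<in> psl_preimage \<Gamma>" if "M \<in> psl_preimage \<Gamma>" "N \<in> psl_preimage \<Gamma>" for M N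
    using subgroup.m_closed[OF assms, of "psl_class M" "psl_class N"] that 
    by (simp add: psl_preimage_def psl_class_mult det_mul)
  show "adj2 M \<in> psl_preimage \<Gamma>" if "M \<in> psl_preimage \<Gamma>" for M
    using subgroup.m_inv_closed[OF assms, of "psl_class M"] that 
    by (simp add: psl_preimage_def psl_class_inv)
  show "- M \<in> psl_preimage \<Gamma>" if "M \<in> psl_preimage \<Gamma>" for M
  proof -
    have "psl_class (- M) = psl_class M" by (auto simp: psl_class_eq)
    with that show ?thesis by (simp add: psl_preimage_def)
  qed
  show "psl_class ` psl_preimage \<Gamma> = \<Gamma>"
    using subgroup.subset[OF assms] by (auto simp: psl_preimage_def carrier_PSL2R)
qed (simp add: psl_preimage_def)

section \<open>Deck transformations, lifts and free holonomy\<close>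

locale uniformization =
  fixes S :: "'a::real_normed_vector set" and d p \<Gamma>
  assumes uniformizes: "uniformizes S d p \<Gamma>"
begin

abbreviation "G \<equiv> psl_preimage \<Gamma>"

lemma covering: "covering_space upper_half p S"
  and local_isometry: "Im z > 0 \<Longrightarrow> \<exists>r>0. isometric_embedding (hball z r) d p"
  and subgroup_\<Gamma>: "subgroup \<Gamma> PSL2R"
  using uniformizes by (auto simp: uniformizes_def)

lemmas G_closed = psl_preimage[OF subgroup_\<Gamma>]

lemma p_eq_iff:
  assumes "Im z > 0" "Im w > 0"
  shows "p z = p w \<longleftrightarrow> (\<exists>M\<in>G. moebius M z = w)"
proof -
  have "p z = p w \<longleftrightarrow> (\<exists>P\<in>\<Gamma>. \<exists>M\<in>P. moebius M z = w)"
    using uniformizes assms unfolding uniformizes_def by auto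
  also have "\<dots> \<longleftrightarrow> (\<exists>M\<in>G. \<exists>N\<in>psl_class M. moebius N z = w)"
    by (subst G_closed(6)[symmetric]) blast
  also have "\<dots> \<longleftrightarrow> (\<exists>M\<in>G. moebius M z = w)"
    by (auto simp: psl_class_eq)
  finally show ?thesis .
qed

lemma p_moebius: "M \<in> G \<Longrightarrow> Im z > 0 \<Longrightarrow> p (moebius M z) = p z"
  using p_eq_iff[of z "moebius M z"] G_closed(1)[of M] by (auto simp: moebius_upper_half)

lemma continuous_on_p: "continuous_on upper_half p"
  using covering by (rule covering_space_imp_continuous)

lemma p_in_S: "Im z > 0 \<Longrightarrow> p z \<in> S"
  using covering_space_imp_surjective[OF covering] by auto

text \<open>On a small ball around the fixed point \<open>p\<close> preserves distances, and
  \<open>M\<close> maps the ball to itself. As \<open>M w\<close> and \<open>w\<close> have the same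
  image under \<open>p\<close>, they are at distance 0, so \<open>M\<close> fixes a second
  point.\<close>

lemma free_action:
  assumes M: "M \<in> G" and z: "Im z > 0" and "moebius M z = z"
  shows "M = mat 1 \<or> M = - mat 1"
proof -
  obtain r where r: "r > 0" "isometric_embedding (hball z r) d p"
    using local_isometry[OF z] by blast
  have det: "det M = 1" using M by (rule G_closed(1))
  let ?B = "hball z r"
  have "open ?B" "z \<in> ?B" using open_hdist_ball[OF z r(1)] r z by auto
  moreover from this have "?B \<noteq> {z}" using not_open_singleton[of z] by metis
  ultimately obtain w where w: "w \<in> ?B" "w \<noteq> z" by blast
  have "Im (moebius M w) > 0" using det w by (simp add: moebius_upper_half)
  moreover have "hdist z (moebius M w) < r"
    using hdist_moebius[OF det z, of w] assms w by simp
  ultimately have "moebius M w \<in> ?B" by simp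
  with r w have "d (p w) (p (moebius M w)) = hdist w (moebius M w)" "d (p w) (p w) = hdist w w"
    unfolding isometric_embedding_def by blast+
  moreover have "p (moebius M w) = p w" using M w by (intro p_moebius) auto
  ultimately have "hdist w (moebius M w) = 0" by simp
  with w \<open>Im (moebius M w) > 0\<close> have "moebius M w = w" by (simp add: hdist_eq_0_iff)
  with moebius_two_fixed_points[OF det z, of w] w assms show ?thesis by auto
qed

lemma moebius_eq_imp_eq:
  assumes M: "M \<in> G" and N: "N \<in> G" and z: "Im z > 0" and "moebius M z = moebius N z"
  shows "M = N \<or> M = - N"
proof -
  have det: "det M = 1" "det N = 1" using M N by (auto intro: G_closed(1))
  have "moebius (adj2 N ** M) z = moebius (adj2 N) (moebius N z)"
    using det z assms(4) by (simp add: moebius_mult)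
  also have "\<dots> = z" using det z by (simp add: adj2_inverse flip: moebius_mult)
  finally have "adj2 N ** M = mat 1 \<or> adj2 N ** M = - mat 1"
    using M N z by (intro free_action) (auto intro: G_closed)
  moreover have "M = N ** (adj2 N ** M)" using det by (simp add: adj2_cancel)
  ultimately show ?thesis by (metis matrix_neg_mult(2) matrix_mul_rid)
qed

lemma lift_unique_moebius:
  assumes "connected T" "continuous_on T f" "f ` T \<subseteq> upper_half" "continuous_on T g" "g ` T \<subseteq> upper_half"
    and "\<And>t. t \<in> T \<Longrightarrow> p (f t) = p (g t)" "M \<in> G" "t0 \<in> T" "g t0 = moebius M (f t0)" "t \<in> T"
  shows "g t = moebius M (f t)"
proof (rule covering_space_lift_unique[OF covering, where f="p \<circ> g" and ?g2.0="\<lambda>t. moebius M (f t)"])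
  have det: "det M = 1" using assms by (auto intro: G_closed)
  show "continuous_on T (p \<circ> g)" 
    using assms(4,5) by (intro continuous_on_compose continuous_on_subset[OF continuous_on_p]) auto
  show "p \<circ> g \<in> T \<rightarrow> S" "g \<in> T \<rightarrow> upper_half" using assms(5) by (auto intro!: p_in_S)
  show "continuous_on T (\<lambda>t. moebius M (f t))"
    using assms(2,3) by (intro continuous_on_compose2[OF continuous_on_moebius[OF det]]) auto
  show "(\<lambda>t. moebius M (f t)) \<in> T \<rightarrow> upper_half" using assms(3) det by (auto simp: moebius_upper_half)
  show "(p \<circ> g) t = p (moebius M (f t))" if "t \<in> T" for t
    using assms(3,6,7) that by (auto simp: p_moebius image_subset_iff)
qed (use assms in auto)

lemma lifts_differ_by_deck:
  assumes "connected T" "continuous_on T f" "f ` T \<subseteq> upper_half" "continuous_on T g" "g ` T \<subseteq> upper_half"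
    and "\<And>t. t \<in> T \<Longrightarrow> p (f t) = p (g t)" "T \<noteq> {}"
  obtains M where "M \<in> G" "\<And>t. t \<in> T \<Longrightarrow> g t = moebius M (f t)"
proof -
  obtain t0 where t0: "t0 \<in> T" using assms by auto
  with assms obtain M where M: "M \<in> G" "moebius M (f t0) = g t0"
    using p_eq_iff[of "f t0" "g t0"] by (auto simp: image_subset_iff)
  show thesis
    by (rule that[OF M(1)]) (use lift_unique_moebius[OF assms(1-6) M(1) t0] M in auto)
qed

definition is_lift :: "(real \<Rightarrow> 'a) \<Rightarrow> (real \<Rightarrow> complex) \<Rightarrow> bool" where
  "is_lift f g \<longleftrightarrow> path g \<and> path_image g \<subseteq> upper_half \<and> (\<forall>t\<in>{0..1}. p (g t) = f t)"

text \<open>The lift may start over any preimage, so the matrix is determined only up to sign and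
  conjugation, and only the absolute value of its trace is meaningful.\<close>

definition free_holonomy :: "(real \<Rightarrow> 'a) \<Rightarrow> real^2^2 \<Rightarrow> bool" where
  "free_holonomy f M \<longleftrightarrow> M \<in> G \<and> (\<exists>g. is_lift f g \<and> pathfinish g = moebius M (pathstart g))"

text \<open>Two lifts of \<open>f\<close> differ by a deck transformation \<open>P\<close>, which
  intertwines \<open>M\<close> and \<open>N\<close> up to sign.\<close>

lemma free_holonomy_unique:
  assumes "free_holonomy f M" "free_holonomy f N"
  shows "\<bar>trace M\<bar> = \<bar>trace N\<bar>"
proof -
  obtain g h where gh: "is_lift f g" "pathfinish g = moebius M (pathstart g)"
    "is_lift f h" "pathfinish h = moebius N (pathstart h)" and G: "M \<in> G" "N \<in> G"
    using assms by (auto simp: free_holonomy_def)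
  have im: "Im (pathstart g) > 0" 
    using gh by (auto simp: is_lift_def dest: subsetD[OF _ pathstart_in_path_image])
  obtain P where P: "P \<in> G" "\<And>t. t \<in> {0..1} \<Longrightarrow> h t = moebius P (g t)"
    by (rule lifts_differ_by_deck[of "{0..1}" g h]) (use gh in \<open>auto simp: is_lift_def path_def path_image_def\<close>)
  have det: "det M = 1" "det N = 1" "det P = 1" using G P by (auto intro: G_closed)
  have "moebius (P ** M) (pathstart g) = moebius (N ** P) (pathstart g)"
    using gh P(2)[of 0] P(2)[of 1] det im by (simp add: moebius_mult pathstart_def pathfinish_def)
  then have "P ** M = N ** P \<or> P ** M = - (N ** P)"
    using G P im by (intro moebius_eq_imp_eq) (auto intro: G_closed)
  moreover have "N = N ** P ** adj2 P" using det by (simp add: adj2_inverse flip: matrix_mul_assoc)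
  ultimately have "N = P ** M ** adj2 P \<or> N = - (P ** M ** adj2 P)" by (metis matrix_neg_mult(1) minus_minus)
  then show ?thesis by (metis abs_minus_cancel trace_neg2 trace_conj[OF det(3)])
qed

text \<open>The whole homotopy is lifted. The sides \<open>k (t, 0)\<close> and
  \<open>k (t, 1)\<close> lift the same track of the base point, so the relation given by
  \<open>M\<close> persists from \<open>t = 0\<close> to \<open>t = 1\<close>.\<close>

lemma free_holonomy_homotopic:
  assumes "free_holonomy f M" "homotopic_loops S f g"
  shows "free_holonomy g M"
proof -
  obtain f' where f': "is_lift f f'" "pathfinish f' = moebius M (pathstart f')" and M: "M \<in> G"
    using assms by (auto simp: free_holonomy_def)
  obtain h :: "real \<times> real \<Rightarrow> 'a" where h: "continuous_on ({0..1} \<times> {0..1}) h" "h \<in> {0..1} \<times> {0..1} \<rightarrow> S"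
    "\<And>x. x \<in> {0..1} \<Longrightarrow> h (0, x) = f x" "\<And>x. x \<in> {0..1} \<Longrightarrow> h (1, x) = g x" 
    "\<And>t. t \<in> {0..1} \<Longrightarrow> h (t, 1) = h (t, 0)"
    using assms(2) unfolding homotopic_loops by (auto simp: pathfinish_def pathstart_def)
  obtain k where k: "continuous_on ({0..1} \<times> {0..1}) k" "k \<in> ({0..1} \<times> {0..1}) \<rightarrow> upper_half"
    "\<And>y. y \<in> {0..1} \<Longrightarrow> k (0, y) = f' y" "\<And>z. z \<in> {0..1} \<times> {0..1} \<Longrightarrow> h z = p (k z)"
    by (rule covering_space_lift_homotopy[OF covering h(1), of f'])
      (use f' h in \<open>auto simp: is_lift_def path_def path_image_def image_subset_iff\<close>)
  have "k (1, 1) = moebius M (k (1, 0))"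
  proof (rule lift_unique_moebius[of "{0..1::real}" "\<lambda>t. k (t, 0)" "\<lambda>t. k (t, 1)" M 0 1])
    show "continuous_on {0..1} (\<lambda>t. k (t, 0))" "continuous_on {0..1} (\<lambda>t. k (t, 1))"
      by (intro continuous_on_compose2[OF k(1)] continuous_intros; auto)+
    show "(\<lambda>t. k (t, 0)) ` {0..1} \<subseteq> upper_half" "(\<lambda>t. k (t, 1)) ` {0..1} \<subseteq> upper_half" using k(2) by force+
    show "p (k (t, 0)) = p (k (t, 1))" if "t \<in> {0..1}" for t using k(4) h(5) that by force
    show "k (0, 1) = moebius M (k (0, 0))" using f' k(3) by (simp add: pathstart_def pathfinish_def)
  qed (use M in auto)
  moreover have "is_lift g (\<lambda>x. k (1, x))"
    unfolding is_lift_def path_def path_image_def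
  proof (intro conjI)
    show "continuous_on {0..1} (\<lambda>x. k (1, x))" 
      by (intro continuous_on_compose2[OF k(1)] continuous_intros; auto)
    show "(\<lambda>x. k (1, x)) ` {0..1} \<subseteq> upper_half" using k(2) by force
    show "\<forall>t\<in>{0..1}. p (k (1, t)) = g t" using k(4) h(4) by force
  qed
  ultimately show ?thesis using M unfolding free_holonomy_def
    by (intro conjI exI[of _ "\<lambda>x. k (1, x)"]) (auto simp: pathstart_def pathfinish_def)
qed

end

section \<open>The fundamental group as a group of loop classes\<close>

lemma fundamental_group_simps:
  "carrier (fundamental_group S x0) = homotopy_class S `
        {f. path f \<and> path_image f \<subseteq> S \<and> pathstart f = x0 \<and> pathfinish f = x0}"
  "one (fundamental_group S x0) = homotopy_class S (\<lambda>_. x0)"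
  by (simp_all add: fundamental_group_def)

lemma homotopy_class_eq:
  assumes "homotopic_paths S f g"
  shows "homotopy_class S f = homotopy_class S g"
proof -
  have "homotopic_paths S g f" using assms by (rule homotopic_paths_sym_eq[THEN iffD1])
  with assms have "homotopic_paths S f h \<longleftrightarrow> homotopic_paths S g h" for h
    using homotopic_paths_trans by blast
  then show ?thesis by (simp add: homotopy_class_def)
qed

lemma homotopy_class_mult:
  assumes "path f" "path_image f \<subseteq> S" "path g" "path_image g \<subseteq> S" "pathfinish f = pathstart g"
  shows "homotopy_class S f \<otimes>\<^bsub>fundamental_group S x0\<^esub> homotopy_class S g = homotopy_class S (f +++ g)"
proof -
  have refl: "homotopic_paths S f f" "homotopic_paths S g g" using assms by simp_all
  have "homotopic_paths S (f +++ g) h" 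
    if "homotopic_paths S f f'" "homotopic_paths S g g'" "homotopic_paths S (f' +++ g') h" for f' g' h
    using that assms homotopic_paths_join homotopic_paths_trans by blast
  then have "{h. \<exists>f'\<in>homotopy_class S f. \<exists>g'\<in>homotopy_class S g. homotopic_paths S (f' +++ g') h} = homotopy_class S (f +++ g)"
    using refl unfolding homotopy_class_def by blast
  then show ?thesis unfolding fundamental_group_def by simp
qed

lemma group_fundamental_group:
  fixes x0 :: "'a::real_normed_vector"
  assumes "x0 \<in> S"
  shows "group (fundamental_group S x0)"
proof (rule groupI)
  let ?G = "fundamental_group S x0"
  note [simp] = fundamental_group_simps homotopy_class_mult
  have const: "(\<lambda>_. x0) = linepath x0 x0" by (auto simp: linepath_def algebra_simps)
  show "\<one>\<^bsub>?G\<^esub> \<in> carrier ?G" using assms unfolding fundamental_group_simps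
    by (intro imageI) (auto simp: path_def pathstart_def pathfinish_def path_image_def)
  fix x assume x: "x \<in> carrier ?G"
  then obtain f where f: "x = homotopy_class S f" "path f" "path_image f \<subseteq> S" "pathstart f = x0" "pathfinish f = x0"
    by auto
  show "\<one>\<^bsub>?G\<^esub> \<otimes>\<^bsub>?G\<^esub> x = x"
    using f assms homotopic_paths_lid[of f S] unfolding fundamental_group_simps const
    by (simp add: homotopy_class_eq)
  show "\<exists>y\<in>carrier ?G. y \<otimes>\<^bsub>?G\<^esub> x = \<one>\<^bsub>?G\<^esub>"
  proof
    show "homotopy_class S (reversepath f) \<in> carrier ?G"
      using f unfolding fundamental_group_simps by (intro imageI) auto
    show "homotopy_class S (reversepath f) \<otimes>\<^bsub>?G\<^esub> x = \<one>\<^bsub>?G\<^esub>"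
      using f homotopic_paths_linv[of f S] unfolding fundamental_group_simps const
      by (simp add: homotopy_class_eq)
  qed
  fix y assume y: "y \<in> carrier ?G"
  then obtain g where g: "y = homotopy_class S g" "path g" "path_image g \<subseteq> S" "pathstart g = x0" "pathfinish g = x0"
    by auto
  show "x \<otimes>\<^bsub>?G\<^esub> y \<in> carrier ?G"
    using f g unfolding fundamental_group_simps
    by (simp add: path_image_join image_iff) (rule exI[of _ "f +++ g"], simp add: path_image_join)
  fix z assume z: "z \<in> carrier ?G"
  then obtain h where h: "z = homotopy_class S h" "path h" "path_image h \<subseteq> S" "pathstart h = x0" "pathfinish h = x0"
    by auto
  show "x \<otimes>\<^bsub>?G\<^esub> y \<otimes>\<^bsub>?G\<^esub> z = x \<otimes>\<^bsub>?G\<^esub> (y \<otimes>\<^bsub>?G\<^esub> z)"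
    using f g h homotopic_paths_assoc[of f S g h] homotopic_paths_sym
    by (auto simp: path_image_join intro!: homotopy_class_eq)
qed

lemma inv_fundamental_group:
  fixes x0 :: "'a::real_normed_vector"
  assumes "path f" "path_image f \<subseteq> S" "pathstart f = x0" "pathfinish f = x0"
  shows "inv\<^bsub>fundamental_group S x0\<^esub> homotopy_class S f = homotopy_class S (reversepath f)"
proof -
  have x0: "x0 \<in> S" using assms by auto
  have const: "(\<lambda>_. x0) = linepath x0 x0" by (auto simp: linepath_def algebra_simps)
  show ?thesis
    using assms homotopic_paths_linv[of f S]
    by (intro group.inv_equality[OF group_fundamental_group[OF x0]])
       (auto simp: fundamental_group_simps homotopy_class_mult const intro!: homotopy_class_eq imageI)
qed

section \<open>Closed geodesics and traces\<close>

context uniformization begin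

text \<open>The geodesic is lifted over the whole real line. The lift shifted by \<open>L\<close>
  differs from the lift by a deck transformation \<open>A\<close>, a translation along it;
  \<open>A\<close> and \<open>M\<close> are free holonomies of the same loop.\<close>

lemma geodesic_length_holonomy:
  assumes "Metric_space S d" "Metric_space.mtopology S d = top_of_set S"
    and "geodesic_length_rel S d \<gamma> L" "\<And>f. f \<in> \<gamma> \<Longrightarrow> free_holonomy f M"
  shows "L > 0 \<and> \<bar>trace M\<bar> = 2 * cosh (L / 2)"
proof -
  interpret Metric_space S d by (rule assms(1))
  obtain c f where c: "closed_geodesic S d L c" and f: "f \<in> \<gamma>" "homotopic_loops S f (\<lambda>t. c (L * t))"
    using assms(3) by (auto simp: geodesic_length_rel_def)
  have L: "L > 0" and cS: "\<And>t. c t \<in> S" and per: "\<And>t. c (t + L) = c t"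
    and iso: "\<And>t. \<exists>e>0. \<forall>s\<in>{t-e<..<t+e}. \<forall>s'\<in>{t-e<..<t+e}. d (c s) (c s') = \<bar>s - s'\<bar>"
    using c by (auto simp: closed_geodesic_def)
  have "continuous_map euclidean mtopology c"
    unfolding continuous_map_to_metric
  proof (intro ballI allI impI)
    fix t \<epsilon> :: real assume "\<epsilon> > 0"
    obtain e where e: "e > 0" "\<forall>s\<in>{t-e<..<t+e}. \<forall>s'\<in>{t-e<..<t+e}. d (c s) (c s') = \<bar>s - s'\<bar>"
      using iso by blast
    show "\<exists>U. openin euclidean U \<and> t \<in> U \<and> (\<forall>y\<in>U. c y \<in> mball (c t) \<epsilon>)"
    proof (intro exI conjI ballI)
      show "openin euclidean (ball t (min e \<epsilon>))" "t \<in> ball t (min e \<epsilon>)" using e \<open>\<epsilon> > 0\<close> by auto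
      fix y assume y: "y \<in> ball t (min e \<epsilon>)"
      then have "d (c t) (c y) = \<bar>t - y\<bar>" using e by (auto simp: dist_real_def abs_less_iff)
      with y cS show "c y \<in> mball (c t) \<epsilon>" by (simp add: dist_real_def)
    qed
  qed
  then have contc: "continuous_on UNIV c" by (simp add: assms(2) continuous_map_in_subtopology)
  obtain C where C: "continuous_on UNIV C" "C \<in> UNIV \<rightarrow> upper_half" "\<And>t. p (C t) = c t"
    by (rule covering_space_lift[OF covering, of "UNIV :: real set" c])
       (use contc cS in \<open>auto simp: convex_imp_simply_connected convex_imp_locally_path_connected\<close>)
  have ImC: "Im (C t) > 0" for t using C(2) by auto
  obtain A where A: "A \<in> G" "\<And>t. C (t + L) = moebius A (C t)"
  proof (rule lifts_differ_by_deck[of UNIV C "\<lambda>t. C (t + L)"])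
    show "continuous_on UNIV (\<lambda>t. C (t + L))" 
      by (intro continuous_on_compose2[OF C(1)] continuous_intros) auto
  qed (use C ImC per in auto)
  have "free_holonomy (\<lambda>t. c (L * t)) A"
    unfolding free_holonomy_def is_lift_def path_def path_image_def
  proof (intro conjI exI)
    show "continuous_on {0..1} (\<lambda>t. C (L * t))"
      by (intro continuous_on_compose2[OF C(1)] continuous_intros) auto
    show "pathfinish (\<lambda>t. C (L * t)) = moebius A (pathstart (\<lambda>t. C (L * t)))"
      using A(2)[of 0] by (simp add: pathstart_def pathfinish_def)
  qed (use A C ImC in auto)
  moreover have "free_holonomy (\<lambda>t. c (L * t)) M"
    using assms(4)[OF f(1)] f(2) by (rule free_holonomy_homotopic)
  ultimately have "\<bar>trace M\<bar> = \<bar>trace A\<bar>" by (intro free_holonomy_unique)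
  also have "\<bar>trace A\<bar> = 2 * cosh (L / 2)"
  proof (rule trace_translation[OF ImC])
    show "det A = 1" using A by (auto intro: G_closed)
    fix t
    \<comment> \<open>Near \<open>t\<close> the lift stays in a ball on which \<open>p\<close> is
      isometric, so that arc length parametrization passes from \<open>c\<close> to
      \<open>C\<close>.\<close>
    obtain r where r: "r > 0" "isometric_embedding (hball (C t) r) d p"
      using local_isometry[OF ImC] by blast
    have "open (C -` (hball (C t) r))"
      using open_hdist_ball[OF ImC r(1)] C(1) by (rule open_vimage)
    moreover have "t \<in> C -` (hball (C t) r)" using r ImC by auto
    ultimately obtain e1 where e1: "e1 > 0" "ball t e1 \<subseteq> C -` (hball (C t) r)"
      by (meson open_contains_ball)
    obtain e2 where e2: "e2 > 0" "\<forall>s\<in>{t-e2<..<t+e2}. \<forall>s'\<in>{t-e2<..<t+e2}. d (c s) (c s') = \<bar>s - s'\<bar>"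
      using iso by blast
    show "\<exists>e>0. \<forall>s\<in>{t-e<..<t+e}. \<forall>s'\<in>{t-e<..<t+e}. hdist (C s) (C s') = \<bar>s - s'\<bar>"
    proof (intro exI[of _ "min e1 e2"] conjI ballI)
      fix s s' assume s: "s \<in> {t - min e1 e2<..<t + min e1 e2}" "s' \<in> {t - min e1 e2<..<t + min e1 e2}"
      moreover have "min e1 e2 \<le> e1" "min e1 e2 \<le> e2" by auto
      ultimately have "s \<in> ball t e1" "s' \<in> ball t e1" and s2: "s \<in> {t-e2<..<t+e2}" "s' \<in> {t-e2<..<t+e2}"
        by (auto simp: dist_real_def abs_less_iff)
      then have "C s \<in> hball (C t) r" "C s' \<in> hball (C t) r"
        using e1(2) by auto
      then have "d (p (C s)) (p (C s')) = hdist (C s) (C s')"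
        using r(2) unfolding isometric_embedding_def by blast
      then show "hdist (C s) (C s') = \<bar>s - s'\<bar>" using e2(2) s2 C(3) by simp
    qed (use e1 e2 in auto)
  qed (rule A(2))
  finally show ?thesis using L by simp
qed

text \<open>A class without closed geodesic has the default length 0 and \<open>Tr = 2\<close>, so
  \<open>Tr > 2\<close> provides a geodesic. Its length is unique because \<open>trace M\<close>
  determines it.\<close>

lemma Tr_holonomy:
  assumes "Metric_space S d" "Metric_space.mtopology S d = top_of_set S"
    and "Tr S d \<gamma> > 2" "\<And>f. f \<in> \<gamma> \<Longrightarrow> free_holonomy f M"
  shows "Tr S d \<gamma> = \<bar>trace M\<bar>"
proof -
  have ex: "\<exists>L. geodesic_length_rel S d \<gamma> L"
  proof (rule ccontr)
    assume "\<not> ?thesis"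
    then have "geodesic_length S d \<gamma> = 0" by (simp add: geodesic_length_def)
    with assms(3) show False by (simp add: Tr_def)
  qed
  then obtain L where L: "geodesic_length_rel S d \<gamma> L" by blast
  note * = geodesic_length_holonomy[OF assms(1,2) _ assms(4)]
  have "geodesic_length S d \<gamma> = L"
    unfolding geodesic_length_def if_P[OF ex]
  proof (rule the_equality)
    show "geodesic_length_rel S d \<gamma> L" by (rule L)
    fix L' assume L': "geodesic_length_rel S d \<gamma> L'"
    have "cosh (L' / 2) = cosh (L / 2)" "L > 0" "L' > 0" using *[OF L] *[OF L'] by auto
    then show "L' = L" using cosh_real_nonneg_less_iff[of "L'/2" "L/2"] cosh_real_nonneg_less_iff[of "L/2" "L'/2"]
      by linarith
  qed
  then show ?thesis using *[OF L] by (simp add: Tr_def)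
qed

section \<open>Holonomy of based loops\<close>

abbreviation "pi1 z0 \<equiv> fundamental_group S (p z0)"

text \<open>A relation, since the matrix is determined only up to sign. All lifts start at
  \<open>z0\<close>, which makes products of loops correspond to products of matrices.\<close>

definition path_holonomy :: "complex \<Rightarrow> (real \<Rightarrow> 'a) \<Rightarrow> real^2^2 \<Rightarrow> bool" where
  "path_holonomy z0 f M \<longleftrightarrow>
     M \<in> G \<and> (\<exists>g. is_lift f g \<and> pathstart g = z0 \<and> pathfinish g = moebius M z0)"

definition holonomy :: "complex \<Rightarrow> (real \<Rightarrow> 'a) set \<Rightarrow> real^2^2 \<Rightarrow> bool" where
  "holonomy z0 \<gamma> M \<longleftrightarrow>
     \<gamma> \<in> carrier (pi1 z0) \<and> (\<exists>f. \<gamma> = homotopy_class S f \<and> path_holonomy z0 f M)"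

lemma path_holonomy_loop:
  assumes "path_holonomy z0 f M" "Im z0 > 0"
  shows "path f" "path_image f \<subseteq> S" "pathstart f = p z0" "pathfinish f = p z0"
proof -
  obtain g where M: "M \<in> G" and g: "is_lift f g" "pathstart g = z0" "pathfinish g = moebius M z0"
    using assms by (auto simp: path_holonomy_def)
  have "path (p \<circ> g)" using g by (intro path_continuous_image continuous_on_subset[OF continuous_on_p])
      (auto simp: is_lift_def)
  then show "path f" using g by (auto simp: is_lift_def intro: path_eq)
  show "path_image f \<subseteq> S" 
  proof -
    have "f t \<in> S" if "t \<in> {0..1}" for t
      using g p_in_S[of "g t"] that by (auto simp: is_lift_def path_image_def image_subset_iff)
    then show ?thesis by (auto simp: path_image_def)
  qed
  show "pathstart f = p z0" "pathfinish f = p z0"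
    using g(1)[unfolded is_lift_def] g(2,3) p_moebius[OF M assms(2)]
    by (metis atLeastAtMost_iff order_refl pathfinish_def pathstart_def zero_le_one)+
qed

lemma path_holonomy_homotopic:
  assumes "path_holonomy z0 f M" "homotopic_paths S f g"
  shows "path_holonomy z0 g M"
proof -
  obtain h where h: "is_lift f h" "pathstart h = z0" "pathfinish h = moebius M z0" and M: "M \<in> G"
    using assms by (auto simp: path_holonomy_def)
  obtain h' where "path h'" "path_image h' \<subseteq> upper_half"
    "pathstart h' = z0" "pathfinish h' = moebius M z0" "\<And>t. t \<in> {0..1} \<Longrightarrow> p (h' t) = g t"
    by (rule covering_space_lift_homotopic_path[OF covering assms(2), of h z0 "moebius M z0"])
      (use h in \<open>auto simp: is_lift_def\<close>)
  with M show ?thesis by (auto simp: path_holonomy_def is_lift_def)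
qed

lemma path_holonomy_ex:
  assumes "path f" "path_image f \<subseteq> S" "pathstart f = p z0" "pathfinish f = p z0" "Im z0 > 0"
  shows "\<exists>M. path_holonomy z0 f M"
proof -
  obtain g where g: "path g" "path_image g \<subseteq> upper_half" "pathstart g = z0" "\<And>t. t \<in> {0..1} \<Longrightarrow> p (g t) = f t"
    by (rule covering_space_lift_path_strong[OF covering, of z0 f]) (use assms in auto)
  have "p (pathfinish g) = p z0" using g(4)[of 1] assms(4) by (simp add: pathfinish_def)
  moreover have "Im (pathfinish g) > 0" using g(2) pathfinish_in_path_image[of g] by (auto simp: subset_iff)
  ultimately obtain M where "M \<in> G" "moebius M z0 = pathfinish g" using p_eq_iff assms(5) by metis
  with g show ?thesis unfolding path_holonomy_def is_lift_def
    by (intro exI[of _ M] conjI exI[of _ g]) auto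
qed

lemma path_holonomy_unique:
  assumes "path_holonomy z0 f M" "path_holonomy z0 f N" "Im z0 > 0"
  shows "M = N \<or> M = - N"
proof -
  obtain g h where M: "M \<in> G" and g: "is_lift f g" "pathstart g = z0" "pathfinish g = moebius M z0"
    and N: "N \<in> G" and h: "is_lift f h" "pathstart h = z0" "pathfinish h = moebius N z0"
    using assms by (auto simp: path_holonomy_def)
  have "h 1 = moebius (mat 1) (g 1)"
    by (rule lift_unique_moebius[of "{0..1}" g h "mat 1" 0 1])
      (use g h in \<open>auto simp: is_lift_def path_def path_image_def pathstart_def intro: G_closed\<close>)
  then have "moebius M z0 = moebius N z0" using g h by (simp add: pathfinish_def)
  with moebius_eq_imp_eq[OF M N assms(3)] show ?thesis by blast
qed

text \<open>The lift of \<open>f\<close> ends at \<open>M z0\<close> and is continued by the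
  \<open>M\<close>-translate of the lift of \<open>g\<close>, which ends at \<open>M (N z0)\<close>:
  the order of the factors is preserved.\<close>

lemma path_holonomy_join:
  assumes "path_holonomy z0 f M" "path_holonomy z0 g N" "Im z0 > 0"
  shows "path_holonomy z0 (f +++ g) (M ** N)"
proof -
  obtain f' g' where M: "M \<in> G" and f': "is_lift f f'" "pathstart f' = z0" "pathfinish f' = moebius M z0"
    and N: "N \<in> G" and g': "is_lift g g'" "pathstart g' = z0" "pathfinish g' = moebius N z0"
    using assms by (auto simp: path_holonomy_def)
  have det: "det M = 1" "det N = 1" using M N by (auto intro: G_closed)
  let ?h = "f' +++ (moebius M \<circ> g')"
  have Mg: "path (moebius M \<circ> g')" "path_image (moebius M \<circ> g') \<subseteq> upper_half"
    "pathstart (moebius M \<circ> g') = moebius M z0"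
    using g' det by (auto simp: is_lift_def path_image_compose moebius_upper_half pathstart_compose
      intro!: path_continuous_image continuous_on_subset[OF continuous_on_moebius])
  have "is_lift (f +++ g) ?h"
    unfolding is_lift_def
  proof (intro conjI ballI)
    show "path ?h" using f' Mg by (intro path_join_imp) (auto simp: is_lift_def)
    show "path_image ?h \<subseteq> upper_half" using f' Mg by (intro subset_path_image_join) (auto simp: is_lift_def)
    show "p (?h t) = (f +++ g) t" if t: "t \<in> {0..1}" for t
    proof (cases "t \<le> 1/2")
      case False
      then have "Im (g' (2 * t - 1)) > 0" using g' t by (auto simp: is_lift_def path_image_def image_subset_iff)
      then show ?thesis using False t g' p_moebius[OF M] by (simp add: joinpaths_def is_lift_def)
    qed (use f' t in \<open>auto simp: joinpaths_def is_lift_def\<close>)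
  qed
  moreover have "pathfinish ?h = moebius (M ** N) z0"
    using g' det assms(3) by (simp add: pathfinish_compose moebius_mult)
  ultimately show ?thesis using M N f'
    unfolding path_holonomy_def by (intro conjI exI[of _ ?h]) (auto intro: G_closed)
qed

lemma path_holonomy_reversepath:
  assumes "path_holonomy z0 f M" "Im z0 > 0"
  shows "path_holonomy z0 (reversepath f) (adj2 M)"
proof -
  obtain g where M: "M \<in> G" and g: "is_lift f g" "pathstart g = z0" "pathfinish g = moebius M z0"
    using assms by (auto simp: path_holonomy_def)
  have det: "det (adj2 M) = 1" "det M = 1" using G_closed(1)[OF M] by auto
  let ?h = "moebius (adj2 M) \<circ> reversepath g"
  have im: "path_image g \<subseteq> upper_half" "path g" using g by (auto simp: is_lift_def)
  have "is_lift (reversepath f) ?h"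
    unfolding is_lift_def
  proof (intro conjI ballI)
    show "path ?h" using im det
      by (intro path_continuous_image continuous_on_subset[OF continuous_on_moebius]) auto
    show "path_image ?h \<subseteq> upper_half" using im det by (auto simp: path_image_compose moebius_upper_half)
    show "p (?h t) = reversepath f t" if t: "t \<in> {0..1}" for t
    proof -
      have "Im (g (1 - t)) > 0" using im t by (auto simp: path_image_def image_subset_iff)
      then show ?thesis using t g p_moebius[OF G_closed(4)[OF M]] by (simp add: reversepath_def is_lift_def)
    qed
  qed
  moreover have "pathstart ?h = z0"
    using g det assms(2) by (simp add: pathstart_compose adj2_inverse flip: moebius_mult)
  moreover have "pathfinish ?h = moebius (adj2 M) z0" using g by (simp add: pathfinish_compose)
  ultimately show ?thesis using M unfolding path_holonomy_def by (auto intro: G_closed)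
qed

lemma path_holonomy_surj:
  assumes "M \<in> G" "Im z0 > 0"
  shows "\<exists>f. path_holonomy z0 f M"
proof -
  let ?g = "linepath z0 (moebius M z0)"
  have "Im (moebius M z0) > 0" using assms G_closed(1) by (simp add: moebius_upper_half)
  then have "path_image ?g \<subseteq> upper_half"
    using convex_upper_half assms(2) by (simp add: closed_segment_subset)
  then show ?thesis using assms unfolding path_holonomy_def is_lift_def
    by (intro exI[of _ "p \<circ> ?g"] conjI exI[of _ ?g]) auto
qed

text \<open>Faithfulness modulo sign: the lift is closed and contracts linearly in the convex half
  plane, and \<open>p\<close> carries the contraction to \<open>S\<close>.\<close>

lemma path_holonomy_trivial:
  assumes "path_holonomy z0 f M" "Im z0 > 0" "M = mat 1 \<or> M = - mat 1"
  shows "homotopic_paths S f (\<lambda>_. p z0)"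
proof -
  obtain g where g: "is_lift f g" "pathstart g = z0" "pathfinish g = z0"
    using assms by (auto simp: path_holonomy_def)
  then have "homotopic_paths upper_half g (linepath z0 z0)"
  proof (intro homotopic_paths_linear)
    fix t :: real assume "t \<in> {0..1}"
    with g have "g t \<in> upper_half" unfolding is_lift_def path_image_def by blast
    then show "closed_segment (g t) (linepath z0 z0 t) \<subseteq> upper_half"
      using assms(2) by (intro closed_segment_subset convex_upper_half) (auto simp: linepath_refl)
  qed (use g in \<open>auto simp: is_lift_def\<close>)
  then have "homotopic_paths S (p \<circ> g) (p \<circ> linepath z0 z0)"
    by (rule homotopic_paths_continuous_image[OF _ continuous_on_p]) (auto intro: p_in_S)
  moreover have "homotopic_paths S (p \<circ> g) f"
  proof (rule homotopic_paths_eq)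
    show "path (p \<circ> g)" "path_image (p \<circ> g) \<subseteq> S" using calculation homotopic_paths_imp_path homotopic_paths_imp_subset by blast+
  qed (use g in \<open>auto simp: is_lift_def\<close>)
  moreover have "p \<circ> linepath z0 z0 = (\<lambda>_. p z0)" by (auto simp: fun_eq_iff linepath_refl)
  ultimately show ?thesis by (metis homotopic_paths_sym homotopic_paths_trans)
qed

lemma holonomyI:
  assumes "path_holonomy z0 f M" "Im z0 > 0"
  shows "holonomy z0 (homotopy_class S f) M"
  using assms path_holonomy_loop[OF assms] by (auto simp: holonomy_def fundamental_group_simps)

lemma holonomy_mult:
  assumes "holonomy z0 \<gamma> M" "holonomy z0 \<delta> N" "Im z0 > 0"
  shows "holonomy z0 (\<gamma> \<otimes>\<^bsub>pi1 z0\<^esub> \<delta>) (M ** N)"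
proof -
  obtain f g where f: "\<gamma> = homotopy_class S f" "path_holonomy z0 f M"
    and g: "\<delta> = homotopy_class S g" "path_holonomy z0 g N" using assms by (auto simp: holonomy_def)
  have "\<gamma> \<otimes>\<^bsub>pi1 z0\<^esub> \<delta> = homotopy_class S (f +++ g)"
    using path_holonomy_loop[OF f(2) assms(3)] path_holonomy_loop[OF g(2) assms(3)]
    by (simp add: f(1) g(1) homotopy_class_mult)
  with holonomyI[OF path_holonomy_join[OF f(2) g(2) assms(3)] assms(3)] show ?thesis by simp
qed

lemma holonomy_inv:
  assumes "holonomy z0 \<gamma> M" "Im z0 > 0"
  shows "holonomy z0 (inv\<^bsub>pi1 z0\<^esub> \<gamma>) (adj2 M)"
proof -
  obtain f where f: "\<gamma> = homotopy_class S f" "path_holonomy z0 f M" using assms by (auto simp: holonomy_def)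
  have "inv\<^bsub>pi1 z0\<^esub> \<gamma> = homotopy_class S (reversepath f)"
    unfolding f(1) by (intro inv_fundamental_group path_holonomy_loop[OF f(2) assms(2)])
  with holonomyI[OF path_holonomy_reversepath[OF f(2) assms(2)] assms(2)] show ?thesis by simp
qed

lemma holonomy_ex:
  assumes "\<gamma> \<in> carrier (pi1 z0)" "Im z0 > 0"
  shows "\<exists>M. holonomy z0 \<gamma> M"
  using assms path_holonomy_ex unfolding holonomy_def fundamental_group_simps by blast

lemma holonomy_G: "holonomy z0 \<gamma> M \<Longrightarrow> M \<in> G"
  by (auto simp: holonomy_def path_holonomy_def)

lemma holonomy_imp_path_holonomy:
  assumes "holonomy z0 \<gamma> M" "f \<in> \<gamma>"
  shows "path_holonomy z0 f M"
  using assms path_holonomy_homotopic by (auto simp: holonomy_def homotopy_class_def)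

lemma path_imp_free_holonomy: "path_holonomy z0 f M \<Longrightarrow> free_holonomy f M"
  by (auto simp: path_holonomy_def free_holonomy_def)

lemma holonomy_surj:
  assumes "M \<in> G" "Im z0 > 0"
  shows "\<exists>\<gamma>. holonomy z0 \<gamma> M"
proof -
  obtain f where f: "path_holonomy z0 f M" using path_holonomy_surj[OF assms] by blast
  with holonomyI[OF f assms(2)] show ?thesis by blast
qed

lemma holonomy_unique:
  assumes "holonomy z0 \<gamma> M" "holonomy z0 \<gamma> N" "Im z0 > 0"
  shows "M = N \<or> M = - N"
proof -
  obtain f where f: "\<gamma> = homotopy_class S f" "path_holonomy z0 f M" using assms by (auto simp: holonomy_def)
  then have "f \<in> \<gamma>" using path_holonomy_loop[OF f(2) assms(3)] by (simp add: homotopy_class_def)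
  then show ?thesis using holonomy_imp_path_holonomy assms path_holonomy_unique by blast
qed

lemma holonomy_trivial:
  assumes "holonomy z0 \<gamma> M" "Im z0 > 0" "M = mat 1 \<or> M = - mat 1"
  shows "\<gamma> = \<one>\<^bsub>pi1 z0\<^esub>"
proof -
  obtain f where f: "\<gamma> = homotopy_class S f" "path_holonomy z0 f M" using assms by (auto simp: holonomy_def)
  show ?thesis
    unfolding f(1) fundamental_group_simps by (intro homotopy_class_eq path_holonomy_trivial[OF f(2) assms(2,3)])
qed

end

text \<open>Negatives are included so that this set can equal the full preimage of a Fuchsian
  group.\<close>

inductive_set matrix_group :: "real^2^2 \<Rightarrow> real^2^2 \<Rightarrow> (real^2^2) set" for A B where
  one: "mat 1 \<in> matrix_group A B"
| gen1: "A \<in> matrix_group A B"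
| gen2: "B \<in> matrix_group A B"
| mult: "M \<in> matrix_group A B \<Longrightarrow> N \<in> matrix_group A B \<Longrightarrow> M ** N \<in> matrix_group A B"
| adj: "M \<in> matrix_group A B \<Longrightarrow> adj2 M \<in> matrix_group A B"
| neg: "M \<in> matrix_group A B \<Longrightarrow> - M \<in> matrix_group A B"

context uniformization begin

lemma G_eq_matrix_group:
  assumes "Im z0 > 0" "generate (pi1 z0) {a, b} = carrier (pi1 z0)"
    and a: "holonomy z0 a A" and b: "holonomy z0 b B"
  shows "G = matrix_group A B"
proof
  have "\<exists>M. M \<in> matrix_group A B \<and> holonomy z0 \<gamma> M" if "\<gamma> \<in> generate (pi1 z0) {a, b}" for \<gamma>
    using that
  proof (induction rule: generate.induct)
    case one
    have "holonomy z0 \<one>\<^bsub>pi1 z0\<^esub> (mat 1)"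
    proof -
      obtain \<gamma> where \<gamma>: "holonomy z0 \<gamma> (mat 1)" using holonomy_surj[OF G_closed(2) assms(1)] by blast
      with holonomy_trivial[OF \<gamma> assms(1)] show ?thesis by simp
    qed
    then show ?case using matrix_group.one by blast
  next
    case (incl h)
    then show ?case using a b by (auto intro: matrix_group.intros)
  next
    case (inv h)
    then show ?case using holonomy_inv[OF a assms(1)] holonomy_inv[OF b assms(1)] 
      by (auto intro: matrix_group.intros)
  next
    case (eng h1 h2)
    then show ?case using holonomy_mult[OF _ _ assms(1)] by (blast intro: matrix_group.mult)
  qed
  then have ex: "\<exists>M. M \<in> matrix_group A B \<and> holonomy z0 \<gamma> M" if "\<gamma> \<in> carrier (pi1 z0)" for \<gamma>
    using that assms(2) by blast
  show "G \<subseteq> matrix_group A B"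
  proof
    fix M assume "M \<in> G"
    then obtain \<gamma> where \<gamma>: "holonomy z0 \<gamma> M" using holonomy_surj assms(1) by blast
    then obtain N where N: "N \<in> matrix_group A B" "holonomy z0 \<gamma> N" using ex unfolding holonomy_def by blast
    with holonomy_unique[OF \<gamma> N(2) assms(1)] show "M \<in> matrix_group A B" by (auto intro: matrix_group.neg)
  qed
  show "matrix_group A B \<subseteq> G"
  proof
    fix M assume "M \<in> matrix_group A B"
    then show "M \<in> G" using holonomy_G[OF a] holonomy_G[OF b]
      by induction (auto intro: G_closed)
  qed
qed

end

section \<open>The area of a hyperbolic end\<close>

lemma sets_harea [simp]: "sets harea = sets borel"
  by (simp add: harea_def)

text \<open>Finitely many balls on which \<open>p\<close> is isometric cover \<open>K\<close>. Made
  disjoint, they cut \<open>K\<close> into pieces whose images are disjoint by injectivity: an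
  admissible family in \<open>surface_area\<close>.\<close>

lemma surface_area_ge:
  assumes iso: "\<And>z. Im z > 0 \<Longrightarrow> \<exists>r>0. isometric_embedding (hball z r) d p"
    and K: "compact K" "K \<subseteq> upper_half" "inj_on p K" "p ` K \<subseteq> S"
  shows "emeasure harea K \<le> surface_area S d"
proof -
  obtain r where r: "\<And>z. Im z > 0 \<Longrightarrow> r z > 0 \<and> isometric_embedding (hball z (r z)) d p"
    using iso by metis
  define B where "B z = hball z (r z)" for z
  have B: "open (B z)" "z \<in> B z" if "z \<in> K" for z
    using that K(2) r[of z] open_hdist_ball[of z "r z"] by (auto simp: B_def)
  obtain C where C: "C \<subseteq> K" "finite C" "K \<subseteq> (\<Union>z\<in>C. B z)"
    by (rule compactE_image[OF K(1), of K B]) (use B in auto)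
  obtain e where e: "bij_betw e {0..<card C} C" using ex_bij_betw_nat_finite[OF C(2)] by blast
  define n where "n = card C"
  define A where "A i = K \<inter> B (e i)" for i
  define V where "V = disjointed A"
  have eK: "e i \<in> K" if "i < n" for i using e C(1) that by (auto simp: bij_betw_def n_def)
  have KA: "K = (\<Union>i\<in>{0..<n}. A i)"
  proof -
    have "C = e ` {0..<n}" using e by (simp add: bij_betw_def n_def)
    with C(3) show ?thesis unfolding A_def by blast
  qed
  then have KV: "K = (\<Union>i\<in>{0..<n}. V i)" by (simp add: V_def finite_UN_disjointed_eq)
  have Ab: "A i \<in> sets borel" if "i < n" for i
    unfolding A_def by (intro sets.Int borel_compact K(1) borel_open B(1) eK that)
  have V: "V i \<in> sets borel" "V i \<subseteq> K" "isometric_embedding (V i) d p" if "i < n" for i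
  proof -
    show "V i \<in> sets borel" unfolding V_def disjointed_def using Ab that by auto
    have "V i \<subseteq> A i" by (auto simp: V_def disjointed_def)
    then show "V i \<subseteq> K" by (auto simp: A_def)
    have "Im (e i) > 0" using eK[OF that] K(2) by auto
    then have "isometric_embedding (B (e i)) d p" using r by (simp add: B_def)
    then show "isometric_embedding (V i) d p"
      using \<open>V i \<subseteq> A i\<close> unfolding A_def isometric_embedding_def by blast
  qed
  have "emeasure harea K = (\<Sum>i<n. emeasure harea (V i))"
    unfolding KV atLeast0LessThan
    by (rule sum_emeasure[symmetric]) (use V disjoint_family_disjointed[of A] in \<open>auto simp: V_def disjoint_family_on_def\<close>)
  also have "\<dots> \<le> surface_area S d"
    unfolding surface_area_def
  proof (rule SUP_upper2[of "(n, V, \<lambda>_. p)"])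
    have "disjoint_family_on (\<lambda>i. p ` V i) {..<n}"
      unfolding disjoint_family_on_def
    proof (intro ballI impI)
      fix i j assume ij: "i \<in> {..<n}" "j \<in> {..<n}" "i \<noteq> j"
      then have "V i \<inter> V j = {}" using disjoint_family_disjointed[of A] by (auto simp: V_def disjoint_family_on_def)
      moreover have "p ` V i \<inter> p ` V j = p ` (V i \<inter> V j)"
        using ij V(2) by (intro inj_on_image_Int[OF K(3), symmetric]) auto
      ultimately show "p ` V i \<inter> p ` V j = {}" by simp
    qed
    moreover have "p ` V i \<subseteq> S" "V i \<subseteq> upper_half" if "i < n" for i using V(2)[OF that] K by auto
    ultimately show "(n, V, \<lambda>_. p) \<in> {(n, V, f). (\<forall>i<n. V i \<in> sets borel \<and> V i \<subseteq> upper_half \<and> f i ` V i \<subseteq> S \<and>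
                 isometric_embedding (V i) d (f i)) \<and> disjoint_family_on (\<lambda>i. f i ` V i) {..<n}}"
      using V by auto
  qed simp
  finally show ?thesis .
qed

text \<open>Below height \<open>2 * e\<close> the density is at least \<open>1 / (2 * e)^2\<close>,
  and the Euclidean area is \<open>(b - a) * e\<close>. For fixed width the bound grows without
  limit as \<open>e\<close> tends to 0.\<close>

lemma harea_box_ge:
  assumes "a \<le> b" "e > 0"
  shows "ennreal ((b - a) / (4 * e)) \<le> emeasure harea (cbox (Complex a e) (Complex b (2 * e)))"
proof -
  let ?K = "cbox (Complex a e) (Complex b (2 * e))"
  have inner: "Complex x y \<bullet> 1 = x" "Complex x y \<bullet> \<i> = y" for x y by (simp_all add: inner_complex_def)
  have "ennreal ((b - a) / (4 * e)) = ennreal (1 / (2 * e)\<^sup>2) * ennreal ((b - a) * e)"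
    using assms by (simp add: power2_eq_square field_simps flip: ennreal_mult)
  also have "ennreal ((b - a) * e) = emeasure lborel ?K"
  proof -
    have "emeasure lborel ?K = (\<Prod>b'\<in>Basis. (Complex b (2 * e) - Complex a e) \<bullet> b')"
      using assms by (intro emeasure_lborel_cbox) (auto simp: Basis_complex_def inner)
    then show ?thesis by (simp add: Basis_complex_def inner_diff_left inner)
  qed
  also have "ennreal (1 / (2 * e)\<^sup>2) * emeasure lborel ?K = (\<integral>\<^sup>+z. ennreal (1 / (2 * e)\<^sup>2) * indicator ?K z \<partial>lborel)"
    by (simp add: nn_integral_cmult_indicator)
  also have "\<dots> \<le> (\<integral>\<^sup>+z. ennreal (1 / (Im z)\<^sup>2) * indicator ?K z \<partial>lborel)"
  proof (rule nn_integral_mono)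
    fix z :: complex
    show "ennreal (1 / (2 * e)\<^sup>2) * indicator ?K z \<le> ennreal (1 / (Im z)\<^sup>2) * indicator ?K z"
    proof (cases "z \<in> ?K")
      case True
      then have "e \<le> Im z" "Im z \<le> 2 * e"
        using inner_complex_def by (auto simp: mem_box Basis_complex_def inner)
      then have "1 / (2 * e)\<^sup>2 \<le> 1 / (Im z)\<^sup>2" using assms by (intro divide_left_mono power_mono) auto
      then show ?thesis using True by (simp add: ennreal_leI)
    qed simp
  qed
  also have "\<dots> = emeasure harea ?K"
    unfolding harea_def by (rule emeasure_density[symmetric]) (auto intro!: borel_measurable_continuous_onI continuous_intros)
  finally show ?thesis .
qed

section \<open>A punctured neighbourhood of the puncture and its lift\<close>

definition end_chart :: "complex \<Rightarrow> complex \<times> complex" where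
  "end_chart w = (cis (Re w), cis (Im w))"

lemma continuous_on_end_chart: "continuous_on A end_chart"
  unfolding end_chart_def by (intro continuous_intros)

lemma cis_inj_small:
  assumes "cis x = cis y" "\<bar>x\<bar> \<le> 1" "\<bar>y\<bar> \<le> 1"
  shows "x = y"
proof -
  have "exp (\<i> * of_real x) = exp (\<i> * of_real y)" using assms by (simp add: cis_conv_exp)
  then obtain n :: int where "\<i> * of_real x = \<i> * of_real y + (of_int (2 * n) * of_real pi) * \<i>"
    by (auto simp: exp_eq)
  then have "x = y + 2 * of_int n * pi" by (auto simp: complex_eq_iff)
  moreover have "n = 0"
  proof (rule ccontr)
    assume "n \<noteq> 0"
    then have "1 \<le> \<bar>of_int n :: real\<bar>" by linarith
    then have "2 * pi \<le> \<bar>2 * of_int n * pi\<bar>" by (simp add: abs_mult)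
    with \<open>x = y + 2 * of_int n * pi\<close> assms(2,3) pi_gt3 show False by linarith
  qed
  ultimately show ?thesis by simp
qed

lemma end_chart_inj:
  assumes "end_chart z = end_chart w" "cmod z \<le> 1" "cmod w \<le> 1"
  shows "z = w"
  using assms abs_Re_le_cmod[of z] abs_Re_le_cmod[of w] abs_Im_le_cmod[of z] abs_Im_le_cmod[of w]
  by (auto simp: end_chart_def complex_eq_iff intro!: cis_inj_small)

lemma end_chart_0: "end_chart 0 = (1, 1)"
  by (simp add: end_chart_def)

lemma end_chart_in_punctured_torus:
  assumes "w \<noteq> 0" "cmod w \<le> 1"
  shows "end_chart w \<in> punctured_torus"
  using end_chart_inj[of w 0] assms by (auto simp: punctured_torus_def end_chart_def)

lemma puncture_loop_eq: "puncture_loop t = end_chart (exp (of_real (2 * pi * t) * \<i>))"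
  by (simp add: puncture_loop_def end_chart_def Re_exp Im_exp)

text \<open>Moves a modulus into a fundamental interval for the dilation by
  \<open>lam\<close>.\<close>

lemma powi_scale:
  fixes lam x :: real
  assumes "lam > 1" "x > 0"
  obtains k :: int where "1 \<le> lam powi k * x" "lam powi k * x \<le> lam"
proof -
  define k where "k = \<lfloor>log lam x\<rfloor>"
  have "x = lam powr (log lam x)" using assms by simp
  then have "lam powr (of_int k) \<le> x" "x \<le> lam powr (of_int k + 1)"
    using assms by (metis k_def of_int_floor_le powr_mono less_imp_le, 
      metis k_def real_of_int_floor_add_one_ge powr_mono less_imp_le)
  then have "lam powi k \<le> x" "x \<le> lam powi k * lam" using assms
    by (simp_all add: powr_real_of_int' powr_add)
  then show thesis using that[of "- k"] assms 
    by (simp add: power_int_minus field_simps)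
qed

abbreviation turn :: "int \<Rightarrow> complex" where
  "turn k \<equiv> of_real (2 * pi * of_int k) * \<i>"

text \<open>The end in normalized position. Through \<open>exp\<close> the closed left half plane
  covers the punctured unit disc of \<open>end_chart\<close>, and \<open>Re v\<close> tending to
  minus infinity means approaching the puncture. \<open>F\<close> is the lift; one turn around the
  puncture acts as the dilation by \<open>lam\<close>, whose axis is the imaginary axis.\<close>

locale hyperbolic_end =
  fixes p :: "complex \<Rightarrow> complex \<times> complex" and lam :: real and F :: "complex \<Rightarrow> complex"
  assumes continuous_p: "continuous_on upper_half p" and p_range: "p ` upper_half \<subseteq> punctured_torus"
    and lam: "lam > 1"
    and F_cont: "continuous_on {v. Re v \<le> 0} F" and F_upper: "Re v \<le> 0 \<Longrightarrow> Im (F v) > 0"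
    and p_F: "Re v \<le> 0 \<Longrightarrow> p (F v) = end_chart (exp v)"
    and F_shift: "Re v \<le> 0 \<Longrightarrow> F (v + of_real (2 * pi) * \<i>) = of_real lam * F v"
begin

lemma F_shift_nat: "Re v \<le> 0 \<Longrightarrow> F (v + turn (int n)) = of_real (lam ^ n) * F v"
proof (induction n)
  case (Suc n)
  have "v + turn (int (Suc n)) = (v + turn (int n)) + of_real (2 * pi) * \<i>"
    by (simp add: algebra_simps)
  also have "F \<dots> = of_real lam * F (v + turn (int n))"
    using Suc.prems by (intro F_shift) simp
  finally show ?case using Suc by (simp add: mult.assoc)
qed simp

lemma F_shift_int:
  assumes "Re v \<le> 0"
  shows "F (v + turn k) = of_real (lam powi k) * F v"
proof (cases "k \<ge> 0")
  case True
  then show ?thesis using F_shift_nat[OF assms, of "nat k"] by (simp add: power_int_def)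
next
  case False
  let ?z = "v + turn k"
  have "F (?z + turn (int (nat (- k)))) = of_real (lam ^ nat (- k)) * F ?z"
    using assms by (intro F_shift_nat) simp
  also have "?z + turn (int (nat (- k))) = v" using False by (simp add: algebra_simps)
  finally show ?thesis using False lam by (simp add: power_int_def field_simps)
qed

text \<open>\<open>end_chart\<close> is injective on the unit disc, so the exponentials agree.
  Inside the image of \<open>F\<close>, points over the same point therefore differ by a power of
  the dilation.\<close>

lemma fibre:
  assumes "Re v \<le> 0" "Re v' \<le> 0" "p (F v) = p (F v')"
  obtains k :: int where "v' = v + turn k" "F v' = of_real (lam powi k) * F v"
proof -
  have "exp v' = exp v"
    using assms p_F by (intro end_chart_inj) (auto simp: norm_exp_eq_Re)
  then obtain k :: int where "v' = v + (of_int (2 * k) * of_real pi) * \<i>" by (auto simp: exp_eq)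
  then have "v' = v + turn k" by (simp add: mult_ac)
  with F_shift_int[OF assms(1)] that show thesis by blast
qed

lemma F_inj: "inj_on F {v. Re v \<le> 0}"
proof (rule inj_onI)
  fix v v' assume *: "v \<in> {v. Re v \<le> 0}" "v' \<in> {v. Re v \<le> 0}" "F v = F v'"
  then obtain k :: int where k: "v' = v + turn k" "F v' = of_real (lam powi k) * F v"
    using fibre[of v v'] by auto
  have "F v \<noteq> 0" using F_upper[of v] * by auto
  moreover have "(of_real (lam powi k) - of_real 1) * F v = 0"
    using *(3) k(2) by (simp only: left_diff_distrib of_real_1 mult_1_left) (metis diff_self)
  ultimately have "complex_of_real (lam powi k) = of_real 1" by (metis mult_eq_0_iff eq_iff_diff_eq_0)
  then have "lam powi k = lam powi 0" by (simp only: of_real_eq_iff power_int_0_right)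
  with lam have "k = 0" by (metis power_int_strict_increasing linorder_neqE less_irrefl)
  with k show "v = v'" by simp
qed

text \<open>The sine of the argument: invariant under dilation, 1 on the axis and small near the
  real line. It measures how far a point is from the axis.\<close>

definition height :: "complex \<Rightarrow> real" where "height z = Im z / cmod z"

lemma height_scale: "c > 0 \<Longrightarrow> height (of_real c * z) = height z"
  by (simp add: height_def norm_mult)

lemma height_shift: "Re v \<le> 0 \<Longrightarrow> height (F (v + turn k)) = height (F v)"
  unfolding F_shift_int by (rule height_scale) (use lam in simp)

text \<open>Modulo the dilation, the points of height at least \<open>\<delta>\<close> form a
  compact set \<open>K\<close> in the half plane. Its image under \<open>p\<close> is compact and
  misses \<open>(1, 1)\<close>, hence a neighbourhood of the puncture.\<close>

lemma height_small:
  assumes "\<delta> > 0"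
  obtains N where "N \<ge> 0" "\<And>v. Re v < - N \<Longrightarrow> height (F v) < \<delta>"
proof -
  define K where "K = {z. 1 \<le> cmod z} \<inter> cball 0 lam \<inter> {z. \<delta> * cmod z \<le> Im z}"
  have "compact K" unfolding K_def
    by (intro compact_Int_closed closed_Int_compact compact_cball closed_Collect_le continuous_intros)
  moreover have K: "K \<subseteq> upper_half"
  proof
    fix z assume z: "z \<in> K"
    then have "0 < \<delta> * cmod z" using assms by (auto simp: K_def intro!: mult_pos_pos)
    with z show "z \<in> upper_half" by (auto simp: K_def)
  qed
  ultimately have "compact (p ` K)"
    by (intro compact_continuous_image continuous_on_subset[OF continuous_p])
  then have "open (- p ` K)" by (auto intro: compact_imp_closed)
  moreover have "(1, 1) \<notin> p ` K" using p_range K by (auto simp: punctured_torus_def)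
  ultimately have "open (end_chart -` (- p ` K))" "0 \<in> end_chart -` (- p ` K)"
    using continuous_on_end_chart by (auto simp: end_chart_0 intro: open_vimage)
  then obtain e where e: "e > 0" "ball 0 e \<subseteq> end_chart -` (- p ` K)" by (meson open_contains_ball)
  show thesis
  proof (rule that[of "max 0 (- ln e)"])
    fix v assume v: "Re v < - max 0 (- ln e)"
    then have le: "Re v \<le> 0" "Re v < ln e" by (auto simp: max_def split: if_splits)
    then have "exp v \<in> ball 0 e" using e(1) by (simp add: norm_exp_eq_Re) (metis exp_less_mono exp_ln)
    then have "end_chart (exp v) \<notin> p ` K" using e(2) by blast
    then have notin: "p (F v) \<notin> p ` K" by (simp only: p_F[OF le(1)] not_False_eq_True)
    show "height (F v) < \<delta>"
    proof (rule ccontr)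
      assume h: "\<not> height (F v) < \<delta>"
      have F0: "cmod (F v) > 0" using F_upper[OF le(1)] by auto
      obtain k :: int where k: "1 \<le> lam powi k * cmod (F v)" "lam powi k * cmod (F v) \<le> lam"
        using powi_scale[OF lam F0] by blast
      \<comment> \<open>A whole number of turns brings \<open>F v\<close> into the annulus of
        \<open>K\<close> without changing its height or its image under \<open>p\<close>.\<close>
      let ?w = "v + turn k"
      have w: "Re ?w \<le> 0" using le by simp
      have cm: "cmod (F ?w) = lam powi k * cmod (F v)" using lam by (simp add: F_shift_int[OF le(1)] norm_mult norm_power_int del: of_real_mult)
      have "\<delta> \<le> height (F ?w)" using h by (simp only: height_shift[OF le(1)] not_less)
      moreover have "cmod (F ?w) > 0" using cm k by linarith
      ultimately have "\<delta> * cmod (F ?w) \<le> Im (F ?w)" by (simp add: height_def pos_le_divide_eq)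
      then have "F ?w \<in> K" using k cm by (auto simp: K_def)
      moreover have "exp ?w = exp v" unfolding exp_eq by (rule exI[of _ k]) simp
      then have "p (F ?w) = p (F v)" by (simp only: p_F[OF w] p_F[OF le(1)])
      ultimately show False using notin by (metis imageI)
    qed
  qed simp
qed

lemma reduce_Im:
  obtains k :: int and v' where "v = v' + turn k" "Re v' = Re v" "0 \<le> Im v'" "Im v' \<le> 2 * pi"
proof -
  define k where "k = \<lfloor>Im v / (2 * pi)\<rfloor>"
  have "of_int k \<le> Im v / (2 * pi)" "Im v / (2 * pi) \<le> of_int k + 1" unfolding k_def by linarith+
  then have "2 * pi * of_int k \<le> Im v" "Im v \<le> 2 * pi * of_int k + 2 * pi" 
    by (simp_all add: field_simps)
  then show thesis
    by (intro that[of "v - turn k" k]) auto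
qed

text \<open>By \<open>height_shift\<close> one period of \<open>Im v\<close> is enough, and on the
  compact rectangle that remains the height has a positive minimum.\<close>

lemma height_large:
  assumes "N \<ge> 0"
  obtains \<delta> where "\<delta> > 0" "\<And>v. - N \<le> Re v \<Longrightarrow> Re v \<le> 0 \<Longrightarrow> \<delta> \<le> height (F v)"
proof -
  let ?C = "cbox (Complex (- N) 0) (Complex 0 (2 * pi))"
  have C: "z \<in> ?C \<longleftrightarrow> - N \<le> Re z \<and> Re z \<le> 0 \<and> 0 \<le> Im z \<and> Im z \<le> 2 * pi" for z
    by (auto simp: in_cbox_complex_iff)
  have F0: "F z \<noteq> 0" if "z \<in> ?C" for z using F_upper[of z] that C by auto
  have "continuous_on ?C F" by (rule continuous_on_subset[OF F_cont]) (auto simp: C)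
  then have "continuous_on ?C (\<lambda>z. height (F z))" unfolding height_def
    using F0 by (intro continuous_intros) auto
  moreover have "0 \<in> ?C" using assms by (simp add: C)
  ultimately obtain z0 where z0: "z0 \<in> ?C" "\<And>z. z \<in> ?C \<Longrightarrow> height (F z0) \<le> height (F z)"
    using continuous_attains_inf[OF compact_cbox, of "Complex (- N) 0" "Complex 0 (2 * pi)" "\<lambda>z. height (F z)"] by blast
  show thesis
  proof (rule that[of "height (F z0)"])
    show "height (F z0) > 0" using F0[OF z0(1)] F_upper[of z0] z0(1) by (auto simp: height_def C)
    fix v assume v: "- N \<le> Re v" "Re v \<le> 0"
    obtain k :: int and v' where k: "v = v' + turn k" "Re v' = Re v" "0 \<le> Im v'" "Im v' \<le> 2 * pi"
      by (rule reduce_Im)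
    have re: "- N \<le> Re v'" "Re v' \<le> 0" using k(2) v by simp_all
    have "height (F v) = height (F v')" unfolding k(1) by (rule height_shift[OF re(2)])
    then show "height (F z0) \<le> height (F v)" using z0(2)[of v'] k(3,4) re by (simp add: C)
  qed
qed

text \<open>The image of the end is clopen in a sufficiently thin sector along one side of the axis.\<close>
lemma sector_in_image:
  obtains s \<kappa> :: real where "s = 1 \<or> s = -1" "\<kappa> > 0"
    "\<And>z. 0 < Im z \<Longrightarrow> Im z < \<kappa> * (s * Re z) \<Longrightarrow> z \<in> F ` {v. Re v \<le> 0}"
proof -
  \<comment> \<open>Points of the axis have height 1, so beyond \<open>N\<close> the image avoids
    the axis; by connectedness it stays on one side, recorded by the sign \<open>s\<close>.\<close>
  obtain N where N: "N \<ge> 0" "\<And>v. Re v < - N \<Longrightarrow> height (F v) < 1" using height_small[of 1] by auto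
  obtain \<delta>1 where \<delta>1: "\<delta>1 > 0" "\<And>v. - N \<le> Re v \<Longrightarrow> Re v \<le> 0 \<Longrightarrow> \<delta>1 \<le> height (F v)"
    using height_large[OF N(1)] by blast
  let ?P = "{v. Re v < - N}"
  have P: "convex ?P" "open ?P" by (simp_all add: convex_halfspace_Re_lt open_halfspace_Re_lt)
  have contP: "continuous_on ?P F" using N(1) by (intro continuous_on_subset[OF F_cont]) auto
  have ne: "Re (F v) \<noteq> 0" if "v \<in> ?P" for v
  proof
    assume "Re (F v) = 0"
    then have "cmod (F v) = \<bar>Im (F v)\<bar>" by (simp add: cmod_def)
    then show False using N(2)[of v] F_upper[of v] that N(1) by (auto simp: height_def)
  qed
  have conn: "connected ((\<lambda>v. Re (F v)) ` ?P)"
    by (intro connected_continuous_image continuous_intros contP convex_connected P)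
  obtain s :: real where s: "s = 1 \<or> s = -1" "\<And>v. v \<in> ?P \<Longrightarrow> s * Re (F v) > 0"
  proof (cases "\<exists>v\<in>?P. Re (F v) > 0")
    case True
    then obtain v where v: "v \<in> ?P" "Re (F v) > 0" by blast
    have "Re (F v') > 0" if "v' \<in> ?P" for v'
    proof (rule ccontr)
      assume "\<not> ?thesis"
      then have "0 \<in> (\<lambda>v. Re (F v)) ` ?P"
        using conn[unfolded connected_iff_interval] v that by (meson imageI less_imp_le not_less)
      then show False using ne by auto
    qed
    then show thesis using that[of 1] by simp
  next
    case False
    then have "Re (F v) < 0" if "v \<in> ?P" for v using ne[OF that] that by (meson linorder_neqE_linordered_idom)
    then show thesis using that[of "-1"] by simp
  qed
  \<comment> \<open>The bound by \<open>\<delta>1\<close> keeps the sector below all heights that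
    occur for \<open>- N \<le> Re v\<close>, so the image meets it only through \<open>?P\<close>.
    The bound by 1 serves the estimate showing that it does meet it.\<close>
  define \<kappa> where "\<kappa> = min \<delta>1 1"
  have \<kappa>: "\<kappa> > 0" "\<kappa> \<le> \<delta>1" "\<kappa> \<le> 1" using \<delta>1 by (auto simp: \<kappa>_def)
  define Q where "Q = {z. 0 < Im z \<and> Im z < \<kappa> * (s * Re z)}"
  have Q_height: "height z < \<delta>1" if "z \<in> Q" for z
  proof -
    have "s * Re z \<le> cmod z" using s(1) abs_Re_le_cmod[of z] by auto
    then have "\<kappa> * (s * Re z) \<le> \<delta>1 * cmod z" using \<kappa> \<delta>1(1)
      by (meson mult_left_mono mult_right_mono less_imp_le norm_ge_zero order_trans)
    moreover have "cmod z > 0" using that by (auto simp: Q_def)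
    ultimately show ?thesis using that by (simp add: Q_def height_def pos_divide_less_eq)
  qed
  have "Q = {z. Im z > 0} \<inter> {z. inner (Complex (- \<kappa> * s) 1) z < 0}"
    by (auto simp: Q_def inner_complex_def mult.assoc)
  then have "convex Q" 
    by (simp only: convex_Int convex_halfspace_Im_gt convex_halfspace_lt)
  then have connQ: "connected Q" by (rule convex_connected)
  let ?I = "F ` ?P"
  have openI: "open ?I"
    by (rule invariance_of_domain[OF contP P(2)]) (use F_inj N(1) in \<open>auto simp: inj_on_def\<close>)
  have ne_QI: "Q \<inter> ?I \<noteq> {}"
  proof -
    have "\<kappa> / 2 > 0" using \<kappa> by simp
    then obtain N1 where N1: "N1 \<ge> 0" "\<And>v. Re v < - N1 \<Longrightarrow> height (F v) < \<kappa> / 2" using height_small by metis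
    define v where "v = complex_of_real (- N - N1 - 1)"
    have v: "v \<in> ?P" "Re v < - N1" "Re v \<le> 0" using N N1(1) by (auto simp: v_def)
    let ?z = "F v"
    have Im: "Im ?z > 0" using F_upper v by simp
    have "Im ?z < \<kappa> / 2 * cmod ?z" using N1(2)[OF v(2)] Im 
      by (cases "?z = 0") (auto simp: height_def pos_divide_less_eq)
    also have "\<dots> \<le> \<kappa> / 2 * (\<bar>Re ?z\<bar> + \<bar>Im ?z\<bar>)" using \<kappa> cmod_le[of ?z] by (intro mult_left_mono) auto
    also have "\<bar>Re ?z\<bar> = s * Re ?z" using s(1) s(2)[OF v(1)] by auto
    also have "\<bar>Im ?z\<bar> = Im ?z" using Im by simp
    finally have "Im ?z < \<kappa> / 2 * (s * Re ?z) + \<kappa> / 2 * Im ?z" by (simp add: distrib_left)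
    moreover have "\<kappa> / 2 * Im ?z \<le> 1 / 2 * Im ?z" using \<kappa> Im by (intro mult_right_mono) auto
    ultimately have "Im ?z < \<kappa> * (s * Re ?z)" by simp
    with Im v show ?thesis by (auto simp: Q_def)
  qed
  \<comment> \<open>Near \<open>z\<close> the height is bounded below, which bounds
    \<open>Re v\<close> from below, and the modulus is bounded on both sides, which bounds the
    number of turns. So all nearby image points come from one compact rectangle, whose image is
    closed.\<close>
  have closed_QI: "z \<in> ?I" if z: "z \<in> Q" "z \<in> closure ?I" for z
  proof -
    have z0: "Im z > 0" "cmod z > 0" using z by (auto simp: Q_def)
    define \<delta> where "\<delta> = height z / 2"
    have \<delta>: "\<delta> > 0" using z0 by (simp add: \<delta>_def height_def)
    obtain N1 where N1: "N1 \<ge> 0" "\<And>v. Re v < - N1 \<Longrightarrow> height (F v) < \<delta>" using height_small[OF \<delta>] by blast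
    define W where "W = {w. \<delta> * cmod w < Im w} \<inter> {w. cmod z / 2 < cmod w} \<inter> {w. cmod w < 2 * cmod z}"
    have "open W" unfolding W_def by (intro open_Int open_Collect_less continuous_intros)
    have "\<delta> * cmod z < Im z" using z0 by (simp add: \<delta>_def height_def)
    then have "z \<in> W" using z0 by (auto simp: W_def)
    let ?C = "cbox (Complex (- N1) 0) (Complex 0 (2 * pi))"
    have C: "x \<in> ?C \<longleftrightarrow> - N1 \<le> Re x \<and> Re x \<le> 0 \<and> 0 \<le> Im x \<and> Im x \<le> 2 * pi" for x
      by (auto simp: in_cbox_complex_iff)
    have "continuous_on ?C (\<lambda>x. cmod (F x))"
      by (intro continuous_intros continuous_on_subset[OF F_cont]) (auto simp: C)
    then obtain x1 x2 where x: "x1 \<in> ?C" "x2 \<in> ?C" "\<And>x. x \<in> ?C \<Longrightarrow> cmod (F x1) \<le> cmod (F x)"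
        "\<And>x. x \<in> ?C \<Longrightarrow> cmod (F x) \<le> cmod (F x2)"
    proof -
      assume *: "continuous_on ?C (\<lambda>x. cmod (F x))"
      have ne: "?C \<noteq> {}" using N1(1) C[of 0] by auto
      show ?thesis 
        using continuous_attains_inf[OF compact_cbox ne *] continuous_attains_sup[OF compact_cbox ne *] that by blast
    qed
    define m M where "m = cmod (F x1)" and "M = cmod (F x2)"
    have m: "m > 0" "M > 0" using F_upper[of x1] F_upper[of x2] x(1,2) by (auto simp: m_def M_def C)
    \<comment> \<open>\<open>cmod (F v)\<close> is \<open>lam powi k\<close> times a value in
      \<open>[m, M]\<close>; comparison with \<open>cmod z / 2\<close> and \<open>2 * cmod z\<close>
      bounds the absolute value of \<open>k\<close> by \<open>B\<close>. The \<open>B + 1\<close> in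
      \<open>C'\<close> leaves room for the remainder of \<open>Im v\<close> within one
      period.\<close>
    define B where "B = (\<bar>ln (2 * cmod z / m)\<bar> + \<bar>ln (cmod z / (2 * M))\<bar>) / ln lam"
    have B0: "B \<ge> 0" using lam by (simp add: B_def)
    define C' where "C' = cbox (Complex (- N1) (- 2 * pi * B)) (Complex 0 (2 * pi * (B + 1)))"
    have C': "x \<in> C' \<longleftrightarrow> - N1 \<le> Re x \<and> Re x \<le> 0 \<and> - 2 * pi * B \<le> Im x \<and> Im x \<le> 2 * pi * (B + 1)" for x
      by (auto simp: C'_def in_cbox_complex_iff)
    have sub: "W \<inter> ?I \<subseteq> F ` C'"
    proof
      fix w assume "w \<in> W \<inter> ?I"
      then obtain v where w: "w = F v" "F v \<in> W" "Re v < - N" by auto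
      have re: "Re v \<le> 0" using w N by simp
      have wpos: "cmod w > 0" using F_upper[OF re] w by auto
      have "\<not> Re v < - N1"
        using N1(2)[of v] w wpos by (auto simp: W_def height_def field_simps)
      obtain k :: int and v' where k: "v = v' + turn k" "Re v' = Re v" "0 \<le> Im v'" "Im v' \<le> 2 * pi"
        by (rule reduce_Im)
      have re': "Re v' \<le> 0" "- N1 \<le> Re v'" using k(2) re \<open>\<not> Re v < - N1\<close> by simp_all
      then have "v' \<in> ?C" using k(3,4) by (simp add: C)
      then have mM: "m \<le> cmod (F v')" "cmod (F v') \<le> M" using x by (auto simp: m_def M_def)
      have "F v = of_real (lam powi k) * F v'" unfolding k(1) by (rule F_shift_int[OF re'(1)])
      then have cw: "cmod (F v) = lam powi k * cmod (F v')" using lam by (simp add: norm_mult norm_power_int)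
      have wz: "cmod z / 2 < cmod (F v)" "cmod (F v) < 2 * cmod z" using w(2) by (auto simp: W_def)
      have lk: "lam powi k > 0" using lam by simp
      have "lam powi k * m \<le> 2 * cmod z" using cw wz mM lk
        by (smt (verit) mult_left_mono)
      then have up: "lam powi k \<le> 2 * cmod z / m" using m by (simp add: field_simps)
      have "cmod z / 2 \<le> lam powi k * M" using cw wz mM lk by (smt (verit) mult_left_mono)
      then have low: "cmod z / (2 * M) \<le> lam powi k" using m by (simp add: field_simps)
      have lnk: "ln (lam powi k) = of_int k * ln lam" using lam by (simp add: ln_powr flip: powr_real_of_int')
      have "of_int k * ln lam \<le> ln (2 * cmod z / m)" "ln (cmod z / (2 * M)) \<le> of_int k * ln lam"
        unfolding lnk[symmetric] using up low lk m z0 by (auto intro!: ln_mono divide_pos_pos)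
      then have "\<bar>of_int k * ln lam\<bar> \<le> \<bar>ln (2 * cmod z / m)\<bar> + \<bar>ln (cmod z / (2 * M))\<bar>" by linarith
      then have "\<bar>of_int k\<bar> \<le> B" using lam by (simp add: B_def abs_mult pos_le_divide_eq)
      then have "- B \<le> of_int k" "of_int k \<le> B" by linarith+
      then have "2 * pi * (- B) \<le> 2 * pi * of_int k" "2 * pi * of_int k \<le> 2 * pi * B" 
        by (intro mult_left_mono; simp)+
      moreover have "Im v = Im v' + 2 * pi * of_int k" unfolding k(1) by simp
      moreover have "2 * pi * (B + 1) = 2 * pi * B + 2 * pi" by (simp add: distrib_left)
      ultimately have "v \<in> C'" using k(3,4) re \<open>\<not> Re v < - N1\<close> unfolding C'
        by (intro conjI; linarith)
      then show "w \<in> F ` C'" using w by auto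
    qed
    have "compact (F ` C')"
      by (intro compact_continuous_image continuous_on_subset[OF F_cont]) (auto simp: C'_def in_cbox_complex_iff)
    then have "closed (F ` C')" by (rule compact_imp_closed)
    have "z \<in> closure (W \<inter> ?I)"
      using z(2) \<open>z \<in> W\<close> \<open>open W\<close> by (meson IntI open_Int_closure_subset subset_iff)
    then have "z \<in> F ` C'" using sub \<open>closed (F ` C')\<close> by (meson closure_minimal subset_iff)
    then obtain v where v: "z = F v" "Re v \<le> 0" by (auto simp: C')
    have "Re v < - N"
    proof (rule ccontr)
      assume "\<not> ?thesis"
      then have "\<delta>1 \<le> height z" using \<delta>1(2) v by simp
      with Q_height[OF z(1)] show False by simp
    qed
    with v show ?thesis by auto
  qed
  have "Q \<subseteq> ?I"
  proof (rule ccontr)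
    assume "\<not> Q \<subseteq> ?I"
    then obtain z where "z \<in> Q" "z \<notin> ?I" by blast
    then have "- closure ?I \<inter> Q \<noteq> {}" using closed_QI by blast
    moreover have "Q \<subseteq> ?I \<union> - closure ?I" using closed_QI by blast
    moreover have "?I \<inter> - closure ?I \<inter> Q = {}" using closure_subset[of ?I] by blast
    ultimately have "?I \<inter> Q = {} \<or> - closure ?I \<inter> Q = {}"
      by (intro connectedD[OF connQ openI]) auto
    with \<open>- closure ?I \<inter> Q \<noteq> {}\<close> ne_QI show False by blast
  qed
  then show thesis
    using s(1) \<kappa>(1) N(1) by (intro that[of s \<kappa>]) (force simp: Q_def)+
qed

text \<open>Two points of the sector whose real parts have absolute values in
  \<open>[1, x2]\<close>, with \<open>x2 < lam\<close>, are related by no nontrivial power of the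
  dilation. So \<open>p\<close> is injective on boxes of this width, and their area is unbounded as
  they approach the real line.\<close>

lemma surface_area_infinite:
  assumes iso: "\<And>z. Im z > 0 \<Longrightarrow> \<exists>r>0. isometric_embedding (hball z r) d p"
  shows "surface_area punctured_torus d = \<infinity>"
proof -
  obtain s \<kappa> :: real where s: "s = 1 \<or> s = -1" and \<kappa>: "\<kappa> > 0"
    and sector: "\<And>z. 0 < Im z \<Longrightarrow> Im z < \<kappa> * (s * Re z) \<Longrightarrow> z \<in> F ` {v. Re v \<le> 0}"
    by (rule sector_in_image) (rule that)
  define x2 where "x2 = (1 + lam) / 2"
  have x2: "1 < x2" "x2 < lam" using lam by (auto simp: x2_def)
  have ge: "ennreal ((x2 - 1) / (4 * e)) \<le> surface_area punctured_torus d" if e: "e > 0" "2 * e < \<kappa>" for e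
  proof -
    \<comment> \<open>For \<open>s = -1\<close> the box is mirrored in the axis.\<close>
    define a b where "a = (if s = 1 then 1 else - x2)" and "b = (if s = 1 then x2 else -1)"
    have ab: "a \<le> b" "b - a = x2 - 1" using x2 s by (auto simp: a_def b_def)
    let ?K = "cbox (Complex a e) (Complex b (2 * e))"
    have K: "1 \<le> s * Re z \<and> s * Re z \<le> x2 \<and> e \<le> Im z \<and> Im z \<le> 2 * e" if "z \<in> ?K" for z
      using that s by (auto simp: in_cbox_complex_iff a_def b_def split: if_splits)
    have KF: "z \<in> F ` {v. Re v \<le> 0}" if "z \<in> ?K" for z
    proof (rule sector)
      show "0 < Im z" using K[OF that] e by simp
      have "Im z < \<kappa> * 1" using K[OF that] e by simp
      also have "\<dots> \<le> \<kappa> * (s * Re z)" using K[OF that] \<kappa> by (intro mult_left_mono) auto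
      finally show "Im z < \<kappa> * (s * Re z)" .
    qed
    have "inj_on p ?K"
    proof (rule inj_onI)
      fix z w assume zw: "z \<in> ?K" "w \<in> ?K" "p z = p w"
      obtain v v' where v: "z = F v" "Re v \<le> 0" "w = F v'" "Re v' \<le> 0" using KF[OF zw(1)] KF[OF zw(2)] by auto
      obtain k :: int where k: "w = of_real (lam powi k) * z"
        using fibre[of v v'] zw(3) v by metis
      have "Re w = lam powi k * Re z"
        unfolding k by (simp only: times_complex.sel Re_complex_of_real Im_complex_of_real mult_zero_left diff_zero)
      then have eq: "s * Re w = lam powi k * (s * Re z)" by simp
      have "lam powi k * 1 \<le> lam powi k * (s * Re z)" using K[OF zw(1)] lam by (intro mult_left_mono) auto
      then have "lam powi k < lam" using eq K[OF zw(2)] x2 by linarith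
      then have up: "lam powi k < lam powi 1" by simp
      have "lam powi k * (s * Re z) \<le> lam powi k * x2" using K[OF zw(1)] lam by (intro mult_left_mono) auto
      then have "1 \<le> lam powi k * x2" using eq K[OF zw(2)] by linarith
      also have "\<dots> < lam powi k * lam" using x2 lam by simp
      finally have low: "lam powi 0 < lam powi (k + 1)" using lam by (simp add: power_int_add)
      have "k < 1" "0 < k + 1" using up low lam by (meson power_int_increasing not_less less_imp_le)+
      then have "k = 0" by simp
      with k show "z = w" by simp
    qed
    moreover have "?K \<subseteq> upper_half"
    proof
      fix z assume "z \<in> ?K"
      with K[of z] e show "z \<in> upper_half" by auto
    qed
    ultimately have "emeasure harea ?K \<le> surface_area punctured_torus d"
      using p_range by (intro surface_area_ge[OF iso compact_cbox]) auto
    with harea_box_ge[OF ab(1) e(1)] ab(2) show ?thesis by simp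
  qed
  have "of_nat n \<le> surface_area punctured_torus d" for n
  proof -
    define e where "e = min (\<kappa> / 4) ((x2 - 1) / (4 * (real n + 1)))"
    have e: "e > 0" "2 * e < \<kappa>" "e \<le> (x2 - 1) / (4 * (real n + 1))" using \<kappa> x2 by (auto simp: e_def)
    then have "real n \<le> (x2 - 1) / (4 * e)" using x2 by (simp add: field_simps) 
    then have "of_nat n \<le> ennreal ((x2 - 1) / (4 * e))" by (simp add: ennreal_of_nat_eq_real_of_nat ennreal_leI)
    with ge[OF e(1,2)] show ?thesis using order_trans by blast
  qed
  then show ?thesis by (metis ennreal_Ex_less_of_nat infinity_ennreal_def not_less top.not_eq_extremum)
qed

end

section \<open>The commutator of standard generators\<close>

lemma hyperbolic_diagonal:
  fixes M :: "real^2^2"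
  assumes "det M = 1" "trace M > 2"
  obtains P t where "det P = 1" "t > 0" "M = P ** hshift t ** adj2 P"
proof -
  define a b c d where "a = M$1$1" and "b = M$1$2" and "c = M$2$1" and "d = M$2$2"
  have det: "a * d - b * c = 1" using assms(1) by (simp add: det_2 a_def b_def c_def d_def)
  have tr: "a + d > 2" using assms(2) by (simp add: trace_2 a_def d_def)
  have M: "M = mk2 a b c d" by (simp add: mat2_eq_iff a_def b_def c_def d_def)
  have "\<exists>P t. det P = 1 \<and> t \<noteq> 0 \<and> M ** P = P ** hshift t"
  proof (cases "c = 0")
    case True
    have "a * d = 1" using det True by simp
    then have "a * d > 0" by simp
    then have "a > 0" using tr by (auto simp: zero_less_mult_iff)
    then have ad: "a > 0" "d = 1 / a" using \<open>a * d = 1\<close> by (auto simp: field_simps)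
    have "a \<noteq> 1" using ad tr by auto
    have "a - d \<noteq> 0"
    proof
      assume "a - d = 0"
      then have "a * a = 1" using \<open>a * d = 1\<close> by simp
      then have "a = 1" using \<open>a > 0\<close> by (simp add: square_eq_1_iff)
      with \<open>a \<noteq> 1\<close> show False ..
    qed
    \<comment> \<open>In the triangular case the columns are eigenvectors for \<open>a\<close> and
      \<open>d\<close>.\<close>
    define P where "P = mk2 1 (b / (d - a)) 0 1"
    have "exp (2 * ln a / 2) = a" "exp (- (2 * ln a) / 2) = d" using ad by (simp_all add: exp_minus field_simps)
    then have sh: "hshift (2 * ln a) = mk2 a 0 0 d" by (simp add: hshift_def)
    have "b / (d - a) * a + b = b / (d - a) * d" using \<open>a - d \<noteq> 0\<close> by (simp add: field_simps)
    then have "M ** P = P ** hshift (2 * ln a)"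
      unfolding M sh P_def True by (simp add: mat2_eq_iff mult.commute)
    moreover have "det P = 1" by (simp add: P_def det_2)
    moreover have "2 * ln a \<noteq> 0" using ad \<open>a \<noteq> 1\<close> by simp
    ultimately show ?thesis by blast
  next
    case False
    have pos: "(a + d)\<^sup>2 - 4 > 0" using tr power_strict_mono[of 2 "a + d" 2] by simp
    define s where "s = sqrt ((a + d)\<^sup>2 - 4)"
    have s: "s > 0" "s\<^sup>2 = (a + d)\<^sup>2 - 4" using pos by (simp_all add: s_def)
    define m n where "m = (a + d + s) / 2" and "n = (a + d - s) / 2"
    have mn: "m * n = 1" "m + n = a + d" "m - n = s" 
      using s(2) by (simp_all add: m_def n_def power2_eq_square field_simps)
    have "m > 1" using s tr by (simp add: m_def)
    \<comment> \<open>The columns are multiples of the eigenvectors \<open>(m - d, c)\<close> and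
      \<open>(n - d, c)\<close>; the factor \<open>1 / (c * s)\<close> makes the determinant 1,
      since \<open>m - n = s\<close>.\<close>
    define P where "P = mk2 ((m - d) / (c * s)) (n - d) (1 / s) c"
    have detP: "det P = 1"
      unfolding P_def det_2 mk2_nth using False s mn(3) by (simp add: field_simps)
    have "exp (2 * ln m / 2) = m" "exp (- (2 * ln m) / 2) = n" using \<open>m > 1\<close> mn(1) by (simp_all add: exp_minus field_simps)
    then have sh: "hshift (2 * ln m) = mk2 m 0 0 n" by (simp add: hshift_def)
    have root: "a * (m - d) + b * c = m * (m - d)" "a * (n - d) + b * c = n * (n - d)"
      using mn(1,2) det by algebra+
    have "M ** P = P ** hshift (2 * ln m)"
    proof -
      have "a * ((m - d) / (c * s)) + b * (1 / s) = ((m - d) / (c * s)) * m"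
        using root(1) False s by (simp add: field_simps)
      moreover have "c * ((m - d) / (c * s)) + d * (1 / s) = 1 / s * m"
        using False s by (simp add: field_simps)
      moreover have "a * (n - d) + b * c = (n - d) * n" using root(2) by (simp add: mult.commute)
      moreover have "c * (n - d) + d * c = c * n" by (simp add: algebra_simps)
      ultimately show ?thesis unfolding M sh P_def by (simp add: mat2_eq_iff)
    qed
    moreover have "2 * ln m \<noteq> 0" using \<open>m > 1\<close> by simp
    ultimately show ?thesis using detP by blast
  qed
  then obtain P t where P: "det P = 1" "t \<noteq> 0" "M ** P = P ** hshift t" by blast
  have "M = M ** P ** adj2 P" using P(1) by (simp add: adj2_inverse flip: matrix_mul_assoc)
  then have MP: "M = P ** hshift t ** adj2 P" unfolding P(3) .
  show thesis
  proof (cases "t > 0")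
    case True
    with P MP that show thesis by blast
  next
    case False
    \<comment> \<open>The half turn reverses the axis and so makes the translation positive, that
      is, the dilation factor greater than 1.\<close>
    define J where "J = mk2 0 (-1) 1 0"
    have J: "det J = 1" by (simp add: J_def det_2)
    have "hshift t = J ** hshift (- t) ** adj2 J" by (simp add: J_def hshift_def mat2_eq_iff)
    then have "M = (P ** J) ** hshift (- t) ** adj2 (P ** J)"
      unfolding MP adj2_mult by (simp add: matrix_mul_assoc)
    then show thesis using False P J by (intro that[of "P ** J" "- t"]) (auto simp: det_mul)
  qed
qed

context uniformization begin

lemma free_holonomy_reversepath:
  assumes "free_holonomy f M"
  shows "free_holonomy (reversepath f) (adj2 M)"
proof -
  obtain g where g: "is_lift f g" "pathfinish g = moebius M (pathstart g)" and M: "M \<in> G"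
    using assms by (auto simp: free_holonomy_def)
  have "pathstart g \<in> upper_half" using g(1) pathstart_in_path_image[of g] unfolding is_lift_def by blast
  then have "moebius (adj2 M) (pathfinish g) = pathstart g"
    using g(2) G_closed(1)[OF M] by (simp add: adj2_inverse flip: moebius_mult)
  moreover have "is_lift (reversepath f) (reversepath g)"
    using g(1) unfolding is_lift_def by simp (simp add: reversepath_def)
  ultimately show ?thesis using M unfolding free_holonomy_def
    by (intro conjI exI[of _ "reversepath g"]) (auto intro: G_closed)
qed

end

text \<open>The left half plane is simply connected, so the neighbourhood lifts along
  \<open>exp\<close>, and the effect \<open>N\<close> of one turn is the holonomy of the loop.
  Conjugating it to a dilation produces a \<open>hyperbolic_end\<close>.\<close>

lemma puncture_holonomy_not_hyperbolic:
  assumes "uniformizes punctured_torus d p \<Gamma>" "surface_area punctured_torus d < \<infinity>"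
    and "uniformization.free_holonomy p \<Gamma> puncture_loop M"
  shows "\<bar>trace M\<bar> \<le> 2"
proof (rule ccontr)
  interpret uniformization punctured_torus d p \<Gamma> by unfold_locales (rule assms(1))
  assume M: "\<not> ?thesis"
  let ?P = "{v::complex. Re v \<le> 0}"
  have P: "convex ?P" by (simp add: convex_halfspace_Re_le)
  have E: "end_chart (exp v) \<in> punctured_torus" if "Re v \<le> 0" for v
    using that by (intro end_chart_in_punctured_torus) (auto simp: norm_exp_eq_Re)
  obtain F0 where F0: "continuous_on ?P F0" "F0 \<in> ?P \<rightarrow> upper_half" "\<And>v. v \<in> ?P \<Longrightarrow> p (F0 v) = end_chart (exp v)"
  proof (rule covering_space_lift[OF covering, of ?P "\<lambda>v. end_chart (exp v)"])
    show "continuous_on ?P (\<lambda>v. end_chart (exp v))"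
      by (intro continuous_on_compose2[OF continuous_on_end_chart[of UNIV]] continuous_intros) auto
  qed (use P E in \<open>auto simp: convex_imp_simply_connected convex_imp_locally_path_connected\<close>)
  have ImF0: "Im (F0 v) > 0" if "Re v \<le> 0" for v using F0(2) that by auto
  let ?u = "of_real (2 * pi) * \<i> :: complex"
  have exp_u: "exp (v + ?u) = exp v" for v unfolding exp_eq by (rule exI[of _ 1]) simp
  obtain N where N: "N \<in> G" "\<And>v. v \<in> ?P \<Longrightarrow> F0 (v + ?u) = moebius N (F0 v)"
  proof (rule lifts_differ_by_deck[of ?P F0 "\<lambda>v. F0 (v + ?u)"])
    show "connected ?P" using P by (rule convex_connected)
    show "continuous_on ?P (\<lambda>v. F0 (v + ?u))"
      by (intro continuous_on_compose2[OF F0(1)] continuous_intros) auto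
    show "F0 ` ?P \<subseteq> upper_half" "(\<lambda>v. F0 (v + ?u)) ` ?P \<subseteq> upper_half" using ImF0 by auto
    show "p (F0 v) = p (F0 (v + ?u))" if "v \<in> ?P" for v
      using F0(3)[OF that] F0(3)[of "v + ?u"] that exp_u[of v] by simp
    show "?P \<noteq> {}" by (auto intro: exI[of _ 0])
    show "continuous_on ?P F0" by (rule F0(1))
  qed (rule that)
  have "free_holonomy puncture_loop N"
    unfolding free_holonomy_def is_lift_def path_def path_image_def
  proof (intro conjI exI)
    let ?g = "\<lambda>t. F0 (of_real (2 * pi * t) * \<i>)"
    show "continuous_on {0..1} ?g"
      by (intro continuous_on_compose2[OF F0(1)] continuous_intros) auto
    show "?g ` {0..1} \<subseteq> upper_half" using ImF0 by auto
    show "\<forall>t\<in>{0..1}. p (?g t) = puncture_loop t" using F0(3) by (simp add: puncture_loop_eq)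
    show "pathfinish ?g = moebius N (pathstart ?g)" using N(2)[of 0] by (simp add: pathstart_def pathfinish_def)
  qed (rule N(1))
  then have "\<bar>trace N\<bar> > 2" using free_holonomy_unique[OF assms(3)] M by simp
  \<comment> \<open>A change of sign leaves the Moebius map alone and makes the trace exceed
    2.\<close>
  obtain N' where N': "det N' = 1" "trace N' > 2" "N' = N \<or> N' = - N"
    using that[of N] that[of "- N"] \<open>\<bar>trace N\<bar> > 2\<close> G_closed(1)[OF N(1)] by (auto simp: abs_if split: if_splits)
  obtain Q t where Q: "det Q = 1" "t > 0" "N' = Q ** hshift t ** adj2 Q"
    using hyperbolic_diagonal[OF N'(1,2)] by blast
  have detQ: "det (adj2 Q) = 1" using Q by simp
  have NF: "moebius N z = moebius N' z" for z using N'(3) by auto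
  interpret hyperbolic_end "p \<circ> moebius Q" "exp t" "\<lambda>v. moebius (adj2 Q) (F0 v)"
  proof
    show "continuous_on upper_half (p \<circ> moebius Q)"
      using Q by (intro continuous_on_compose continuous_on_moebius continuous_on_subset[OF continuous_on_p])
        (auto simp: moebius_upper_half)
    show "(p \<circ> moebius Q) ` upper_half \<subseteq> punctured_torus"
      using Q by (auto simp: moebius_upper_half intro!: p_in_S simp del: surj_pair)
    show "exp t > 1" using Q by simp
    show "continuous_on ?P (\<lambda>v. moebius (adj2 Q) (F0 v))"
      using ImF0 by (intro continuous_on_compose2[OF continuous_on_moebius[OF detQ] F0(1)]) auto
    fix v :: complex assume v: "Re v \<le> 0"
    show "Im (moebius (adj2 Q) (F0 v)) > 0" using ImF0[OF v] detQ by (simp add: moebius_upper_half)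
    show "(p \<circ> moebius Q) (moebius (adj2 Q) (F0 v)) = end_chart (exp v)"
      using F0(3)[of v] v ImF0[OF v] Q detQ by (simp add: adj2_inverse flip: moebius_mult)
    have "moebius (adj2 Q) (F0 (v + ?u)) = moebius (adj2 Q) (moebius N' (F0 v))"
      using N(2)[of v] v by (simp add: NF)
    also have "\<dots> = moebius (adj2 Q ** N') (F0 v)" using N' ImF0[OF v] by (simp add: moebius_mult)
    also have "adj2 Q ** N' = hshift t ** adj2 Q"
      unfolding Q(3) using Q(1) by (simp add: adj2_cancel flip: matrix_mul_assoc)
    also have "moebius (hshift t ** adj2 Q) (F0 v) = of_real (exp t) * moebius (adj2 Q) (F0 v)"
      using detQ ImF0[OF v] by (simp add: moebius_mult moebius_hshift)
    finally show "moebius (adj2 Q) (F0 (v + ?u)) = of_real (exp t) * moebius (adj2 Q) (F0 v)" .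
  qed
  have "surface_area punctured_torus d = \<infinity>"
  proof (rule surface_area_infinite)
    fix z assume z: "Im z > 0"
    then have Qz: "Im (moebius Q z) > 0" using Q by (simp add: moebius_upper_half)
    obtain r where r: "r > 0" "isometric_embedding (hball (moebius Q z) r) d p"
      using local_isometry[OF Qz] by blast
    have "isometric_embedding (hball z r) d (p \<circ> moebius Q)"
      unfolding isometric_embedding_def
    proof (intro ballI)
      fix u v assume uv: "u \<in> hball z r" "v \<in> hball z r"
      then have "moebius Q u \<in> hball (moebius Q z) r"
        "moebius Q v \<in> hball (moebius Q z) r"
        using Q z by (auto simp: moebius_upper_half hdist_moebius)
      then have "d (p (moebius Q u)) (p (moebius Q v)) = hdist (moebius Q u) (moebius Q v)"
        using r(2) unfolding isometric_embedding_def by blast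
      then show "d ((p \<circ> moebius Q) u) ((p \<circ> moebius Q) v) = hdist u v"
        using uv Q by (simp add: hdist_moebius)
    qed
    with r show "\<exists>r>0. isometric_embedding (hball z r) d (p \<circ> moebius Q)" by blast
  qed
  with assms(2) show False by simp
qed

text \<open>Trace 2 characterizes pairs with a common complex eigenvector; in triangular form all
  commutators are unipotent and commute. The computation stays with real matrices: with
  \<open>N = A ** B - B ** A\<close> and \<open>X\<close> the inverse of \<open>B ** A\<close> one
  has \<open>C = 1 + N X\<close> and \<open>D = 1 + X N\<close>.\<close>

lemma commute_if_trace_commutator_eq_2:
  fixes A B :: "real^2^2"
  defines "C \<equiv> A ** B ** adj2 A ** adj2 B" and "D \<equiv> adj2 A ** adj2 B ** A ** B"
  assumes det: "det A = 1" "det B = 1" and tr: "trace C = 2"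
  shows "C ** D = D ** C"
proof -
  define N where "N = A ** B - B ** A"
  define X where "X = adj2 A ** adj2 B"
  have adjBA: "adj2 (B ** A) = X" by (simp add: adj2_mult X_def)
  have detBA: "det (B ** A) = 1" using det by (simp add: det_mul)
  have detX: "det X = 1" using det by (simp add: det_mul X_def)
  have XBA: "X ** (B ** A) = mat 1" "(B ** A) ** X = mat 1"
    using adj2_inverse[OF detBA] by (simp_all add: adjBA)
  have sub: "(U - V) ** W = U ** W - V ** W" "W ** (U - V) = W ** U - W ** V"
      "(U + V) ** W = U ** W + V ** W" "W ** (U + V) = W ** U + W ** V" for U V W :: "real^2^2"
    by (simp_all add: mat2_eq_iff algebra_simps)
  have C: "C = mat 1 + N ** X"
    unfolding N_def sub XBA by (simp add: C_def X_def matrix_mul_assoc)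
  have D: "D = mat 1 + X ** N"
    unfolding N_def sub XBA by (simp add: D_def X_def matrix_mul_assoc)
  have trN: "trace N = 0" by (simp add: N_def trace_2)
  have trD: "trace D = 2"
  proof -
    have "trace D = (trace A)\<^sup>2 + (trace B)\<^sup>2 + (trace (adj2 A ** adj2 B))\<^sup>2
        - trace A * trace B * trace (adj2 A ** adj2 B) - 2"
      using trace_commutator[of "adj2 A" "adj2 B"] det by (simp add: D_def)
    moreover have "trace (adj2 A ** adj2 B) = trace (A ** B)" by (simp add: trace_2)
    ultimately show ?thesis using trace_commutator[OF det] tr by (simp add: C_def)
  qed
  have trNX: "trace (N ** X) = 0" using tr by (simp add: C trace_2)
  have trXN: "trace (X ** N) = 0" using trD by (simp add: D trace_2)
  have detN: "det N = 0"
  proof -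
    have "det C = 1 + trace (N ** X) + det (N ** X)" by (simp add: C det_2 trace_2 algebra_simps)
    moreover have "det C = 1" using det by (simp add: C_def det_mul)
    ultimately have "det (N ** X) = 0" using trNX by simp
    then show ?thesis using detX by (simp add: det_mul)
  qed
  \<comment> \<open>A Cayley-Hamilton identity with a parameter. As \<open>det N\<close> and the
    traces of \<open>N\<close> and \<open>N X\<close> vanish, it gives \<open>N X N = 0\<close> and
    \<open>N N = 0\<close>, which kills both products of \<open>N X\<close> and
    \<open>X N\<close>.\<close>
  have NYN: "N ** Y ** N = trace (N ** Y) *\<^sub>R N - det N *\<^sub>R adj2 Y" for Y
    by (simp add: mat2_eq_iff trace_2 det_2 algebra_simps)
  have NXN: "N ** X ** N = 0" using NYN[of X] trNX detN by simp
  have NN: "N ** N = 0" using NYN[of "mat 1"] trN detN by (simp add: trace_2)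
  have XX: "X ** X = trace X *\<^sub>R X - mat 1"
  proof -
    have "X ** X = trace X *\<^sub>R X - det X *\<^sub>R mat 1" by (simp add: mat2_eq_iff trace_2 det_2 algebra_simps)
    then show ?thesis using detX by simp
  qed
  have "(N ** X) ** (X ** N) = N ** (X ** X) ** N" by (simp add: matrix_mul_assoc)
  also have "\<dots> = trace X *\<^sub>R (N ** X ** N) - N ** N"
    unfolding XX by (simp add: mat2_eq_iff algebra_simps)
  finally have 1: "(N ** X) ** (X ** N) = 0" by (simp add: NXN NN)
  have "(X ** N) ** (N ** X) = X ** (N ** N) ** X" by (simp add: matrix_mul_assoc)
  also have "\<dots> = 0" unfolding NN by (simp add: mat2_eq_iff)
  finally have 2: "(X ** N) ** (N ** X) = 0" .
  show ?thesis unfolding C D sub 1 2 by (simp add: add.commute add.left_commute)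
qed

lemma trace_commutator_punctured_torus:
  assumes unif: "uniformizes punctured_torus d p \<Gamma>" and area: "surface_area punctured_torus d < \<infinity>"
    and gens: "standard_generators (p z0) a b" and z0: "Im z0 > 0"
    and a: "uniformization.holonomy punctured_torus p \<Gamma> z0 a A"
    and b: "uniformization.holonomy punctured_torus p \<Gamma> z0 b B"
  shows "trace (A ** B ** adj2 A ** adj2 B) = -2"
proof -
  interpret uniformization punctured_torus d p \<Gamma> by unfold_locales (rule unif)
  let ?C = "A ** B ** adj2 A ** adj2 B"
  note [intro] = holonomy_mult[OF _ _ z0] holonomy_inv[OF _ z0]
  have det: "det A = 1" "det B = 1" using holonomy_G[OF a] holonomy_G[OF b] G_closed(1) by auto
  have c: "holonomy z0 (commutator (pi1 z0) a b) ?C"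
    unfolding commutator_def using a b by auto
  have "\<exists>M. free_holonomy puncture_loop M \<and> \<bar>trace M\<bar> = \<bar>trace ?C\<bar>"
  proof -
    obtain f where f: "f \<in> commutator (pi1 z0) a b" "homotopic_loops punctured_torus f puncture_loop \<or>
            homotopic_loops punctured_torus f (reversepath puncture_loop)"
      using gens unfolding standard_generators_def around_puncture_def by blast
    have "free_holonomy f ?C" by (rule path_imp_free_holonomy[OF holonomy_imp_path_holonomy[OF c f(1)]])
    then have "free_holonomy puncture_loop ?C \<or> free_holonomy (reversepath puncture_loop) ?C"
      using f(2) free_holonomy_homotopic by blast
    then show ?thesis
      using free_holonomy_reversepath[of "reversepath puncture_loop" ?C] by (metis reversepath_reversepath trace_adj2)
  qed
  then have le: "\<bar>trace ?C\<bar> \<le> 2" using puncture_holonomy_not_hyperbolic[OF unif area] by metis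
  have "\<not> \<bar>trace ?C\<bar> < 2"
  proof
    assume lt: "\<bar>trace ?C\<bar> < 2"
    obtain z where "Im z > 0" "moebius ?C z = z"
      by (rule elliptic_fixed_point[OF _ lt]) (simp add: det_mul det)
    then have "?C = mat 1 \<or> ?C = - mat 1" using free_action[OF holonomy_G[OF c]] by blast
    then have "\<bar>trace ?C\<bar> = 2" by (auto simp only: trace_neg2) (simp_all add: trace_2)
    with lt show False by simp
  qed
  moreover have "trace ?C \<noteq> 2"
  proof
    assume "trace ?C = 2"
    then have comm: "?C ** (adj2 A ** adj2 B ** A ** B) = (adj2 A ** adj2 B ** A ** B) ** ?C"
      by (rule commute_if_trace_commutator_eq_2[OF det])
    \<comment> \<open>The commutator of \<open>[a, b]\<close> and \<open>[a^-1, b^-1]\<close>,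
      multiplied out. The inverse letters in the second entry prevent cancellation, so the word is
      reduced.\<close>
    define w where "w = [(a,True),(b,True),(a,False),(b,False),(a,False),(b,False),(a,True),(b,True),
       (b,True),(a,True),(b,False),(a,False),(b,False),(a,False),(b,True),(a,True)]"
    have ab: "a \<noteq> b" and free: "free_basis (pi1 z0) {a, b}" using gens by (auto simp: standard_generators_def)
    have "reduced_word w" using ab by (simp add: w_def reduced_word_def)
    moreover have "w \<noteq> []" "set w \<subseteq> {a, b} \<times> UNIV" by (auto simp: w_def)
    ultimately have ne: "word_eval (pi1 z0) w \<noteq> \<one>\<^bsub>pi1 z0\<^esub>" using free unfolding free_basis_def by blast
    have one: "holonomy z0 \<one>\<^bsub>pi1 z0\<^esub> (mat 1)"
    proof -
      obtain \<gamma> where \<gamma>: "holonomy z0 \<gamma> (mat 1)" using holonomy_surj[OF G_closed(2) z0] by blast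
      with holonomy_trivial[OF \<gamma> z0] show ?thesis by simp
    qed
    let ?D = "adj2 A ** adj2 B ** A ** B"
    have "holonomy z0 (word_eval (pi1 z0) w) (A ** (B ** (adj2 A ** (adj2 B ** (adj2 A ** (adj2 B ** (A ** (B **
       (B ** (A ** (adj2 B ** (adj2 A ** (adj2 B ** (adj2 A ** (B ** (A ** mat 1))))))))))))))))"
      unfolding w_def word_eval_def foldr.simps o_apply id_apply split_conv if_True if_False
      by (intro holonomy_mult[OF _ _ z0] holonomy_inv[OF _ z0] a b one)
    also have "(A ** (B ** (adj2 A ** (adj2 B ** (adj2 A ** (adj2 B ** (A ** (B **
       (B ** (A ** (adj2 B ** (adj2 A ** (adj2 B ** (adj2 A ** (B ** (A ** mat 1)))))))))))))))) = (?C ** ?D) ** adj2 (?D ** ?C)"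
      by (simp add: adj2_mult flip: matrix_mul_assoc)
    also have "\<dots> = mat 1" unfolding comm by (rule adj2_inverse) (simp add: det_mul det)
    finally have "word_eval (pi1 z0) w = \<one>\<^bsub>pi1 z0\<^esub>" using z0 by (rule holonomy_trivial) simp
    with ne show False ..
  qed
  ultimately show ?thesis using le by linarith
qed

section \<open>Conjugating Salem numbers\<close>

text \<open>Polynomials over a subfield stay in the ambient polynomial type, so that all fields of a
  tower share one type.\<close>

definition coeffs_in :: "'a::zero set \<Rightarrow> 'a poly \<Rightarrow> bool" where
  "coeffs_in K q \<longleftrightarrow> (\<forall>i. coeff q i \<in> K)"

locale subfield_hom =
  fixes K :: "'a::field set" and f :: "'a \<Rightarrow> 'b::field"
  assumes one_in: "1 \<in> K" and diff_in: "x \<in> K \<Longrightarrow> y \<in> K \<Longrightarrow> x - y \<in> K"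
    and mult_in: "x \<in> K \<Longrightarrow> y \<in> K \<Longrightarrow> x * y \<in> K" and inverse_in: "x \<in> K \<Longrightarrow> inverse x \<in> K"
    and hom_one: "f 1 = 1" and hom_add: "x \<in> K \<Longrightarrow> y \<in> K \<Longrightarrow> f (x + y) = f x + f y"
    and hom_mult: "x \<in> K \<Longrightarrow> y \<in> K \<Longrightarrow> f (x * y) = f x * f y"
begin

lemma zero_in: "0 \<in> K" using diff_in[OF one_in one_in] by simp
lemma uminus_in: "x \<in> K \<Longrightarrow> - x \<in> K" using diff_in[OF zero_in, of x] by simp
lemma add_in: "x \<in> K \<Longrightarrow> y \<in> K \<Longrightarrow> x + y \<in> K" using diff_in[of x "- y"] uminus_in by simp
lemma hom_zero: "f 0 = 0" using hom_add[OF zero_in zero_in] by (metis add_0_right add_left_cancel)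
lemma hom_uminus: "x \<in> K \<Longrightarrow> f (- x) = - f x"
  using hom_add[of x "- x"] uminus_in hom_zero by (simp add: eq_neg_iff_add_eq_0 add.commute)
lemma hom_diff: "x \<in> K \<Longrightarrow> y \<in> K \<Longrightarrow> f (x - y) = f x - f y"
  using hom_add[of x "- y"] uminus_in hom_uminus by simp
lemma hom_eq_0: "x \<in> K \<Longrightarrow> f x = 0 \<Longrightarrow> x = 0"
  using hom_mult[of x "inverse x"] inverse_in hom_one by (cases "x = 0") auto

lemma coeffs_in_0: "coeffs_in K 0" by (simp add: coeffs_in_def zero_in)
lemma coeffs_in_pCons: "coeffs_in K (pCons a q) \<longleftrightarrow> a \<in> K \<and> coeffs_in K q"
  by (auto simp: coeffs_in_def coeff_pCons split: nat.splits)
lemma coeffs_in_add: "coeffs_in K p \<Longrightarrow> coeffs_in K q \<Longrightarrow> coeffs_in K (p + q)"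
  by (simp add: coeffs_in_def add_in)
lemma coeffs_in_diff: "coeffs_in K p \<Longrightarrow> coeffs_in K q \<Longrightarrow> coeffs_in K (p - q)"
  by (simp add: coeffs_in_def diff_in)
lemma coeffs_in_smult: "a \<in> K \<Longrightarrow> coeffs_in K q \<Longrightarrow> coeffs_in K (smult a q)"
  by (simp add: coeffs_in_def mult_in)
lemma coeffs_in_monom: "a \<in> K \<Longrightarrow> coeffs_in K (monom a n)"
  by (simp add: coeffs_in_def zero_in)
lemma coeffs_in_mult: "coeffs_in K p \<Longrightarrow> coeffs_in K q \<Longrightarrow> coeffs_in K (p * q)"
  by (induction p) (simp_all add: coeffs_in_pCons coeffs_in_add coeffs_in_smult zero_in coeffs_in_0)

lemma map_add: "coeffs_in K p \<Longrightarrow> coeffs_in K q \<Longrightarrow> map_poly f (p + q) = map_poly f p + map_poly f q"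
  by (intro poly_eqI) (simp add: coeff_map_poly hom_zero hom_add coeffs_in_def)
lemma map_diff: "coeffs_in K p \<Longrightarrow> coeffs_in K q \<Longrightarrow> map_poly f (p - q) = map_poly f p - map_poly f q"
  by (intro poly_eqI) (simp add: coeff_map_poly hom_zero hom_diff coeffs_in_def)
lemma map_smult: "a \<in> K \<Longrightarrow> coeffs_in K q \<Longrightarrow> map_poly f (smult a q) = smult (f a) (map_poly f q)"
  by (intro poly_eqI) (simp add: coeff_map_poly hom_zero hom_mult coeffs_in_def)
lemma map_pCons: "map_poly f (pCons a q) = pCons (f a) (map_poly f q)"
  by (intro poly_eqI) (simp add: coeff_map_poly hom_zero coeff_pCons split: nat.splits)
lemma map_mult: "coeffs_in K p \<Longrightarrow> coeffs_in K q \<Longrightarrow> map_poly f (p * q) = map_poly f p * map_poly f q"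
  by (induction p) (simp_all add: coeffs_in_pCons map_add map_pCons map_smult coeffs_in_smult coeffs_in_mult
      coeffs_in_0 zero_in hom_zero)
lemma poly_in: "coeffs_in K q \<Longrightarrow> x \<in> K \<Longrightarrow> poly q x \<in> K"
  by (induction q) (simp_all add: coeffs_in_pCons zero_in add_in mult_in)
lemma poly_map: "coeffs_in K q \<Longrightarrow> x \<in> K \<Longrightarrow> poly (map_poly f q) (f x) = f (poly q x)"
  by (induction q) (simp_all add: coeffs_in_pCons hom_zero map_pCons hom_add hom_mult mult_in poly_in)
lemma degree_map: "coeffs_in K q \<Longrightarrow> degree (map_poly f q) = degree q"
proof (cases "q = 0")
  case False
  assume "coeffs_in K q"
  then have "f (lead_coeff q) \<noteq> 0" using False hom_eq_0[of "lead_coeff q"] by (auto simp: coeffs_in_def)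
  then show ?thesis
    by (intro antisym degree_le le_degree) (auto simp: coeff_map_poly hom_zero coeff_eq_0)
qed simp

lemma coeffs_in_divide:
  assumes "coeffs_in K q" "coeffs_in K m" "m \<noteq> 0"
  shows "\<exists>s r. coeffs_in K s \<and> coeffs_in K r \<and> q = s * m + r \<and> (r = 0 \<or> degree r < degree m)"
  using assms(1)
\<comment> \<open>The measure puts 0 below the nonzero constants: dividing a constant by a constant
  lowers no degree, but leaves 0.\<close>
proof (induction "if q = 0 then 0 else Suc (degree q)" arbitrary: q rule: less_induct)
  case less
  show ?case
  proof (cases "q = 0 \<or> degree q < degree m")
    case True
    then show ?thesis using less.prems coeffs_in_0 by (intro exI[of _ 0] exI[of _ q]) auto
  next
    case False
    define c where "c = monom (lead_coeff q * inverse (lead_coeff m)) (degree q - degree m)"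
    define q' where "q' = q - c * m"
    have c: "coeffs_in K c" unfolding c_def
      using less.prems assms(2) by (intro coeffs_in_monom mult_in inverse_in) (auto simp: coeffs_in_def)
    then have q': "coeffs_in K q'" unfolding q'_def
      using less.prems assms(2) by (intro coeffs_in_diff coeffs_in_mult)
    have dc: "degree (c * m) \<le> degree q"
    proof -
      have "degree (c * m) \<le> degree c + degree m" by (rule degree_mult_le)
      also have "degree c \<le> degree q - degree m" unfolding c_def by (rule degree_monom_le)
      finally show ?thesis using False by simp
    qed
    have "coeff (c * m) (degree q) = lead_coeff q"
    proof -
      have "coeff (c * m) (degree q) = lead_coeff q * inverse (lead_coeff m) * coeff m (degree q - (degree q - degree m))"
        unfolding c_def by (subst coeff_monom_mult) simp
      also have "degree q - (degree q - degree m) = degree m" using False by simp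
      finally show ?thesis using assms(3) by simp
    qed
    then have 0: "coeff q' (degree q) = 0" by (simp add: q'_def)
    have "degree q' \<le> degree q" unfolding q'_def using dc by (intro degree_diff_le) auto
    with 0 have "q' = 0 \<or> degree q' < degree q" by (metis le_neq_implies_less leading_coeff_0_iff)
    then have "(if q' = 0 then 0 else Suc (degree q')) < (if q = 0 then 0 else Suc (degree q))" using False by auto
    from less.hyps[OF this q'] obtain s r where "coeffs_in K s" "coeffs_in K r" "q' = s * m + r" "r = 0 \<or> degree r < degree m"
      by blast
    moreover from this have "q = (s + c) * m + r" by (simp add: q'_def algebra_simps)
    ultimately show ?thesis using c coeffs_in_add by blast
  qed
qed

end

definition minimal_poly :: "'a::field set \<Rightarrow> 'a \<Rightarrow> 'a poly \<Rightarrow> bool" where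
  "minimal_poly K y m \<longleftrightarrow> coeffs_in K m \<and> m \<noteq> 0 \<and> poly m y = 0 \<and>
     (\<forall>q. coeffs_in K q \<and> q \<noteq> 0 \<and> poly q y = 0 \<longrightarrow> degree m \<le> degree q)"

lemma minimal_poly_ex:
  assumes "coeffs_in K q" "q \<noteq> 0" "poly q y = 0"
  obtains m where "minimal_poly K y m"
proof -
  let ?Q = "\<lambda>q. coeffs_in K q \<and> q \<noteq> 0 \<and> poly q y = 0"
  have "?Q q" using assms by blast
  then obtain m where "?Q m" "\<And>q. ?Q q \<Longrightarrow> degree m \<le> degree q"
    using ex_has_least_nat[of ?Q q degree] by blast
  then show thesis using that[of m] unfolding minimal_poly_def by blast
qed

context subfield_hom begin

lemma minimal_poly_dvd:
  assumes "minimal_poly K y m" "coeffs_in K q" "poly q y = 0"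
  obtains s where "coeffs_in K s" "q = s * m"
proof -
  obtain s r where sr: "coeffs_in K s" "coeffs_in K r" "q = s * m + r" "r = 0 \<or> degree r < degree m"
    using coeffs_in_divide[of q m] assms by (auto simp: minimal_poly_def)
  have "poly r y = 0" using sr(3) assms by (simp add: minimal_poly_def)
  then have "r = 0" using assms(1) sr unfolding minimal_poly_def by (meson not_less)
  with sr that show thesis by simp
qed

text \<open>\<open>K[y]\<close> is a field. An element \<open>g\<close> of least degree in the ideal
  of \<open>q\<close> and \<open>m\<close> divides both. As \<open>g\<close> does not vanish at
  \<open>y\<close>, its cofactor in \<open>m\<close> does; by minimality \<open>g\<close> is
  constant, and Bezout's relation yields the inverse.\<close>

lemma adjoin_inverse:
  assumes m: "minimal_poly K y m" and q: "coeffs_in K q"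
  shows "\<exists>r. coeffs_in K r \<and> inverse (poly q y) = poly r y"
proof (cases "poly q y = 0")
  case True
  then show ?thesis using coeffs_in_0 by (intro exI[of _ 0]) simp
next
  case False
  let ?I = "\<lambda>g. g \<noteq> 0 \<and> (\<exists>a b. coeffs_in K a \<and> coeffs_in K b \<and> g = a * q + b * m)"
  have K1: "coeffs_in K 1" by (simp add: one_pCons coeffs_in_pCons one_in coeffs_in_0)
  have mK: "coeffs_in K m" "m \<noteq> 0" "poly m y = 0" using m by (auto simp: minimal_poly_def)
  have "?I m" using mK K1 coeffs_in_0 by (intro conjI exI[of _ 0] exI[of _ 1]) auto
  then obtain g where g: "?I g" "\<And>h. ?I h \<Longrightarrow> degree g \<le> degree h"
    using ex_has_least_nat[of ?I m degree] by blast
  then obtain a b where ab: "coeffs_in K a" "coeffs_in K b" "g = a * q + b * m" by blast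
  have gK: "coeffs_in K g" using ab q mK by (auto intro: coeffs_in_add coeffs_in_mult)
  have dvd: "\<exists>s. coeffs_in K s \<and> h = s * g" if h: "\<exists>a b. coeffs_in K a \<and> coeffs_in K b \<and> h = a * q + b * m" for h
  proof -
    obtain a' b' where ab': "coeffs_in K a'" "coeffs_in K b'" "h = a' * q + b' * m" using h by blast
    have hK: "coeffs_in K h" using ab' q mK by (auto intro: coeffs_in_add coeffs_in_mult)
    obtain s r where sr: "coeffs_in K s" "coeffs_in K r" "h = s * g + r" "r = 0 \<or> degree r < degree g"
      using coeffs_in_divide[OF hK gK] g(1) by auto
    have "r = (a' - s * a) * q + (b' - s * b) * m" using sr(3) ab(3) ab'(3) by (simp add: algebra_simps)
    moreover have "coeffs_in K (a' - s * a)" "coeffs_in K (b' - s * b)"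
      using ab ab' sr by (auto intro: coeffs_in_diff coeffs_in_mult)
    ultimately have "r = 0" using g(2)[of r] sr(4) by (metis not_less)
    with sr show ?thesis by auto
  qed
  have "\<exists>s. coeffs_in K s \<and> m = s * g" using K1 coeffs_in_0 by (intro dvd exI[of _ 0] exI[of _ 1]) auto
  then obtain s where s: "coeffs_in K s" "m = s * g" by blast
  have "\<exists>s. coeffs_in K s \<and> q = s * g" using K1 coeffs_in_0 by (intro dvd exI[of _ 1] exI[of _ 0]) auto
  then have "poly g y \<noteq> 0" using False by auto
  then have "poly s y = 0" using s mK by simp
  moreover have "s \<noteq> 0" using s mK by auto
  ultimately have "degree m \<le> degree s" using m s unfolding minimal_poly_def by blast
  also have "degree m = degree s + degree g" unfolding s(2) using \<open>s \<noteq> 0\<close> g(1) by (intro degree_mult_eq) auto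
  finally have "degree g = 0" by simp
  then obtain u where u: "g = [:u:]" by (rule degree_eq_zeroE)
  have uK: "u \<in> K" "u \<noteq> 0" using u gK g(1) by (auto simp: coeffs_in_pCons)
  have "poly a y * poly q y = u" using ab(3) mK u by (metis poly_add poly_mult poly_pCons poly_0 mult_zero_right add.right_neutral)
  then have "inverse (poly q y) = poly (smult (inverse u) a) y"
    using uK False by (simp add: field_simps)
  then show ?thesis using coeffs_in_smult[OF inverse_in[OF uK(1)] ab(1)] by blast
qed

text \<open>The new field is \<open>K[y]\<close>, and \<open>poly q y\<close> goes to the value at
  \<open>y'\<close> of the transported \<open>q\<close>. Two choices of \<open>q\<close> differ by a
  multiple of \<open>m\<close>, whose transport vanishes at \<open>y'\<close>, so the map is well
  defined.\<close>

lemma extend: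
  assumes m: "minimal_poly K y m" and y': "poly (map_poly f m) y' = 0"
  obtains L g where "subfield_hom L g" "K \<subseteq> L" "y \<in> L" "\<And>x. x \<in> K \<Longrightarrow> g x = f x" "g y = y'"
proof -
  define L where "L = {poly q y |q. coeffs_in K q}"
  define g where "g u = poly (map_poly f (SOME q. coeffs_in K q \<and> poly q y = u)) y'" for u
  have mK: "coeffs_in K m" using m by (simp add: minimal_poly_def)
  have g: "g (poly q y) = poly (map_poly f q) y'" if q: "coeffs_in K q" for q
  proof -
    define r where "r = (SOME r. coeffs_in K r \<and> poly r y = poly q y)"
    have r: "coeffs_in K r \<and> poly r y = poly q y"
      unfolding r_def by (rule someI[of _ q]) (use q in simp)
    obtain s where s: "coeffs_in K s" "r - q = s * m"
      using minimal_poly_dvd[OF m, of "r - q"] coeffs_in_diff r q by auto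
    have "map_poly f r - map_poly f q = map_poly f s * map_poly f m"
      using map_diff[of r q] map_mult[OF s(1) mK] r q s(2) by simp
    then have "poly (map_poly f r) y' - poly (map_poly f q) y' = 0"
      using y' by (metis poly_diff poly_mult mult_zero_right)
    then show ?thesis by (simp add: g_def r_def)
  qed
  have const: "coeffs_in K [:x:]" if "x \<in> K" for x using that by (simp add: coeffs_in_pCons coeffs_in_0)
  have K1: "coeffs_in K 1" by (simp add: one_pCons const one_in)
  have X: "coeffs_in K [:0, 1:]" by (simp add: coeffs_in_pCons coeffs_in_0 zero_in one_in)
  have "subfield_hom L g"
  proof
    show "1 \<in> L" using K1 unfolding L_def by (intro CollectI exI[of _ 1]) simp
    show "g 1 = 1" using g[OF K1] by (simp add: one_pCons map_pCons hom_one)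
    fix u assume "u \<in> L"
    then obtain p where p: "u = poly p y" "coeffs_in K p" by (auto simp: L_def)
    show "inverse u \<in> L" using adjoin_inverse[OF m p(2)] by (auto simp: L_def p(1))
    fix v assume "v \<in> L"
    then obtain q where q: "v = poly q y" "coeffs_in K q" by (auto simp: L_def)
    show "u - v \<in> L" using p q coeffs_in_diff unfolding L_def by (intro CollectI exI[of _ "p - q"]) simp
    show "u * v \<in> L" using p q coeffs_in_mult unfolding L_def by (intro CollectI exI[of _ "p * q"]) simp
    show "g (u + v) = g u + g v"
      using g[OF p(2)] g[OF q(2)] g[OF coeffs_in_add[OF p(2) q(2)]] p q by (simp add: map_add)
    show "g (u * v) = g u * g v"
      using g[OF p(2)] g[OF q(2)] g[OF coeffs_in_mult[OF p(2) q(2)]] p q by (simp add: map_mult)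
  qed
  moreover have "K \<subseteq> L" using const unfolding L_def by (auto intro!: exI[of _ "[:_:]"])
  moreover have "y \<in> L" using X unfolding L_def by (intro CollectI exI[of _ "[:0, 1:]"]) simp
  moreover have "g x = f x" if "x \<in> K" for x using g[OF const[OF that]] by (simp add: map_pCons)
  moreover have "g y = y'" using g[OF X] by (simp add: map_pCons hom_one hom_zero)
  ultimately show thesis by (rule that)
qed

end

section \<open>Embeddings of real fields and Galois conjugates\<close>

lemma subfield_hom_of_rat: "subfield_hom UNIV (of_rat :: rat \<Rightarrow> 'a::field_char_0)"
  by unfold_locales (simp_all add: of_rat_add of_rat_mult)

lemma subfield_hom_Rats: "subfield_hom \<rat> complex_of_real"
  by unfold_locales auto

lemma poly_of_rat_of_real: "poly (map_poly of_rat q) (complex_of_real x) = of_real (poly (map_poly of_rat q) x)"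
proof (induction q)
  case (pCons a q)
  have "complex_of_real (of_rat a) = of_rat a" by (cases a) (simp add: of_rat_rat)
  with pCons show ?case by (simp add: subfield_hom.map_pCons[OF subfield_hom_of_rat])
qed simp

lemma irreducible_rat_poly_ex:
  fixes x :: real
  assumes "algebraic_int x"
  obtains q :: "rat poly" where "irreducible q" "poly (map_poly of_rat q) x = 0"
proof -
  obtain p :: "int poly" where p: "poly (map_poly of_int p) x = 0" "lead_coeff p = 1"
    using assms algebraic_int_altdef_ipoly by blast
  let ?Q = "\<lambda>q :: rat poly. q \<noteq> 0 \<and> poly (map_poly of_rat q) x = 0"
  have "map_poly of_rat (map_poly of_int p :: rat poly) = (map_poly of_int p :: real poly)"
    by (intro poly_eqI) (simp add: coeff_map_poly)
  moreover have "lead_coeff (map_poly of_int p :: rat poly) \<noteq> 0"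
  proof -
    have "coeff (map_poly of_int p :: rat poly) (degree p) = 1" using p(2) by (simp add: coeff_map_poly)
    then show ?thesis by auto
  qed
  ultimately have "?Q (map_poly of_int p)" using p(1) by auto
  then obtain m where m: "?Q m" "\<And>q. ?Q q \<Longrightarrow> degree m \<le> degree q"
    using ex_has_least_nat[of ?Q _ degree] by blast
  have unit: "b dvd 1" if ab: "m = a * b" and "poly (map_poly of_rat a) x = 0" for a b
  proof -
    have "a \<noteq> 0" "b \<noteq> 0" using ab m(1) by auto
    then have "degree m = degree a + degree b" unfolding ab by (intro degree_mult_eq)
    moreover have "degree m \<le> degree a" using m(2)[of a] that \<open>a \<noteq> 0\<close> by simp
    ultimately show ?thesis using \<open>b \<noteq> 0\<close> by (simp add: is_unit_iff_degree)
  qed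
  have "irreducible m"
  proof (rule irreducibleI)
    show "m \<noteq> 0" using m by simp
    show "\<not> m dvd 1"
    proof
      assume "m dvd 1"
      then obtain c where "m = [:c:]" by (auto simp: is_unit_poly_iff)
      then show False using m(1) by (simp add: subfield_hom.map_pCons[OF subfield_hom_of_rat])
    qed
    fix a b assume ab: "m = a * b"
    have "poly (map_poly of_rat m) x = poly (map_poly of_rat a) x * poly (map_poly of_rat b) x"
      by (simp add: ab coeffs_in_def subfield_hom.map_mult[OF subfield_hom_of_rat])
    then have "poly (map_poly of_rat a) x = 0 \<or> poly (map_poly of_rat b) x = 0" using m(1) by simp
    then show "a dvd 1 \<or> b dvd 1" using unit[of a b] unit[of b a] ab by (auto simp: mult.commute)
  qed
  with m(1) that show thesis by blast
qed

lemma Rats_subset_subfield: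
  assumes "subfield_hom (K :: 'a::field_char_0 set) f"
  shows "\<rat> \<subseteq> K"
proof
  interpret subfield_hom K f by (rule assms)
  fix x :: 'a assume "x \<in> \<rat>"
  have nat: "of_nat n \<in> K" for n by (induction n) (auto simp: zero_in one_in add_in)
  have int: "of_int n \<in> K" for n by (cases n) (auto simp: nat uminus_in simp del: of_nat_Suc)
  from \<open>x \<in> \<rat>\<close> obtain a b :: int where "x = of_int a / of_int b" by (auto elim: Rats_cases')
  then show "x \<in> K" by (simp add: divide_inverse int mult_in inverse_in)
qed

lemma hom_of_rat:
  assumes "subfield_hom (K :: 'a::field_char_0 set) (f :: 'a \<Rightarrow> 'b::field_char_0)"
  shows "f (of_rat r) = of_rat r"
proof -
  interpret subfield_hom K f by (rule assms)
  have Q: "\<rat> \<subseteq> K" by (rule Rats_subset_subfield[OF assms])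
  then have inK: "of_rat s \<in> K" "of_nat n \<in> K" "of_int i \<in> K" for s n i by auto
  have nat: "f (of_nat n) = of_nat n" for n
    by (induction n) (simp_all add: hom_zero hom_one hom_add one_in inK)
  have int: "f (of_int i) = of_int i" for i
    by (cases i) (auto simp: nat hom_uminus inK simp del: of_nat_Suc)
  obtain a b where r: "r = Fract a b" "b > 0" by (cases r)
  then have "of_rat r * of_int b = (of_int a :: 'a)" by (simp add: of_rat_rat)
  then have "f (of_rat r) * f (of_int b) = f (of_int a)" using hom_mult inK by metis
  then show ?thesis using r by (simp add: int of_rat_rat field_simps)
qed

text \<open>An embedding fixes the rationals, so it maps roots of a rational polynomial to roots of
  the same polynomial.\<close>

lemma galois_conjugate_hom:
  assumes "subfield_hom K f" "x \<in> K" "algebraic_int x"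
  shows "galois_conjugate x (f x)"
proof -
  interpret subfield_hom K f by (rule assms(1))
  obtain q :: "rat poly" where q: "irreducible q" "poly (map_poly of_rat q) x = 0"
    using irreducible_rat_poly_ex[OF assms(3)] by blast
  have "coeffs_in K (map_poly of_rat q)"
    using Rats_subset_subfield[OF assms(1)] by (auto simp: coeffs_in_def coeff_map_poly)
  then have "poly (map_poly f (map_poly of_rat q)) (f x) = f (poly (map_poly of_rat q) x)"
    using assms(2) by (rule poly_map)
  also have "map_poly f (map_poly of_rat q) = map_poly of_rat q"
    by (intro poly_eqI) (simp add: coeff_map_poly hom_zero hom_of_rat[OF assms(1)])
  finally show ?thesis
    using q hom_zero by (auto simp: galois_conjugate_def poly_of_rat_of_real)
qed

lemma algebraic_minimal_poly:
  assumes "subfield_hom (K :: real set) (f :: real \<Rightarrow> complex)" "algebraic_int y"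
  obtains m where "minimal_poly K y m"
proof -
  obtain p where p: "lead_coeff p = 1" "\<forall>i. coeff p i \<in> \<int>" "poly p y = 0"
    using assms(2) by (auto elim: algebraic_int.cases)
  have "coeffs_in K p" using p(2) Rats_subset_subfield[OF assms(1)] Ints_subset_Rats by (auto simp: coeffs_in_def)
  moreover have "p \<noteq> 0" using p(1) by auto
  ultimately show thesis using minimal_poly_ex[OF _ _ p(3)] that by blast
qed

text \<open>The transported minimal polynomial is not constant and has a root in the complex
  numbers; any root serves in \<open>extend\<close>.\<close>

lemma extend_algebraic:
  assumes "subfield_hom (K :: real set) (f :: real \<Rightarrow> complex)" "algebraic_int y"
  obtains L g where "subfield_hom L g" "K \<subseteq> L" "y \<in> L" "\<And>x. x \<in> K \<Longrightarrow> g x = f x"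
proof -
  interpret subfield_hom K f by (rule assms(1))
  obtain m where m: "minimal_poly K y m" using algebraic_minimal_poly[OF assms] by blast
  have "degree m > 0"
  proof (rule ccontr)
    assume "\<not> ?thesis"
    then obtain c where "m = [:c:]" using degree_eq_zeroE[of m] by auto
    with m show False by (simp add: minimal_poly_def)
  qed
  then obtain y' where y': "poly (map_poly f m) y' = 0"
    using alg_closed_imp_poly_has_root[of "map_poly f m"] m by (auto simp: degree_map minimal_poly_def)
  show thesis
  proof (rule extend[OF m y'])
    fix L g assume "subfield_hom L g" "K \<subseteq> L" "y \<in> L" "\<And>x. x \<in> K \<Longrightarrow> g x = f x"
    then show thesis by (rule that)
  qed
qed

text \<open>\<open>m\<close> splits off the factor \<open>X - x\<close>, and the cofactor is not
  constant since \<open>x\<close> is irrational. Its root \<open>x'\<close> is not \<open>x\<close>,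
  because a double root of \<open>m\<close> would be a root of \<open>pderiv m\<close>, against
  minimality.\<close>

lemma conjugate_ex:
  assumes "algebraic_int (x :: real)" "x \<notin> \<rat>"
  obtains K f where "subfield_hom (K :: real set) (f :: real \<Rightarrow> complex)" "x \<in> K" "f x \<noteq> complex_of_real x"
proof -
  interpret subfield_hom \<rat> complex_of_real by (rule subfield_hom_Rats)
  obtain m where m: "minimal_poly \<rat> x m" using algebraic_minimal_poly[OF subfield_hom_Rats assms(1)] by blast
  have mQ: "coeffs_in \<rat> m" "m \<noteq> 0" "poly m x = 0" using m by (auto simp: minimal_poly_def)
  obtain r where r: "m = [:- x, 1:] * r" using mQ(3) by (auto simp: poly_eq_0_iff_dvd)
  have "r \<noteq> 0" using r mQ by auto
  then have deg: "degree m = Suc (degree r)" unfolding r by (subst degree_mult_eq) auto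
  have "degree r > 0"
  proof (rule ccontr)
    assume "\<not> ?thesis"
    then obtain c where "r = [:c:]" using degree_eq_zeroE[of r] by auto
    then have c: "coeff m 0 = - x * c" "coeff m 1 = c" by (simp_all add: r)
    have "c \<noteq> 0" using \<open>r \<noteq> 0\<close> \<open>r = [:c:]\<close> by auto
    then have "x = - (coeff m 0 / coeff m 1)" unfolding c by simp
    moreover have "- (coeff m 0 / coeff m 1) \<in> \<rat>"
      using mQ(1) unfolding coeffs_in_def by (intro Rats_minus_iff[THEN iffD2] Rats_divide) auto
    ultimately show False using assms(2) by simp
  qed
  have map: "map_poly complex_of_real (p * q) = map_poly of_real p * map_poly of_real q" for p q
    by (simp add: poly_eq_iff coeff_map_poly coeff_mult)
  have ev: "poly (map_poly complex_of_real p) (of_real u) = of_real (poly p u)" for p u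
    by (induction p) (simp_all add: map_poly_pCons)
  obtain x' :: complex where x': "poly (map_poly of_real r) x' = 0"
    using alg_closed_imp_poly_has_root[of "map_poly complex_of_real r"] \<open>degree r > 0\<close> by (auto simp: degree_map_poly)
  have "x' \<noteq> of_real x"
  proof
    assume "x' = of_real x"
    then have "of_real (poly r x) = (0 :: complex)" using x' by (simp add: ev)
    then have rx: "poly r x = 0" by simp
    have "poly (pderiv m) x = 0" using rx unfolding r pderiv_mult by (simp add: pderiv_pCons)
    moreover have "coeffs_in \<rat> (pderiv m)" using mQ(1) by (auto simp: coeffs_in_def coeff_pderiv)
    moreover have "pderiv m \<noteq> 0" using deg by (simp add: pderiv_eq_0_iff)
    ultimately have "degree m \<le> degree (pderiv m)" using m unfolding minimal_poly_def by blast
    then show False using deg by (simp add: degree_pderiv)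
  qed
  moreover have "poly (map_poly of_real m) x' = 0" unfolding r map poly_mult x' by simp
  then obtain L g where "subfield_hom L g" "x \<in> L" "g x = x'" by (rule extend[OF m])
  ultimately show thesis using that[of L g] by simp
qed

text \<open>A conjugate \<open>\<xi>\<close> of \<open>x\<close> with \<open>\<bar>\<xi>\<bar> < 2\<close> would turn the equation into the vanishing of a positive
  definite form.\<close>
lemma Salem_Markov_triple_integral:
  fixes x y z :: real
  assumes x: "geometric_Salem x" and y: "geometric_Salem y" and z: "geometric_Salem z"
    and eq: "x\<^sup>2 + y\<^sup>2 + z\<^sup>2 = x * y * z"
  shows "x \<in> \<int>"
proof (rule ccontr)
  assume "x \<notin> \<int>"
  have alg: "algebraic_int x" "algebraic_int y" "algebraic_int z"
    using x y z by (auto simp: geometric_Salem_def)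
  then have "x \<notin> \<rat>" using \<open>x \<notin> \<int>\<close> rational_algebraic_int_is_int by blast
  then obtain K1 f1 where 1: "subfield_hom (K1 :: real set) (f1 :: real \<Rightarrow> complex)" "x \<in> K1" "f1 x \<noteq> complex_of_real x"
    using conjugate_ex[OF alg(1)] by blast
  \<comment> \<open>The embedding that moves \<open>x\<close> is extended to \<open>y\<close> and
    \<open>z\<close>, so that one map conjugates the whole equation.\<close>
  obtain K2 f2 where 2: "subfield_hom K2 f2" "K1 \<subseteq> K2" "y \<in> K2" "\<And>x. x \<in> K1 \<Longrightarrow> f2 x = f1 x"
    by (rule extend_algebraic[OF 1(1) alg(2)]) (rule that)
  obtain K f where 3: "subfield_hom K f" "K2 \<subseteq> K" "z \<in> K" "\<And>x. x \<in> K2 \<Longrightarrow> f x = f2 x"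
    by (rule extend_algebraic[OF 2(1) alg(3)]) (rule that)
  interpret subfield_hom K f by (rule 3(1))
  have in_K: "x \<in> K" "y \<in> K" "z \<in> K" using 1 2 3 by auto
  have fx: "f x \<noteq> of_real x" using 1 2 3 by auto
  have conj: "galois_conjugate x (f x)" "galois_conjugate y (f y)" "galois_conjugate z (f z)"
    using in_K alg galois_conjugate_hom[OF 3(1)] by auto
  have "f x \<in> \<real>" "cmod (f x) < 2" using x conj fx by (auto simp: geometric_Salem_def)
  \<comment> \<open>\<open>f\<close> may fix \<open>y\<close> or \<open>z\<close>, so these images
    are only known to be real; the bound 2 is available for \<open>f x\<close>.\<close>
  moreover have "f y \<in> \<real>" "f z \<in> \<real>" using y z conj unfolding geometric_Salem_def by (metis Reals_of_real)+
  ultimately obtain \<xi> \<eta> \<zeta> where r: "f x = of_real \<xi>" "f y = of_real \<eta>" "f z = of_real \<zeta>" "\<bar>\<xi>\<bar> < 2"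
    by (auto elim!: Reals_cases)
  have "f x * f x + f y * f y + f z * f z = f x * f y * f z"
    using eq in_K by (simp add: power2_eq_square flip: hom_mult hom_add add: add_in mult_in)
  then have "of_real (\<xi> * \<xi> + \<eta> * \<eta> + \<zeta> * \<zeta>) = complex_of_real (\<xi> * \<eta> * \<zeta>)" by (simp add: r)
  then have "\<xi> * \<xi> + \<eta> * \<eta> + \<zeta> * \<zeta> = \<xi> * \<eta> * \<zeta>" by (simp only: of_real_eq_iff)
  \<comment> \<open>The square in \<open>\<eta>\<close> is completed. Because
    \<open>\<bar>\<xi>\<bar> < 2\<close>, no term is negative, so \<open>\<xi>\<close> and with it
    \<open>x\<close> is 0.\<close>
  then have sum: "\<xi>\<^sup>2 + (\<eta> - \<xi> * \<zeta> / 2)\<^sup>2 + (1 - \<xi>\<^sup>2 / 4) * \<zeta>\<^sup>2 = 0"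
    by (simp add: power2_eq_square field_simps)
  have "\<xi>\<^sup>2 \<le> 2\<^sup>2" using r(4) by (intro abs_le_square_iff[THEN iffD1]) simp
  then have "(1 - \<xi>\<^sup>2 / 4) * \<zeta>\<^sup>2 \<ge> 0" by (intro mult_nonneg_nonneg) auto
  with sum have "\<xi>\<^sup>2 = 0" using zero_le_power2[of \<xi>] zero_le_power2[of "\<eta> - \<xi> * \<zeta> / 2"] by linarith
  then have "x = 0" using hom_eq_0[OF in_K(1)] r by simp
  with x show False by (simp add: geometric_Salem_def)
qed

section \<open>Markov triples and the modular group\<close>

definition shear :: "int \<Rightarrow> real^2^2" where
  "shear n = mk2 1 (of_int n) 0 1"

definition rot :: "real^2^2" where
  "rot = mk2 0 (-1) 1 0"

lemma shear_mult: "shear m ** shear n = shear (m + n)"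
  by (simp add: shear_def mat2_eq_iff)

lemma shear_0: "shear 0 = mat 1"
  by (simp add: shear_def mat2_eq_iff)

text \<open>The form that a pair with traces 3, 3, 3 takes in \<open>traces_333_conjugate\<close>:
  \<open>A0\<close> is the companion matrix of \<open>t^2 - 3 t + 1\<close>, and the columns of
  \<open>B0\<close> say \<open>B w = 2 w - A w\<close> and \<open>B A w = A w - w\<close>.\<close>

abbreviation "A0 \<equiv> mk2 0 (-1) 1 3"
abbreviation "B0 \<equiv> mk2 2 (-1) (-1) 1"
abbreviation "G0 \<equiv> matrix_group A0 B0"

text \<open>Six shears suffice because \<open>shear 6\<close> lies in \<open>G0\<close>; up to sign
  it is the inverse of a commutator.\<close>

definition cosets_reached :: "(real^2^2) set" where
  "cosets_reached = {M ** shear i |M i. M \<in> G0 \<and> 0 \<le> i \<and> i < 6}"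

lemma cosets_reachedI: "M \<in> G0 \<Longrightarrow> 0 \<le> i \<Longrightarrow> i < 6 \<Longrightarrow> M ** shear i \<in> cosets_reached"
  by (auto simp: cosets_reached_def)

lemma shear_6: "shear 6 \<in> G0"
proof -
  have "shear 6 = - adj2 (adj2 A0 ** adj2 B0 ** A0 ** B0)"
    by (simp add: shear_def mat2_eq_iff)
  also have "\<dots> \<in> G0" by (intro matrix_group.intros)
  finally show ?thesis .
qed

lemma cosets_reached_mult_left:
  assumes "M \<in> G0" "N \<in> cosets_reached"
  shows "M ** N \<in> cosets_reached"
proof -
  obtain M' i where N: "N = M' ** shear i" "M' \<in> G0" "0 \<le> i" "i < 6"
    using assms(2) by (auto simp: cosets_reached_def)
  then have "M ** N = (M ** M') ** shear i" by (simp add: matrix_mul_assoc)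
  then show ?thesis using N assms(1) by (auto intro!: cosets_reachedI matrix_group.mult)
qed

lemma cosets_reached_neg: "N \<in> cosets_reached \<Longrightarrow> - N \<in> cosets_reached"
  using cosets_reached_mult_left[OF matrix_group.neg[OF matrix_group.one]] by fastforce

text \<open>The index moves by one and wraps around modulo 6, \<open>shear 6\<close> being absorbed
  into \<open>G0\<close>.\<close>

lemma cosets_reached_shear_1:
  assumes "N \<in> cosets_reached"
  shows "N ** shear 1 \<in> cosets_reached" "N ** shear (-1) \<in> cosets_reached"
proof -
  obtain M i where N: "N = M ** shear i" "M \<in> G0" "0 \<le> i" "i < 6"
    using assms by (auto simp: cosets_reached_def)
  have eq: "N ** shear j = M ** shear (i + j)" for j
    by (simp add: N shear_mult flip: matrix_mul_assoc)
  show "N ** shear 1 \<in> cosets_reached"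
  proof (cases "i = 5")
    case True
    then have "N ** shear 1 = (M ** shear 6) ** shear 0" unfolding eq by (simp add: shear_0)
    then show ?thesis using N shear_6 by (auto intro!: cosets_reachedI matrix_group.mult)
  next
    case False
    then show ?thesis unfolding eq using N by (intro cosets_reachedI) auto
  qed
  show "N ** shear (-1) \<in> cosets_reached"
  proof (cases "i = 0")
    case True
    have "adj2 (shear 6) = shear (-6)" by (simp add: shear_def mat2_eq_iff)
    then have "M ** adj2 (shear 6) ** shear 5 = M ** shear (-1)"
      by (simp add: shear_mult flip: matrix_mul_assoc)
    then have "N ** shear (-1) = (M ** adj2 (shear 6)) ** shear 5" unfolding eq using True by simp
    then show ?thesis using N shear_6 by (auto intro!: cosets_reachedI matrix_group.mult matrix_group.adj)
  next
    case False
    then show ?thesis unfolding eq using N by (intro cosets_reachedI) auto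
  qed
qed

lemma cosets_reached_shear:
  assumes "N \<in> cosets_reached"
  shows "N ** shear n \<in> cosets_reached"
proof (induction n rule: int_induct[of _ 0])
  case base
  then show ?case using assms by (simp add: shear_0)
next
  case (step1 i)
  have "N ** shear (i + 1) = N ** shear i ** shear 1" by (simp add: shear_mult flip: matrix_mul_assoc)
  then show ?case using step1 cosets_reached_shear_1 by simp
next
  case (step2 i)
  have "N ** shear (i - 1) = N ** shear i ** shear (-1)" by (simp add: shear_mult flip: matrix_mul_assoc)
  then show ?case using step2 cosets_reached_shear_1 by simp
qed

text \<open>A finite check with explicit words. The index moves by 3 modulo 6: the abelianization of
  PSL(2,Z) is cyclic of order 6, generated by \<open>shear 1\<close>, and \<open>rot\<close> is its
  element of order 2.\<close>

lemma cosets_reached_rot: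
  assumes "N \<in> cosets_reached"
  shows "N ** rot \<in> cosets_reached"
proof -
  obtain M i where N: "N = M ** shear i" "M \<in> G0" "0 \<le> i" "i < 6"
    using assms by (auto simp: cosets_reached_def)
  let ?a = "adj2 A0" and ?b = "adj2 B0"
  have "\<exists>M j. M \<in> G0 \<and> 0 \<le> j \<and> j < 6 \<and> shear i ** rot = M ** shear j"
  proof -
    have *: ?thesis if "shear i ** rot = M ** shear j" "M \<in> G0" "0 \<le> j" "j < 6" for M j using that by blast
    note [simp] = shear_def rot_def mat2_eq_iff
    consider "i = 0" | "i = 1" | "i = 2" | "i = 3" | "i = 4" | "i = 5" using N(3,4) by linarith
    then show ?thesis
    proof cases
      case 1
      then show ?thesis by (intro *[of "- (?b ** A0 ** B0)" 3] matrix_group.intros) simp_all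
    next
      case 2
      then show ?thesis by (intro *[of "- (?b ** ?a ** ?b ** A0 ** B0)" 4] matrix_group.intros) simp_all
    next
      case 3
      then show ?thesis by (intro *[of "- (?b ** ?a ** ?a ** ?b ** A0 ** B0)" 5] matrix_group.intros) simp_all
    next
      case 4
      then show ?thesis by (intro *[of "?b ** ?a ** B0" 0] matrix_group.intros) simp_all
    next
      case 5
      then show ?thesis by (intro *[of "?b ** ?a ** B0 ** A0 ** B0" 1] matrix_group.intros) simp_all
    next
      case 6
      then show ?thesis by (intro *[of "?b ** ?a ** B0 ** A0 ** A0 ** B0" 2] matrix_group.intros) simp_all
    qed
  qed
  then have "shear i ** rot \<in> cosets_reached" unfolding cosets_reached_def by blast
  then show ?thesis using cosets_reached_mult_left[OF N(2)] by (simp add: N(1) flip: matrix_mul_assoc)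
qed

abbreviation imat :: "int \<Rightarrow> int \<Rightarrow> int \<Rightarrow> int \<Rightarrow> real^2^2" where
  "imat a b c d \<equiv> mk2 (of_int a) (of_int b) (of_int c) (of_int d)"

text \<open>Euclid's algorithm on the bottom row. The matrix is obtained by \<open>rot\<close>, a
  shear and a sign from one whose lower left entry is the remainder of \<open>d\<close> modulo
  \<open>c\<close>.\<close>

lemma SL2Z_cosets:
  assumes "a * d - b * c = 1"
  shows "imat a b c d \<in> cosets_reached"
  using assms
proof (induction "nat \<bar>c\<bar>" arbitrary: a b c d rule: less_induct)
  case less
  have one: "mat 1 \<in> cosets_reached"
    using cosets_reachedI[OF matrix_group.one, of 0] by (simp add: shear_0)
  show ?case
  proof (cases "c = 0")
    case True
    then have "a * d = 1" using less.prems by simp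
    then consider "a = 1" "d = 1" | "a = -1" "d = -1" by (auto simp: zmult_eq_1_iff)
    then show ?thesis
    proof cases
      case 1
      then have "imat a b c d = mat 1 ** shear b"
        using True by (simp add: shear_def mat2_eq_iff)
      then show ?thesis using cosets_reached_shear[OF one] by simp
    next
      case 2
      then have "imat a b c d = - (mat 1 ** shear (- b))"
        using True by (simp add: shear_def mat2_eq_iff)
      then show ?thesis using cosets_reached_neg[OF cosets_reached_shear[OF one]] by simp
    qed
  next
    case False
    define q where "q = d div c"
    have "d - q * c = d mod c" by (simp add: q_def minus_div_mult_eq_mod)
    then have "\<bar>d - q * c\<bar> < \<bar>c\<bar>" using False abs_mod_less[of c d] by simp
    then have lt: "nat \<bar>d - q * c\<bar> < nat \<bar>c\<bar>" using False by simp
    have "(b - q * a) * (- c) - (- a) * (d - q * c) = 1" using less.prems by (simp add: algebra_simps)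
    from less.hyps[OF lt this]
    have *: "imat (b - q * a) (- a) (d - q * c) (- c) \<in> cosets_reached" .
    have "imat a b c d =
      - (imat (b - q * a) (- a) (d - q * c) (- c) ** rot ** shear q)"
      by (simp add: rot_def shear_def mat2_eq_iff algebra_simps)
    then show ?thesis using cosets_reached_neg[OF cosets_reached_shear[OF cosets_reached_rot[OF *]]] by simp
  qed
qed

definition integral_mat :: "real^2^2 \<Rightarrow> bool" where
  "integral_mat M \<longleftrightarrow> M$1$1 \<in> \<int> \<and> M$1$2 \<in> \<int> \<and> M$2$1 \<in> \<int> \<and> M$2$2 \<in> \<int>"

lemma integral_mat_cosets_reached:
  assumes "integral_mat M" "det M = 1"
  shows "M \<in> cosets_reached"
proof -
  obtain a b c d where *: "M$1$1 = of_int a" "M$1$2 = of_int b" "M$2$1 = of_int c" "M$2$2 = of_int d"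
    using assms(1) by (auto simp: integral_mat_def elim!: Ints_cases)
  then have M: "M = imat a b c d" by (simp add: mat2_eq_iff)
  have "of_int (a * d - b * c) = (of_int 1 :: real)" using assms(2) by (simp add: det_2 M)
  then have "a * d - b * c = 1" by (simp only: of_int_eq_iff)
  then show ?thesis unfolding M by (rule SL2Z_cosets)
qed

lemma G0_integral: "M \<in> G0 \<Longrightarrow> integral_mat M \<and> det M = 1"
  by (induction rule: matrix_group.induct) (auto simp: integral_mat_def det_mul, auto simp: det_2)

section \<open>Markov descent by Nielsen moves\<close>

lemma matrix_group_mono:
  assumes "A \<in> matrix_group A' B'" "B \<in> matrix_group A' B'"
  shows "matrix_group A B \<subseteq> matrix_group A' B'"
proof
  fix M assume "M \<in> matrix_group A B"
  then show "M \<in> matrix_group A' B'" using assms by induction (auto intro: matrix_group.intros)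
qed

text \<open>Vieta jumping: \<open>z\<close> and \<open>x * y - z\<close> are the roots of
  \<open>T^2 - x y T + x^2 + y^2\<close>, whose constant term is positive.\<close>

lemma Markov_descent:
  fixes x y z :: int
  assumes pos: "x > 0" "y > 0" "z > 0" and eq: "x\<^sup>2 + y\<^sup>2 + z\<^sup>2 = x * y * z"
    and le: "x \<le> z" "y \<le> z" and ne: "\<not> (x = 3 \<and> y = 3 \<and> z = 3)"
  shows "0 < x * y - z" "x * y - z < z"
proof -
  have prod: "z * (x * y - z) = x\<^sup>2 + y\<^sup>2" using eq by (simp add: algebra_simps power2_eq_square)
  have "x\<^sup>2 + y\<^sup>2 > 0" using pos by (simp add: add_pos_pos)
  with prod pos show "0 < x * y - z" by (metis zero_less_mult_pos)
  have sym: "x * y - z < z" 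
    if pos: "x > 0" "y > 0" "z > 0" and eq: "x\<^sup>2 + y\<^sup>2 + z\<^sup>2 = x * y * z" and le: "x \<le> y" "y \<le> z"
      and ne: "\<not> (x = 3 \<and> y = 3 \<and> z = 3)" for x y z :: int
  proof (rule ccontr)
    assume "\<not> ?thesis"
    \<comment> \<open>The quadratic at \<open>T = y\<close>. Without descent both roots are at least
      \<open>y\<close>, so the value is nonnegative, and this will bound \<open>x\<close> by
      3.\<close>
    then have "(y - z) * (y - (x * y - z)) \<ge> 0" using le by (intro mult_nonpos_nonpos) auto
    also have "(y - z) * (y - (x * y - z)) = 2 * y\<^sup>2 + x\<^sup>2 - x * y\<^sup>2"
      using eq by (simp add: algebra_simps power2_eq_square)
    finally have f: "x * y\<^sup>2 \<le> 2 * y\<^sup>2 + x\<^sup>2" by simp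
    have "x \<noteq> 1" 
    proof
      assume "x = 1"
      then have "(y - z)\<^sup>2 + y * z + 1 = 0" using eq by (simp add: power2_eq_square algebra_simps)
      moreover have "y * z > 0" using pos by simp
      ultimately show False using zero_le_power2[of "y - z"] by linarith
    qed
    moreover have "x \<noteq> 2"
    proof
      assume "x = 2"
      then have "(y - z)\<^sup>2 + 4 = 0" using eq by (simp add: power2_eq_square algebra_simps)
      then show False using zero_le_power2[of "y - z"] by linarith
    qed
    ultimately have x3: "x \<ge> 3" using pos by linarith
    have xy: "x\<^sup>2 \<le> y\<^sup>2" using pos le by (intro power_mono) auto
    have "x \<le> 3"
    proof (rule ccontr)
      assume "\<not> x \<le> 3"
      then have "4 * y\<^sup>2 \<le> x * y\<^sup>2" by (intro mult_right_mono) auto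
      moreover have "y\<^sup>2 > 0" using pos by simp
      ultimately show False using f xy by linarith
    qed
    then have x: "x = 3" using x3 by simp
    then have "y\<^sup>2 \<le> 3\<^sup>2" using f by simp
    then have "y \<le> 3" using pos power2_le_imp_le[of y 3] by simp
    then have y: "y = 3" using le x by simp
    \<comment> \<open>For \<open>x = y = 3\<close> the roots are 3 and 6: the first gives the
      excluded triple, the second does descend.\<close>
    then have "(z - 3) * (z - 6) = 0" using eq x by (simp add: algebra_simps power2_eq_square)
    then show False using ne x y \<open>\<not> x * y - z < z\<close> by auto
  qed
  show "x * y - z < z"
  proof (cases "x \<le> y")
    case True
    then show ?thesis using sym[of x y z] assms by auto
  next
    case False
    then have "y * x - z < z" using assms by (intro sym) (auto simp: algebra_simps)
    then show ?thesis by (simp add: mult.commute)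
  qed
qed

definition reduces_to_333 :: "real^2^2 \<Rightarrow> real^2^2 \<Rightarrow> bool" where
  "reduces_to_333 A B \<longleftrightarrow> (\<exists>A' B'. det A' = 1 \<and> det B' = 1 \<and> trace A' = 3 \<and> trace B' = 3 \<and>
     trace (A' ** B') = 3 \<and> matrix_group A' B' = matrix_group A B)"

text \<open>Inverting \<open>Q\<close> changes the third trace from \<open>w\<close> to
  \<open>u * v - w\<close>, since the traces of \<open>P Q\<close> and \<open>P Q^-1\<close> add up
  to \<open>trace P * trace Q\<close>. If the third trace is the largest, the sum of the three
  decreases.\<close>

lemma Nielsen_reduction:
  fixes x y z :: int
  assumes "det A = 1" "det B = 1" "trace A = of_int x" "trace B = of_int y" "trace (A ** B) = of_int z"
    and "x > 0" "y > 0" "z > 0" "x\<^sup>2 + y\<^sup>2 + z\<^sup>2 = x * y * z"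
  shows "reduces_to_333 A B"
  using assms
proof (induction "nat (x + y + z)" arbitrary: A B x y z rule: less_induct)
  case less
  note IH = less.hyps
  have step: "reduces_to_333 P Q"
    if PQ: "det P = 1" "det Q = 1" "trace P = of_int u" "trace Q = of_int v" "trace (P ** Q) = of_int w"
      and pos: "u > 0" "v > 0" "w > 0" and eq: "u\<^sup>2 + v\<^sup>2 + w\<^sup>2 = u * v * w"
      and max: "u \<le> w" "v \<le> w" and sum: "u + v + w = x + y + z" for P Q u v w
  proof (cases "u = 3 \<and> v = 3 \<and> w = 3")
    case True
    then show ?thesis unfolding reduces_to_333_def using PQ by (intro exI[of _ P] exI[of _ Q]) auto
  next
    case False
    note d = Markov_descent[OF pos eq max False]
    have "nat (u + v + (u * v - w)) < nat (x + y + z)" using d sum pos by simp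
    moreover have "trace (P ** adj2 Q) = of_int (u * v - w)"
    proof -
      have "trace (P ** adj2 Q) = trace P * trace Q - trace (P ** Q)" by (simp add: trace_2 algebra_simps)
      then show ?thesis using PQ by simp
    qed
    moreover have "u\<^sup>2 + v\<^sup>2 + (u * v - w)\<^sup>2 = u * v * (u * v - w)"
      using eq by (simp add: power2_eq_square algebra_simps)
    ultimately have "reduces_to_333 P (adj2 Q)"
      using PQ pos d by (intro IH) auto
    moreover have "matrix_group P (adj2 Q) = matrix_group P Q"
    proof
      show "matrix_group P (adj2 Q) \<subseteq> matrix_group P Q" by (intro matrix_group_mono matrix_group.intros)
      have "adj2 (adj2 Q) \<in> matrix_group P (adj2 Q)" by (intro matrix_group.adj matrix_group.gen2)
      then show "matrix_group P Q \<subseteq> matrix_group P (adj2 Q)"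
        by (intro matrix_group_mono matrix_group.gen1) simp
    qed
    ultimately show ?thesis by (simp add: reduces_to_333_def)
  qed
  \<comment> \<open>Passing to \<open>(Q, (P Q)^-1)\<close> permutes the three traces cyclically and
    can bring the largest into third place.\<close>
  have rotate: "det Q = 1 \<and> det (adj2 (P ** Q)) = 1 \<and> trace (adj2 (P ** Q)) = trace (P ** Q) \<and>
      trace (Q ** adj2 (P ** Q)) = trace P \<and> matrix_group Q (adj2 (P ** Q)) = matrix_group P Q"
    if "det P = 1" "det Q = 1" for P Q
  proof (intro conjI)
    show "det (adj2 (P ** Q)) = 1" using that by (simp add: det_mul)
    have inv: "Q ** adj2 (P ** Q) = adj2 P"
      using that by (simp add: adj2_mult adj2_cancel)
    then show "trace (Q ** adj2 (P ** Q)) = trace P" by simp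
    show "matrix_group Q (adj2 (P ** Q)) = matrix_group P Q"
    proof
      show "matrix_group Q (adj2 (P ** Q)) \<subseteq> matrix_group P Q" by (intro matrix_group_mono matrix_group.intros)
      have "adj2 (Q ** adj2 (P ** Q)) \<in> matrix_group Q (adj2 (P ** Q))" by (intro matrix_group.intros)
      then show "matrix_group P Q \<subseteq> matrix_group Q (adj2 (P ** Q))"
        unfolding inv by (intro matrix_group_mono matrix_group.gen1) simp
    qed
  qed (use that in simp_all)
  let ?C = "adj2 (A ** B)"
  note r1 = rotate[OF less.prems(1,2)]
  then have dC: "det B = 1" "det ?C = 1" by auto
  note r2 = rotate[OF dC]
  have tr1: "trace B = of_int y" "trace ?C = of_int z" "trace (B ** ?C) = of_int x" using r1 less.prems by auto
  have tr2: "trace ?C = of_int z" "trace (adj2 (B ** ?C)) = of_int x" "trace (?C ** adj2 (B ** ?C)) = of_int y"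
    using r2 tr1 by auto
  have eq1: "y\<^sup>2 + z\<^sup>2 + x\<^sup>2 = y * z * x" and eq2: "z\<^sup>2 + x\<^sup>2 + y\<^sup>2 = z * x * y"
    using less.prems(9) by (simp_all add: algebra_simps)
  consider "x \<le> z" "y \<le> z" | "y \<le> x" "z \<le> x" | "x \<le> y" "z \<le> y" by linarith
  then show ?case
  proof cases
    case 1
    then show ?thesis using step[OF less.prems(1-9)] by simp
  next
    case 2
    then show ?thesis using step[OF dC tr1 less.prems(7,8,6) eq1] r1 by (simp add: reduces_to_333_def add_ac)
  next
    case 3
    have "det (adj2 (B ** ?C)) = 1" using r2 by simp
    from step[OF dC(2) this tr2 less.prems(8,6,7) eq2] 3 r1 r2 show ?thesis by (simp add: reduces_to_333_def add_ac)
  qed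
qed

lemma singular_kernel:
  fixes p q r s :: real
  assumes "p * s - q * r = 0"
  obtains u v where "u \<noteq> 0 \<or> v \<noteq> 0" "p * u + q * v = 0" "r * u + s * v = 0"
proof (cases "p = 0 \<and> q = 0")
  case True
  show thesis
  proof (cases "r = 0 \<and> s = 0")
    case True
    then show ?thesis using \<open>p = 0 \<and> q = 0\<close> by (intro that[of 1 0]) auto
  next
    case False
    then show ?thesis using \<open>p = 0 \<and> q = 0\<close> by (intro that[of "- s" r]) auto
  qed
next
  case False
  then show thesis using assms by (intro that[of "- q" p]) (auto simp: algebra_simps)
qed

text \<open>The commutator of a pair with traces \<open>3, 3, 3\<close> is parabolic; its fixed direction is \<open>B A w\<close> with
  \<open>w\<close> in the kernel of \<open>A B + B A = 3 (A + B - 2)\<close>, and the traces determine \<open>A\<close> and \<open>B\<close> in the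
  basis \<open>w, A w\<close>.\<close>
lemma traces_333_conjugate:
  fixes A B :: "real^2^2"
  assumes "det A = 1" "det B = 1" "trace A = 3" "trace B = 3" "trace (A ** B) = 3"
  obtains g where "det g \<noteq> 0" "A ** g = g ** A0" "B ** g = g ** B0"
proof -
  define a b c d where "a = A$1$1" and "b = A$1$2" and "c = A$2$1" and "d = A$2$2"
  define a' b' c' d' where "a' = B$1$1" and "b' = B$1$2" and "c' = B$2$1" and "d' = B$2$2"
  note defs = a_def b_def c_def d_def a'_def b'_def c'_def d'_def
  have d: "d = 3 - a" and d': "d' = 3 - a'" using assms(3,4) by (simp_all add: trace_2 defs)
  have det: "a * (3 - a) - b * c = 1" "a' * (3 - a') - b' * c' = 1"
    using assms(1,2) d d' by (simp_all add: det_2 defs)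
  have trAB: "a * a' + b * c' + c * b' + (3 - a) * (3 - a') = 3"
    using assms(5) d d' by (simp add: trace_2 defs)
  \<comment> \<open>This says \<open>det (A + B - 2) = 0\<close>: \<open>det (A + B)\<close> is
    \<open>2 + trace (A ** adj2 B) = 8\<close>, and subtracting 2 on the diagonal changes it by
    \<open>- 2 * 6 + 4\<close>.\<close>
  have "(a + a' - 2) * (d + d' - 2) - (b + b') * (c + c') = 0"
    using det trAB unfolding d d' by (simp add: algebra_simps)
  then obtain u v where uv: "u \<noteq> 0 \<or> v \<noteq> 0" "(a + a' - 2) * u + (b + b') * v = 0" "(c + c') * u + (d + d' - 2) * v = 0"
    by (rule singular_kernel)
  \<comment> \<open>\<open>(u, v)\<close> is \<open>w\<close> and \<open>(e, f)\<close> is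
    \<open>A w\<close>.\<close>
  define e f where "e = a * u + b * v" and "f = c * u + d * v"
  have Aef: "a * e + b * f = 3 * e - u" "c * e + d * f = 3 * f - v"
    using det(1) unfolding e_def f_def d by algebra+
  have Buv: "a' * u + b' * v = 2 * u - e" "c' * u + d' * v = 2 * v - f"
    using uv(2,3) by (simp_all add: e_def f_def algebra_simps)
  have Bef: "a' * e + b' * f = e - u" "c' * e + d' * f = f - v"
    using Buv det trAB unfolding e_def f_def d d' by algebra+
  \<comment> \<open>If \<open>w\<close> and \<open>A w\<close> were dependent, \<open>w\<close>
    would be a common eigenvector. The formulas for \<open>A\<close> and \<open>B\<close> on it
    force \<open>\<mu> = 1\<close>, which is no root of the characteristic polynomial of
    \<open>A\<close>.\<close>
  have ne: "u * f - e * v \<noteq> 0"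
  proof
    assume 0: "u * f - e * v = 0"
    obtain \<mu> where mu: "e = \<mu> * u" "f = \<mu> * v"
    proof (cases "u = 0")
      case True
      then show ?thesis using 0 uv(1) by (intro that[of "f / v"]) auto
    next
      case False
      then show ?thesis using 0 by (intro that[of "e / u"]) (auto simp: field_simps)
    qed
    have "(\<mu> * \<mu> - 3 * \<mu> + 1) * u = 0" "(\<mu> * \<mu> - 3 * \<mu> + 1) * v = 0"
      using Aef mu unfolding e_def f_def by algebra+
    then have m1: "\<mu> * \<mu> - 3 * \<mu> + 1 = 0" using uv(1) by auto
    have "(\<mu> * (2 - \<mu>) - \<mu> + 1) * u = 0" "(\<mu> * (2 - \<mu>) - \<mu> + 1) * v = 0"
      using Bef Buv unfolding mu by algebra+
    then have "\<mu> * (2 - \<mu>) - \<mu> + 1 = 0" using uv(1) by auto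
    with m1 have "\<mu> = 1" by (simp add: algebra_simps)
    with m1 show False by simp
  qed
  let ?g = "mk2 u e v f"
  have A: "A = mk2 a b c d" and B: "B = mk2 a' b' c' d'" by (simp_all add: mat2_eq_iff defs)
  show thesis
  proof (rule that[of ?g])
    show "det ?g \<noteq> 0" using ne by (simp add: det_2)
    show "A ** ?g = ?g ** A0"
      using Aef by (simp add: A mat2_eq_iff e_def[symmetric] f_def[symmetric])
    show "B ** ?g = ?g ** B0"
      using Buv Bef by (simp add: B mat2_eq_iff)
  qed
qed

section \<open>The arithmetic model given by integral matrices\<close>

lemma finite_rcosets:
  assumes "group G" "subgroup H G" "finite T" "T \<subseteq> carrier G"
    and "\<And>k. k \<in> K \<Longrightarrow> \<exists>h\<in>H. \<exists>t\<in>T. k = h \<otimes>\<^bsub>G\<^esub> t"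
  shows "finite (rcosets\<^bsub>G\<lparr>carrier := K\<rparr>\<^esub> H)"
proof -
  interpret group G by (rule assms(1))
  have "rcosets\<^bsub>G\<lparr>carrier := K\<rparr>\<^esub> H \<subseteq> (\<lambda>t. H #>\<^bsub>G\<^esub> t) ` T"
  proof
    fix X assume "X \<in> rcosets\<^bsub>G\<lparr>carrier := K\<rparr>\<^esub> H"
    then obtain k where k: "k \<in> K" "X = H #>\<^bsub>G\<^esub> k" by (auto simp: RCOSETS_def r_coset_def)
    then obtain h t where "h \<in> H" "t \<in> T" "k = h \<otimes>\<^bsub>G\<^esub> t" using assms(5) by blast
    moreover from this have "H #>\<^bsub>G\<^esub> (h \<otimes>\<^bsub>G\<^esub> t) = H #>\<^bsub>G\<^esub> t"
      using assms(2,4) subgroup.subset[OF assms(2)] 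
      by (subst coset_mult_assoc[symmetric]) (auto simp: coset_join2)
    ultimately show "X \<in> (\<lambda>t. H #>\<^bsub>G\<^esub> t) ` T" using k by auto
  qed
  then show ?thesis using assms(3) finite_surj by blast
qed

lemma vector_4 [simp]:
  "(vector [a, b, c, d] :: 'a::zero^4)$1 = a" "(vector [a, b, c, d] :: 'a^4)$2 = b"
  "(vector [a, b, c, d] :: 'a^4)$3 = c" "(vector [a, b, c, d] :: 'a^4)$4 = d"
  unfolding vector_def by simp_all

lemma scaled_adj2_inverse:
  assumes "det g \<noteq> 0"
  shows "((1 / det g) *\<^sub>R adj2 g) ** g = mat 1" "g ** ((1 / det g) *\<^sub>R adj2 g) = mat 1"
proof -
  have "adj2 g ** g = det g *\<^sub>R mat 1" "g ** adj2 g = det g *\<^sub>R mat 1"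
    by (simp_all add: mat2_eq_iff det_2 algebra_simps)
  moreover have "(c *\<^sub>R M) ** N = c *\<^sub>R (M ** N)" "M ** (c *\<^sub>R N) = c *\<^sub>R (M ** N)"
    for c and M N :: "real^2^2" by (simp_all add: mat2_eq_iff algebra_simps)
  ultimately show "((1 / det g) *\<^sub>R adj2 g) ** g = mat 1" "g ** ((1 / det g) *\<^sub>R adj2 g) = mat 1"
    using assms by simp_all
qed

text \<open>The split algebra with parameters 1, 1 as a matrix algebra: \<open>i\<close> is diagonal
  with entries 1 and -1, and \<open>j\<close> exchanges the coordinates.\<close>

definition quat_mat :: "real^4 \<Rightarrow> real^2^2" where
  "quat_mat x = mk2 (x$1 + x$2) (x$3 + x$4) (x$3 - x$4) (x$1 - x$2)"

lemma quat_mat_mult: "quat_mat (quat_mult 1 1 x y) = quat_mat x ** quat_mat y"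
  by (simp add: quat_mat_def quat_mult_def mat2_eq_iff algebra_simps)

lemma quat_mat_diff: "quat_mat (x - y) = quat_mat x - quat_mat y"
  by (simp add: quat_mat_def mat2_eq_iff)

lemma det_quat_mat: "det (quat_mat x) = reduced_norm 1 1 x"
  by (simp add: quat_mat_def reduced_norm_def det_2 power2_eq_square algebra_simps)

lemma vec4_eq_iff: "x = y \<longleftrightarrow> x$1 = y$1 \<and> x$2 = y$2 \<and> x$3 = y$3 \<and> x$4 = (y :: real^4)$4"
  by (auto simp: vec_eq_iff forall_4)

definition mat_quat :: "real^2^2 \<Rightarrow> real^4" where
  "mat_quat M = vector [(M$1$1 + M$2$2) / 2, (M$1$1 - M$2$2) / 2, (M$1$2 + M$2$1) / 2, (M$1$2 - M$2$1) / 2]"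

lemma quat_mat_mat_quat [simp]: "quat_mat (mat_quat M) = M"
  by (simp add: quat_mat_def mat_quat_def mat2_eq_iff field_simps)

lemma mat_quat_quat_mat [simp]: "mat_quat (quat_mat x) = x"
  by (simp add: quat_mat_def mat_quat_def vec4_eq_iff)

text \<open>Conjugation by \<open>g\<close> is built into the identification with matrices, because
  \<open>det g\<close> may be negative and then no conjugation in PSL(2,R) has the same
  effect.\<close>

lemma algebra_iso_quat_mat:
  assumes "det g \<noteq> 0"
  shows "algebra_iso (quat_mult 1 1) (**) (\<lambda>x. g ** quat_mat x ** ((1 / det g) *\<^sub>R adj2 g))"
    (is "algebra_iso _ _ ?f")
proof -
  let ?h = "(1 / det g) *\<^sub>R adj2 g"
  note inv = scaled_adj2_inverse[OF assms]
  have lin: "linear ?f"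
    by (rule linearI) (simp_all add: mat2_eq_iff quat_mat_def algebra_simps)
  have "bij ?f"
  proof (rule bij_betw_byWitness[of _ "\<lambda>M. mat_quat (?h ** M ** g)"])
    have "?h ** (g ** quat_mat x ** ?h) ** g = (?h ** g) ** quat_mat x ** (?h ** g)" for x
      by (simp only: matrix_mul_assoc)
    then show "\<forall>x\<in>UNIV. mat_quat (?h ** ?f x ** g) = x" by (simp only: inv) simp
    have "g ** (?h ** M ** g) ** ?h = (g ** ?h) ** M ** (g ** ?h)" for M
      by (simp only: matrix_mul_assoc)
    then show "\<forall>M\<in>UNIV. ?f (mat_quat (?h ** M ** g)) = M" by (simp only: quat_mat_mat_quat inv) simp
  qed auto
  moreover have "?f (quat_mult 1 1 x y) = ?f x ** ?f y" for x y
  proof -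
    have "?f x ** ?f y = g ** quat_mat x ** (?h ** g) ** quat_mat y ** ?h" by (simp only: matrix_mul_assoc)
    then show ?thesis by (simp only: inv quat_mat_mult) (simp add: matrix_mul_assoc)
  qed
  ultimately show ?thesis using lin unfolding algebra_iso_def by blast
qed

lemma real_number_field_Rats: "real_number_field \<rat>"
  unfolding real_number_field_def
proof (intro conjI ballI)
  have "(\<rat> :: real set) = range (\<lambda>c :: real \<Rightarrow> rat. of_rat (c 1) * 1)"
  proof
    show "(\<rat> :: real set) \<subseteq> range (\<lambda>c :: real \<Rightarrow> rat. of_rat (c 1) * 1)"
    proof
      fix x :: real assume "x \<in> \<rat>"
      then obtain r where "x = of_rat r" by (auto elim: Rats_cases)
      then show "x \<in> range (\<lambda>c :: real \<Rightarrow> rat. of_rat (c 1) * 1)" by (intro image_eqI[of _ _ "\<lambda>_. r"]) auto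
    qed
  qed auto
  then show "\<exists>B. finite B \<and> \<rat> = range (\<lambda>c :: real \<Rightarrow> rat. \<Sum>b\<in>B. of_rat (c b) * b)"
    by (intro exI[of _ "{1}"]) simp
qed auto

lemma field_embedding_Rats:
  fixes \<sigma> :: "real \<Rightarrow> 'b::field_char_0"
  assumes "field_embedding \<rat> \<sigma>"
  shows "\<sigma> (of_rat r) = of_rat r"
proof -
  have "subfield_hom \<rat> \<sigma>" using assms unfolding field_embedding_def by unfold_locales auto
  then show ?thesis by (rule hom_of_rat)
qed

text \<open>The order of integral matrices; its quaternion coordinates are half-integers in
  general.\<close>

definition matrix_order :: "(real^4) set" where
  "matrix_order = {x. integral_mat (quat_mat x)}"

lemma quat_order_matrix_order: "quat_order \<rat> 1 1 matrix_order"
  unfolding quat_order_def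
proof (intro conjI ballI)
  show "matrix_order \<subseteq> quat_points \<rat>"
  proof
    fix x assume "x \<in> matrix_order"
    then have *: "quat_mat x $ i $ j \<in> \<rat>" for i j
      using Ints_subset_Rats exhaust_2[of i] exhaust_2[of j] by (auto simp: matrix_order_def integral_mat_def)
    have "mat_quat (quat_mat x) $ i \<in> \<rat>" for i
      using exhaust_4[of i] * unfolding mat_quat_def by auto
    then show "x \<in> quat_points \<rat>" by (simp add: quat_points_def)
  qed
  show "quat_one \<in> matrix_order" by (simp add: matrix_order_def integral_mat_def quat_mat_def quat_one_def)
  fix x y assume xy: "x \<in> matrix_order" "y \<in> matrix_order"
  then show "x - y \<in> matrix_order" 
    unfolding matrix_order_def mem_Collect_eq quat_mat_diff by (simp add: integral_mat_def)
  show "quat_mult 1 1 x y \<in> matrix_order"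
    using xy unfolding matrix_order_def mem_Collect_eq quat_mat_mult by (simp add: integral_mat_def)
next
  let ?E = "\<lambda>a b c d. mat_quat (mk2 a b c d)"
  let ?e1 = "?E 1 0 0 0" and ?e2 = "?E 0 1 0 0" and ?e3 = "?E 0 0 1 0" and ?e4 = "?E 0 0 0 1"
  let ?B = "{?e1, ?e2, ?e3, ?e4}"
  have inj: "mat_quat M = mat_quat N \<longleftrightarrow> M = N" for M N by (metis quat_mat_mat_quat)
  have sum: "(\<Sum>b\<in>?B. of_int (c b) *\<^sub>R b) = ?E (of_int (c ?e1)) (of_int (c ?e2)) (of_int (c ?e3)) (of_int (c ?e4))"
    for c :: "real^4 \<Rightarrow> int"
  proof -
    have "(\<Sum>b\<in>?B. of_int (c b) *\<^sub>R b) = of_int (c ?e1) *\<^sub>R ?e1 + of_int (c ?e2) *\<^sub>R ?e2 + of_int (c ?e3) *\<^sub>R ?e3 + of_int (c ?e4) *\<^sub>R ?e4"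
      by (simp add: inj mat2_eq_iff)
    also have "\<dots> = ?E (of_int (c ?e1)) (of_int (c ?e2)) (of_int (c ?e3)) (of_int (c ?e4))"
      by (simp only: vec4_eq_iff) (simp add: mat_quat_def field_simps)
    finally show ?thesis .
  qed
  have "matrix_order = range (\<lambda>c :: real^4 \<Rightarrow> int. \<Sum>b\<in>?B. of_int (c b) *\<^sub>R b)"
  proof
    show "range (\<lambda>c :: real^4 \<Rightarrow> int. \<Sum>b\<in>?B. of_int (c b) *\<^sub>R b) \<subseteq> matrix_order"
      unfolding sum by (auto simp: matrix_order_def integral_mat_def)
    show "matrix_order \<subseteq> range (\<lambda>c :: real^4 \<Rightarrow> int. \<Sum>b\<in>?B. of_int (c b) *\<^sub>R b)"
    proof
      fix x assume "x \<in> matrix_order"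
      then obtain a b c d where "quat_mat x $1$1 = of_int a" "quat_mat x $1$2 = of_int b"
        "quat_mat x $2$1 = of_int c" "quat_mat x $2$2 = of_int d"
        by (auto simp: matrix_order_def integral_mat_def elim!: Ints_cases)
      then have "quat_mat x = imat a b c d" by (simp add: mat2_eq_iff)
      then have x: "x = ?E (of_int a) (of_int b) (of_int c) (of_int d)" by (metis mat_quat_quat_mat)
      define C where "C = (\<lambda>z. if z = ?e1 then a else if z = ?e2 then b else if z = ?e3 then c else d)"
      have "C ?e1 = a" "C ?e2 = b" "C ?e3 = c" "C ?e4 = d" by (simp_all add: C_def inj mat2_eq_iff)
      then show "x \<in> range (\<lambda>c :: real^4 \<Rightarrow> int. \<Sum>b\<in>?B. of_int (c b) *\<^sub>R b)"
        unfolding sum x by (intro image_eqI[of _ _ C]) auto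
    qed
  qed
  then show "\<exists>B. finite B \<and> matrix_order = range (\<lambda>c :: real^4 \<Rightarrow> int. \<Sum>b\<in>B. of_int (c b) *\<^sub>R b)"
    by (intro exI[of _ ?B]) simp
next
  fix x assume x: "x \<in> quat_points \<rat>"
  have den: "\<exists>n::nat. n > 0 \<and> of_nat n * r \<in> \<int>" if "r \<in> \<rat>" for r :: real
  proof -
    from that obtain a b where "b > 0" "Rings.coprime a b" "r = of_int a / of_int b" by (rule Rats_cases')
    then show ?thesis by (intro exI[of _ "nat b"]) auto
  qed
  have "\<forall>i. \<exists>n::nat. n > 0 \<and> of_nat n * x$i \<in> \<int>" using den x by (simp add: quat_points_def)
  from choice[OF this] obtain n where n: "\<And>i. n i > (0::nat)" "\<And>i. of_nat (n i) * x$i \<in> \<int>"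
    by blast
  define m where "m = n 1 * n 2 * n 3 * n 4"
  have m: "of_nat m * x$i \<in> \<int>" for i
  proof -
    have "\<exists>k. m = k * n i" 
      using exhaust_4[of i] by (auto simp: m_def intro: exI[of _ "n 2 * n 3 * n 4"] exI[of _ "n 1 * n 3 * n 4"]
          exI[of _ "n 1 * n 2 * n 4"] exI[of _ "n 1 * n 2 * n 3"])
    then obtain k where "m = k * n i" by blast
    then have "of_nat m * x$i = of_nat k * (of_nat (n i) * x$i)" by simp
    also have "\<dots> \<in> \<int>" by (intro Ints_mult n(2)) simp
    finally show ?thesis .
  qed
  have "m > 0" using n(1) by (simp add: m_def)
  moreover have "of_nat m *\<^sub>R x \<in> matrix_order"
    using m by (simp add: matrix_order_def integral_mat_def quat_mat_def)
  ultimately show "\<exists>n::nat. n > 0 \<and> of_nat n *\<^sub>R x \<in> matrix_order" by blast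
qed

text \<open>The base field is the rationals, whose only embedding is the identity, so there is no
  further real place at which ramification has to be checked.\<close>

lemma arithmetic_model_SL2Z:
  assumes "det g \<noteq> 0"
  shows "arithmetic_model ((\<lambda>N. psl_class (g ** N ** ((1 / det g) *\<^sub>R adj2 g))) ` {N. integral_mat N \<and> det N = 1})"
proof -
  let ?\<theta> = "\<lambda>x. g ** quat_mat x ** ((1 / det g) *\<^sub>R adj2 g)"
  have "totally_real \<rat>"
    unfolding totally_real_def
  proof (intro allI impI)
    fix \<sigma> :: "real \<Rightarrow> complex" assume "field_embedding \<rat> \<sigma>"
    moreover have "complex_of_rat r \<in> \<real>" for r by (cases r) (simp add: of_rat_rat)
    ultimately show "\<sigma> ` \<rat> \<subseteq> \<real>" by (auto simp: field_embedding_Rats elim!: Rats_cases)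
  qed
  moreover have "\<sigma> x = x" if "field_embedding \<rat> \<sigma>" "x \<in> \<rat>" for \<sigma> :: "real \<Rightarrow> real" and x
    using that by (auto simp: field_embedding_Rats elim!: Rats_cases)
  moreover have "(\<lambda>N. psl_class (g ** N ** ((1 / det g) *\<^sub>R adj2 g))) ` {N. integral_mat N \<and> det N = 1} =
     (\<lambda>x. psl_class (?\<theta> x)) ` {x \<in> matrix_order. reduced_norm 1 1 x = 1}"
  proof -
    have "{N. integral_mat N \<and> det N = 1} = quat_mat ` {x \<in> matrix_order. reduced_norm 1 1 x = 1}"
    proof
      show "{N. integral_mat N \<and> det N = 1} \<subseteq> quat_mat ` {x \<in> matrix_order. reduced_norm 1 1 x = 1}"
      proof
        fix N assume "N \<in> {N. integral_mat N \<and> det N = 1}"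
        then show "N \<in> quat_mat ` {x \<in> matrix_order. reduced_norm 1 1 x = 1}"
          by (intro image_eqI[of _ _ "mat_quat N"]) (auto simp: matrix_order_def simp flip: det_quat_mat)
      qed
    qed (auto simp: matrix_order_def det_quat_mat)
    then show ?thesis by (simp add: image_image)
  qed
  ultimately show ?thesis
    unfolding arithmetic_model_def
    using real_number_field_Rats quat_order_matrix_order algebra_iso_quat_mat[OF assms]
    by (intro exI[of _ \<rat>] exI[of _ 1] exI[of _ matrix_order] exI[of _ ?\<theta>]) auto
qed

text \<open>Conjugation by \<open>g\<close> carries \<open>G0\<close> onto the group of
  \<open>A\<close> and \<open>B\<close>, and the integral matrices onto the model. So
  \<open>\<Gamma>\<close> lies in \<open>\<Delta>\<close>, and the six conjugated shears meet all
  its cosets there.\<close>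

lemma arithmetic_group_traces_333:
  assumes \<Gamma>: "subgroup \<Gamma> PSL2R" and gen: "psl_preimage \<Gamma> = matrix_group A B"
    and AB: "det A = 1" "det B = 1" "trace A = 3" "trace B = 3" "trace (A ** B) = 3"
  shows "arithmetic_group \<Gamma>"
proof -
  obtain g where g: "det g \<noteq> 0" "A ** g = g ** A0" "B ** g = g ** B0"
    using traces_333_conjugate[OF AB] by blast
  define h where "h = (1 / det g) *\<^sub>R adj2 g"
  have inv: "h ** g = mat 1" "g ** h = mat 1"
    unfolding h_def by (fact scaled_adj2_inverse[OF g(1)])+
  define c where "c N = g ** N ** h" for N
  have c_mult: "c (M ** N) = c M ** c N" for M N
  proof -
    have "c M ** c N = g ** M ** (h ** g) ** N ** h" by (simp only: c_def matrix_mul_assoc)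
    then show ?thesis by (simp only: inv c_def) (simp add: matrix_mul_assoc)
  qed
  have c_one: "c (mat 1) = mat 1" by (simp add: c_def inv)
  have c_neg: "c (- N) = - c N" for N by (simp add: c_def)
  have det_c: "det (c N) = det N" for N
  proof -
    have "det (c N) = det N * (det g * det h)" by (simp add: c_def det_mul)
    also have "det g * det h = 1" using arg_cong[OF inv(2), of det] by (simp add: det_mul)
    finally show ?thesis by simp
  qed
  have c_adj: "c (adj2 N) = adj2 (c N)" if "det N = 1" for N
  proof -
    have "adj2 (c N) ** (c N ** c (adj2 N)) = c (adj2 N)" using that by (simp add: adj2_cancel det_c)
    then show ?thesis using that by (simp add: adj2_inverse c_one flip: c_mult)
  qed
  have cA: "c A0 = A" "c B0 = B"
    using g(2,3) inv by (simp_all add: c_def flip: g(2,3)) (simp_all flip: matrix_mul_assoc)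
  have mg: "c N \<in> matrix_group A B" if "N \<in> G0" for N
    using that
  proof (induction rule: matrix_group.induct)
    case (adj M)
    then show ?case using G0_integral by (auto simp: c_adj intro: matrix_group.adj)
  qed (auto simp: c_one c_mult c_neg cA intro: matrix_group.intros)
  have mg': "M \<in> c ` G0" if "M \<in> matrix_group A B" for M
    using that
  proof (induction rule: matrix_group.induct)
    case one
    show ?case using c_one matrix_group.one by (metis imageI)
  next
    case gen1
    show ?case using cA matrix_group.gen1 by (metis imageI)
  next
    case gen2
    show ?case using cA matrix_group.gen2 by (metis imageI)
  next
    case (mult M N)
    then show ?case using c_mult matrix_group.mult by (auto simp flip: c_mult)
  next
    case (adj M)
    then obtain N where N: "M = c N" "N \<in> G0" by auto
    then have "adj2 M = c (adj2 N)" using G0_integral by (simp add: c_adj)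
    then show ?case using matrix_group.adj[OF N(2)] by simp
  next
    case (neg M)
    then obtain N where N: "M = c N" "N \<in> G0" by auto
    then have "- M = c (- N)" by (simp add: c_neg)
    then show ?case using matrix_group.neg[OF N(2)] by simp
  qed
  define \<Delta> where "\<Delta> = (\<lambda>N. psl_class (c N)) ` {N. integral_mat N \<and> det N = 1}"
  have model: "arithmetic_model \<Delta>"
    using arithmetic_model_SL2Z[OF g(1)] by (simp add: \<Delta>_def c_def h_def)
  have \<Delta>_carrier: "\<Delta> \<subseteq> carrier PSL2R" by (auto simp: \<Delta>_def carrier_PSL2R det_c)
  have \<Gamma>_eq: "\<Gamma> = psl_class ` matrix_group A B" using psl_preimage(6)[OF \<Gamma>] gen by simp
  have sub: "\<Gamma> \<subseteq> \<Delta>"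
  proof
    fix P assume "P \<in> \<Gamma>"
    then obtain N where "P = psl_class (c N)" "N \<in> G0" using mg' by (auto simp: \<Gamma>_eq)
    then show "P \<in> \<Delta>" using G0_integral by (auto simp: \<Delta>_def)
  qed
  interpret P: group PSL2R by (rule group_PSL2R)
  \<comment> \<open>\<open>g\<close> is already part of the model, so the conjugating element is the
    identity.\<close>
  have conj: "(\<lambda>h. \<one>\<^bsub>PSL2R\<^esub> \<otimes>\<^bsub>PSL2R\<^esub> h \<otimes>\<^bsub>PSL2R\<^esub> inv\<^bsub>PSL2R\<^esub> \<one>\<^bsub>PSL2R\<^esub>) ` \<Delta> = \<Delta>"
    using \<Delta>_carrier by (force simp: image_iff subset_iff)
  have "commensurable PSL2R \<Gamma> \<Delta>"
    unfolding commensurable_def Int_absorb2[OF sub]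
  proof
    show "finite (rcosets\<^bsub>PSL2R\<lparr>carrier := \<Gamma>\<rparr>\<^esub> \<Gamma>)"
    proof (rule finite_rcosets[OF group_PSL2R \<Gamma>, of "{\<one>\<^bsub>PSL2R\<^esub>}"])
      fix k assume "k \<in> \<Gamma>"
      then have "k = k \<otimes>\<^bsub>PSL2R\<^esub> \<one>\<^bsub>PSL2R\<^esub>" using subgroup.mem_carrier[OF \<Gamma>] by simp
      with \<open>k \<in> \<Gamma>\<close> show "\<exists>h\<in>\<Gamma>. \<exists>t\<in>{\<one>\<^bsub>PSL2R\<^esub>}. k = h \<otimes>\<^bsub>PSL2R\<^esub> t" by blast
    qed auto
    let ?T = "(\<lambda>i. psl_class (c (shear i))) ` {0..<6}"
    show "finite (rcosets\<^bsub>PSL2R\<lparr>carrier := \<Delta>\<rparr>\<^esub> \<Gamma>)"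
    proof (rule finite_rcosets[OF group_PSL2R \<Gamma>, of ?T])
      have "det (c (shear i)) = 1" for i unfolding det_c by (simp add: shear_def det_2)
      then show "?T \<subseteq> carrier PSL2R" by (auto simp: carrier_PSL2R)
      fix k assume "k \<in> \<Delta>"
      then obtain N where N: "k = psl_class (c N)" "integral_mat N" "det N = 1" by (auto simp: \<Delta>_def)
      then have "N \<in> cosets_reached" by (intro integral_mat_cosets_reached)
      then obtain M i where M: "N = M ** shear i" "M \<in> G0" "0 \<le> i" "i < 6"
        unfolding cosets_reached_def by blast
      then have "k = psl_class (c M) \<otimes>\<^bsub>PSL2R\<^esub> psl_class (c (shear i))" by (simp add: N(1) c_mult psl_class_mult)
      then show "\<exists>h\<in>\<Gamma>. \<exists>t\<in>?T. k = h \<otimes>\<^bsub>PSL2R\<^esub> t" 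
        using mg[OF M(2)] M(3,4) unfolding \<Gamma>_eq
        by (intro bexI[of _ "psl_class (c M)"] bexI[of _ "psl_class (c (shear i))"] imageI) auto
    qed simp
  qed
  then show ?thesis unfolding arithmetic_group_def using model conj P.one_closed by metis
qed

theorem theorem1p8:
  fixes d :: "complex \<times> complex \<Rightarrow> complex \<times> complex \<Rightarrow> real"
    and x0 :: "complex \<times> complex"
    and a b :: "(real \<Rightarrow> complex \<times> complex) set"
  assumes "x0 \<in> punctured_torus"
    and "standard_generators x0 a b"
    and "complete_hyperbolic_metric punctured_torus d"
    and "surface_area punctured_torus d < \<infinity>"
    and "geometric_Salem (Tr punctured_torus d a)"
    and "geometric_Salem (Tr punctured_torus d b)"
    and "geometric_Salem (Tr punctured_torus d (a \<otimes>\<^bsub>fundamental_group punctured_torus x0\<^esub> b))"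
  shows "arithmetic_metric punctured_torus d"
  unfolding arithmetic_metric_def
proof (intro allI impI)
  fix p \<Gamma> assume unif: "uniformizes punctured_torus d p \<Gamma>"
  interpret uniformization punctured_torus d p \<Gamma> by unfold_locales (rule unif)
  obtain z0 where z0: "Im z0 > 0" "p z0 = x0"
    using covering_space_imp_surjective[OF covering] assms(1) by (metis imageE upper_half_iff)
  have basis: "{a, b} \<subseteq> carrier (pi1 z0)" "generate (pi1 z0) {a, b} = carrier (pi1 z0)"
    using assms(2) unfolding z0(2) standard_generators_def free_basis_def by blast+
  have metric: "Metric_space punctured_torus d" "Metric_space.mtopology punctured_torus d = top_of_set punctured_torus"
    using assms(3) by (auto simp: complete_hyperbolic_metric_def)
  have Tr_eq: "Tr punctured_torus d \<gamma> = \<bar>trace M\<bar>" 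
    if "holonomy z0 \<gamma> M" "geometric_Salem (Tr punctured_torus d \<gamma>)" for \<gamma> M
    using that by (intro Tr_holonomy[OF metric]) 
      (auto simp: geometric_Salem_def intro: path_imp_free_holonomy holonomy_imp_path_holonomy)
  \<comment> \<open>Of the two matrices that differ by sign, the one with positive trace is taken,
    independently for \<open>a\<close> and \<open>b\<close>.\<close>
  have pos_rep: "\<exists>M. holonomy z0 \<gamma> M \<and> trace M = Tr punctured_torus d \<gamma>"
    if \<gamma>: "\<gamma> \<in> carrier (pi1 z0)" "geometric_Salem (Tr punctured_torus d \<gamma>)" for \<gamma>
  proof -
    obtain M where M: "holonomy z0 \<gamma> M" using holonomy_ex[OF \<gamma>(1) z0(1)] by blast
    have "holonomy z0 \<gamma> (- M)" using M G_closed(5) by (auto simp: holonomy_def path_holonomy_def)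
    moreover have "trace M = Tr punctured_torus d \<gamma> \<or> trace (- M) = Tr punctured_torus d \<gamma>"
      using Tr_eq[OF M \<gamma>(2)] by (auto simp: abs_if)
    ultimately show ?thesis using M by blast
  qed
  obtain A where A: "holonomy z0 a A" "trace A = Tr punctured_torus d a" using pos_rep basis assms(5) by blast
  obtain B where B: "holonomy z0 b B" "trace B = Tr punctured_torus d b" using pos_rep basis assms(6) by blast
  have AB: "holonomy z0 (a \<otimes>\<^bsub>pi1 z0\<^esub> b) (A ** B)" using holonomy_mult[OF A(1) B(1) z0(1)] .
  have Salem: "geometric_Salem (trace A)" "geometric_Salem (trace B)" using A B assms(5,6) by simp_all
  have absAB: "\<bar>trace (A ** B)\<bar> = Tr punctured_torus d (a \<otimes>\<^bsub>pi1 z0\<^esub> b)"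
    using Tr_eq[OF AB] assms(7) by (simp add: z0)
  have det: "det A = 1" "det B = 1" using A B holonomy_G G_closed(1) by blast+
  have "trace (A ** B ** adj2 A ** adj2 B) = -2"
    by (rule trace_commutator_punctured_torus[OF unif assms(4) _ z0(1) A(1) B(1)]) (use assms(2) z0(2) in simp)
  then have eq: "(trace A)\<^sup>2 + (trace B)\<^sup>2 + (trace (A ** B))\<^sup>2 = trace A * trace B * trace (A ** B)"
    using trace_commutator[OF det] by simp
  have gt: "trace A > 2" "trace B > 2" using Salem by (auto simp: geometric_Salem_def)
  \<comment> \<open>The sign of \<open>A ** B\<close> is no longer free, but the left side of the
    equation is positive, and so is the product on the right.\<close>
  have "trace (A ** B) > 0"
  proof (rule ccontr)
    assume "\<not> ?thesis"
    then have "trace A * trace B * trace (A ** B) \<le> 0" using gt by (intro mult_nonneg_nonpos) auto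
    moreover have "(trace A)\<^sup>2 > 0" using gt by simp
    ultimately show False using eq zero_le_power2[of "trace B"] zero_le_power2[of "trace (A ** B)"] by linarith
  qed
  then have "geometric_Salem (trace (A ** B))" using absAB assms(7) by (simp add: z0)
  note Salem = Salem this
  have ints: "trace A \<in> \<int>" "trace B \<in> \<int>" "trace (A ** B) \<in> \<int>"
  proof -
    show "trace A \<in> \<int>" by (rule Salem_Markov_triple_integral[OF Salem eq])
    show "trace B \<in> \<int>" by (rule Salem_Markov_triple_integral[OF Salem(2,3,1)]) (use eq in \<open>simp add: algebra_simps\<close>)
    show "trace (A ** B) \<in> \<int>" by (rule Salem_Markov_triple_integral[OF Salem(3,1,2)]) (use eq in \<open>simp add: algebra_simps\<close>)
  qed
  then obtain x y z where xyz: "trace A = of_int x" "trace B = of_int y" "trace (A ** B) = of_int z"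
    by (auto elim!: Ints_cases)
  have "of_int (x\<^sup>2 + y\<^sup>2 + z\<^sup>2) = (of_int (x * y * z) :: real)" using eq by (simp add: xyz)
  then have "x\<^sup>2 + y\<^sup>2 + z\<^sup>2 = x * y * z" by (simp only: of_int_eq_iff)
  moreover have "x > 0" "y > 0" "z > 0" using gt \<open>trace (A ** B) > 0\<close> by (auto simp: xyz)
  ultimately obtain A' B' where "det A' = 1" "det B' = 1" "trace A' = 3" "trace B' = 3" "trace (A' ** B') = 3"
    "matrix_group A' B' = matrix_group A B"
    using Nielsen_reduction[OF det xyz] unfolding reduces_to_333_def by blast
  moreover have "psl_preimage \<Gamma> = matrix_group A B" by (rule G_eq_matrix_group[OF z0(1) basis(2) A(1) B(1)])
  ultimately show "arithmetic_group \<Gamma>" by (intro arithmetic_group_traces_333[OF subgroup_\<Gamma>]) simp_all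
qed

end
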